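(* Let $X$ be an SCLCS, let $n\ge2$, and let $f:[0,+\infty)^n\to X$ be a locally integrable function. Put $$G(t_1,\dots,t_n):=\int_0^{t_1}\!\!\cdots\int_0^{t_n}f(s_1,\dots,s_n)\,ds_1\cdots ds_n,\qquad (t_1,\dots,t_n)\in[0,+\infty)^n .$$ For $(\lambda_1^0,\dots,\lambda_n^0)\in\mathbb C^n$, consider the following property (P): for each seminorm $p\in\circledast$ there exists $M_p>0$ such that for all $t_1\ge0,\dots,t_n\ge0$, $$p\bigl(G(t_1,\dots,t_n)\bigr)\le M_p\sum a_1(t_1)\cdots a_n(t_n),$$ where the sum is over all $2^n$ choices in which each $a_j(t_j)$ ($1\le j\le n$) is either $e^{(\Re\lambda_j^0)t_j}$ or $\int_0^{t_j}e^{(\Re\lambda_j^0)s}\,ds$. Then: (i) If $(\lambda_1^0,\dots,\lambda_n^0)\in\Omega_{abs}(f)$, then for each seminorm $p\in\circledast$ there exists a finite real number $M_p>0$ such that for all $(t_1,\dots,t_n)\in[0,+\infty)^n$ $$\int_0^{t_1}\!\!\cdots\int_0^{t_n}p\bigl(f(s_1,\dots,s_n)\bigr)\,ds_1\cdots ds_n\le M_p\,e^{\max(0,\Re\lambda_1^0)t_1+\dots+\max(0,\Re\lambda_n^0)t_n}.$$ (ii) If $(\lambda_1^0,\dots,\lambda_n^0)\in\Omega_b(f)$, then property (P) holds for $(\lambda_1^0,\dots,\lambda_n^0)$. (iii) If $(\lambda_1^0,\dots,\lambda_n^0)\in\mathbb C^n$ satisfies (P), $(\lambda_1,\dots,\lambda_n)\in\mathbb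 C^n$ and $\Re\lambda_j>\max(\Re\lambda_j^0,0)$ for all $1\le j\le n$, then $(\lambda_1,\dots,\lambda_n)\in\Omega_{abs}(G)$, $(\lambda_1,\dots,\lambda_n)\in\Omega(f)\cap\Omega_b(f)$ and $$(\mathcal Lf)(\lambda_1,\dots,\lambda_n)=\lambda_1\cdots\lambda_n\cdot(\mathcal LG)(\lambda_1,\dots,\lambda_n).$$
   Context: An SCLCS is a Hausdorff sequentially complete locally convex space over $\mathbb C$; $\circledast$ denotes a fundamental system of seminorms defining the topology of $X$. Integration (with respect to Lebesgue measure): for a compact set $K$, a function $f:K\to X$ is integrable if there is a sequence $(f_k)$ of simple functions with $f_k(t)\to f(t)$ for a.e. $t\in K$ and such that for every $\epsilon>0$ and $p\in\circledast$ there is $k_0$ with $\int_K p(f_k-f_m)\le\epsilon$ for all $k,m\ge k_0$; then $\int_K f:=\lim_k\int_K f_k$. A function $f:[0,+\infty)^n\to X$ is locally integrable if its restriction to every compact subset is integrable. For locally integrable $f$ and $\lambda=(\lambda_1,\dots,\lambda_n)\in\mathbb C^n$ put $I_\lambda(t_1,\dots,t_n):=\int_0^{t_1}\cdots\int_0^{t_n}e^{-\lambda_1s_1-\dots-\lambda_ns_n}f(s_1,\dots,s_n)\,ds_1\cdots ds_n$. $\Omega(f)$ is the set of all $\lambda$ for which the joint limit $(\mathcal Lf)(\lambda):=\lim_{t_1\to+\infty;\dots;t_n\to+\infty}I_\lambda(t_1,\dots,t_n)$ exists in $X$ (for every $\epsilon>0$ and $p\in\circledast$ there is $M>0$ with $p(I_\lambda(t_1,\dots,t_n)-(\mathcal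 Lf)(\lambda))<\epsilon$ whenever all $t_j>M$). $\Omega_{abs}(f)$ is the set of all $\lambda$ with $\int_{[0,+\infty)^n}p(e^{-\lambda_1t_1-\dots-\lambda_nt_n}f(t_1,\dots,t_n))\,dt_1\cdots dt_n<+\infty$ for every $p\in\circledast$; one has $\Omega_{abs}(f)\subseteq\Omega(f)$. $\Omega_b(f)$ is the set of all $\lambda$ such that $\{I_\lambda(t_1,\dots,t_n):t_1\ge0,\dots,t_n\ge0\}$ is bounded in $X$. *)

theory Defs
  imports "HOL-Analysis.Analysis"
begin

section \<open>Locally convex spaces given by a family of seminorms\<close>

text \<open>
  The library has no class of locally convex spaces.  The space \<open>X\<close> is a type \<open>'x\<close> with an explicit
  complex scalar multiplication \<open>sc\<close> and a set \<open>P\<close> of seminorms defining its topology.  \<open>P\<close> is not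
  required to be directed, so finitely many seminorms have to be intersected to get a basic
  neighbourhood.
\<close>

definition seminorm :: "(complex \<Rightarrow> 'x::ab_group_add \<Rightarrow> 'x) \<Rightarrow> ('x \<Rightarrow> real) \<Rightarrow> bool" where
  "seminorm sc p \<longleftrightarrow>
     (\<forall>x. 0 \<le> p x) \<and> (\<forall>x y. p (x + y) \<le> p x + p y) \<and> (\<forall>c x. p (sc c x) = norm c * p x)"

definition seminorm_topology :: "('x::ab_group_add \<Rightarrow> real) set \<Rightarrow> 'x topology" where
  "seminorm_topology P = topology (\<lambda>U. \<forall>x\<in>U. \<exists>F e. finite F \<and> F \<subseteq> P \<and> 0 < e \<and>
     {y. \<forall>p\<in>F. p (y - x) < e} \<subseteq> U)"

lemma openin_seminorm_topology:
  "openin (seminorm_topology P) U \<longleftrightarrow>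
     (\<forall>x\<in>U. \<exists>F e. finite F \<and> F \<subseteq> P \<and> 0 < e \<and> {y. \<forall>p\<in>F. p (y - x) < e} \<subseteq> U)"
proof -
  define O' where "O' U \<longleftrightarrow>
     (\<forall>x\<in>U. \<exists>F e. finite F \<and> F \<subseteq> P \<and> 0 < e \<and> {y. \<forall>p\<in>F. p (y - x) < e} \<subseteq> U)" for U
  have "O' (S \<inter> T)" if S: "O' S" and T: "O' T" for S T
    unfolding O'_def
  proof
    fix x assume "x \<in> S \<inter> T"
    then have "x \<in> S" "x \<in> T" by simp_all
    obtain F d where F: "finite F" "F \<subseteq> P" "0 < d" "{y. \<forall>p\<in>F. p (y - x) < d} \<subseteq> S"
      using S[unfolded O'_def, rule_format, OF \<open>x \<in> S\<close>] by (elim exE conjE)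
    obtain H e where H: "finite H" "H \<subseteq> P" "0 < e" "{y. \<forall>p\<in>H. p (y - x) < e} \<subseteq> T"
      using T[unfolded O'_def, rule_format, OF \<open>x \<in> T\<close>] by (elim exE conjE)
    have "{y. \<forall>p\<in>F \<union> H. p (y - x) < min d e} \<subseteq> S \<inter> T"
      using F(4) H(4) by auto
    then show "\<exists>F e. finite F \<and> F \<subseteq> P \<and> 0 < e \<and> {y. \<forall>p\<in>F. p (y - x) < e} \<subseteq> S \<inter> T"
      using F H by (intro exI[of _ "F \<union> H"] exI[of _ "min d e"]) simp
  qed
  moreover have "O' (\<Union>\<K>)" if K: "\<forall>K\<in>\<K>. O' K" for \<K>
    unfolding O'_def
  proof
    fix x assume "x \<in> \<Union>\<K>"
    then obtain K where "K \<in> \<K>" "x \<in> K" by (elim UnionE)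
    with K have "O' K" by simp
    obtain F d where F: "finite F" "F \<subseteq> P" "0 < d" "{y. \<forall>p\<in>F. p (y - x) < d} \<subseteq> K"
      using \<open>O' K\<close>[unfolded O'_def, rule_format, OF \<open>x \<in> K\<close>] by (elim exE conjE)
    have "K \<subseteq> \<Union>\<K>" using \<open>K \<in> \<K>\<close> by (rule Union_upper)
    with F(4) have "{y. \<forall>p\<in>F. p (y - x) < d} \<subseteq> \<Union>\<K>" by (rule subset_trans)
    with F(1-3) show "\<exists>F e. finite F \<and> F \<subseteq> P \<and> 0 < e \<and> {y. \<forall>p\<in>F. p (y - x) < e} \<subseteq> \<Union>\<K>"
      by (intro exI[of _ F] exI[of _ d] conjI)
  qed
  ultimately have "istopology O'"
    unfolding istopology_def by simp
  then have "openin (topology O') U \<longleftrightarrow> O' U"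
    by (simp only: topology_inverse')
  then show ?thesis
    unfolding seminorm_topology_def O'_def .
qed

locale sclcs = vector_space sc
  for sc :: "complex \<Rightarrow> 'x::ab_group_add \<Rightarrow> 'x" +
  fixes P :: "('x \<Rightarrow> real) set"
  assumes seminorms: "p \<in> P \<Longrightarrow> seminorm sc p"
    and Hausdorff: "Hausdorff_space (seminorm_topology P)"
    and sequentially_complete:
      "(\<forall>p\<in>P. \<forall>e>0. \<exists>N. \<forall>k\<ge>N. \<forall>m\<ge>N. p (u k - u m) < e) \<Longrightarrow>
         \<exists>l. limitin (seminorm_topology P) u l sequentially"


section \<open>Integration\<close>

definition simple_integral ::
  "(complex \<Rightarrow> 'x::ab_group_add \<Rightarrow> 'x) \<Rightarrow> (real^'n) set \<Rightarrow> (real^'n \<Rightarrow> 'x) \<Rightarrow> 'x" where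
  "simple_integral sc K g =
     (\<Sum>x\<in>g ` K. sc (complex_of_real (measure lebesgue {t \<in> K. g t = x})) x)"

definition approximating_seq ::
  "('x::ab_group_add \<Rightarrow> real) set \<Rightarrow> (real^'n) set \<Rightarrow> (real^'n \<Rightarrow> 'x) \<Rightarrow>
     (nat \<Rightarrow> real^'n \<Rightarrow> 'x) \<Rightarrow> bool" where
  "approximating_seq P K f g \<longleftrightarrow>
     (\<forall>k. simple_function (lebesgue_on K) (g k)) \<and>
     (AE t in lebesgue_on K. limitin (seminorm_topology P) (\<lambda>k. g k t) (f t) sequentially) \<and>
     (\<forall>e>0. \<forall>p\<in>P. \<exists>k0. \<forall>k\<ge>k0. \<forall>m\<ge>k0. (LINT t|lebesgue_on K. p (g k t - g m t)) \<le> e)"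

definition lcs_integrable ::
  "('x::ab_group_add \<Rightarrow> real) set \<Rightarrow> (real^'n) set \<Rightarrow> (real^'n \<Rightarrow> 'x) \<Rightarrow> bool" where
  "lcs_integrable P K f \<longleftrightarrow> (\<exists>g. approximating_seq P K f g)"

definition lcs_integral ::
  "(complex \<Rightarrow> 'x::ab_group_add \<Rightarrow> 'x) \<Rightarrow> ('x \<Rightarrow> real) set \<Rightarrow> (real^'n) set \<Rightarrow>
     (real^'n \<Rightarrow> 'x) \<Rightarrow> 'x" where
  "lcs_integral sc P K f = (THE I. \<exists>g. approximating_seq P K f g \<and>
     limitin (seminorm_topology P) (\<lambda>k. simple_integral sc K (g k)) I sequentially)"

definition orthant :: "(real^'n) set" where
  "orthant = {t. \<forall>j. 0 \<le> t $ j}"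

text \<open>
  A function on \<open>[0,+\<infinity>)\<^sup>n\<close> is represented by a function on the whole space whose values outside
  \<^const>\<open>orthant\<close> are never used.
\<close>

definition locally_integrable ::
  "('x::ab_group_add \<Rightarrow> real) set \<Rightarrow> (real^'n \<Rightarrow> 'x) \<Rightarrow> bool" where
  "locally_integrable P f \<longleftrightarrow> (\<forall>K. compact K \<and> K \<subseteq> orthant \<longrightarrow> lcs_integrable P K f)"


section \<open>The multidimensional Laplace transform\<close>

definition exp_weighted ::
  "(complex \<Rightarrow> 'x::ab_group_add \<Rightarrow> 'x) \<Rightarrow> complex^'n \<Rightarrow> (real^'n \<Rightarrow> 'x) \<Rightarrow> real^'n \<Rightarrow> 'x" where
  "exp_weighted sc lam f s = sc (exp (- (\<Sum>j\<in>UNIV. lam $ j * complex_of_real (s $ j)))) (f s)"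

text \<open>
  The multiple integral with limits \<open>0\<close> and \<open>t\<^sub>j\<close> in the \<open>j\<close>-th variable is the integral over the
  box \<open>[0,t\<^sub>1] \<times> \<dots> \<times> [0,t\<^sub>n] = cbox 0 t\<close>.
\<close>

definition box_integral ::
  "(complex \<Rightarrow> 'x::ab_group_add \<Rightarrow> 'x) \<Rightarrow> ('x \<Rightarrow> real) set \<Rightarrow> (real^'n \<Rightarrow> 'x) \<Rightarrow> real^'n \<Rightarrow> 'x" where
  "box_integral sc P f t = lcs_integral sc P (cbox 0 t) f"

definition I_lap ::
  "(complex \<Rightarrow> 'x::ab_group_add \<Rightarrow> 'x) \<Rightarrow> ('x \<Rightarrow> real) set \<Rightarrow> (real^'n \<Rightarrow> 'x) \<Rightarrow>
     complex^'n \<Rightarrow> real^'n \<Rightarrow> 'x" where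
  "I_lap sc P f lam = box_integral sc P (exp_weighted sc lam f)"

definition has_laplace ::
  "(complex \<Rightarrow> 'x::ab_group_add \<Rightarrow> 'x) \<Rightarrow> ('x \<Rightarrow> real) set \<Rightarrow> (real^'n \<Rightarrow> 'x) \<Rightarrow>
     complex^'n \<Rightarrow> 'x \<Rightarrow> bool" where
  "has_laplace sc P f lam L \<longleftrightarrow>
     (\<forall>e>0. \<forall>p\<in>P. \<exists>M>0. \<forall>t. (\<forall>j. M < t $ j) \<longrightarrow> p (I_lap sc P f lam t - L) < e)"

definition laplace ::
  "(complex \<Rightarrow> 'x::ab_group_add \<Rightarrow> 'x) \<Rightarrow> ('x \<Rightarrow> real) set \<Rightarrow> (real^'n \<Rightarrow> 'x) \<Rightarrow>
     complex^'n \<Rightarrow> 'x" where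
  "laplace sc P f lam = (THE L. has_laplace sc P f lam L)"

text \<open>
  The regions of convergence are only meant for locally integrable functions; building this into
  the sets guarantees that the integrals occurring in them are never those of a non-integrable or
  non-measurable function.
\<close>

definition Omega ::
  "(complex \<Rightarrow> 'x::ab_group_add \<Rightarrow> 'x) \<Rightarrow> ('x \<Rightarrow> real) set \<Rightarrow> (real^'n \<Rightarrow> 'x) \<Rightarrow>
     (complex^'n) set" where
  "Omega sc P f = {lam. locally_integrable P f \<and> (\<exists>L. has_laplace sc P f lam L)}"

definition Omega_abs ::
  "(complex \<Rightarrow> 'x::ab_group_add \<Rightarrow> 'x) \<Rightarrow> ('x \<Rightarrow> real) set \<Rightarrow> (real^'n \<Rightarrow> 'x) \<Rightarrow>
     (complex^'n) set" where
  "Omega_abs sc P f = {lam. locally_integrable P f \<and>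
     (\<forall>p\<in>P. (\<integral>\<^sup>+ t. ennreal (p (exp_weighted sc lam f t)) \<partial>lebesgue_on orthant) < \<infinity>)}"

definition Omega_b ::
  "(complex \<Rightarrow> 'x::ab_group_add \<Rightarrow> 'x) \<Rightarrow> ('x \<Rightarrow> real) set \<Rightarrow> (real^'n \<Rightarrow> 'x) \<Rightarrow>
     (complex^'n) set" where
  "Omega_b sc P f = {lam. locally_integrable P f \<and>
     (\<forall>p\<in>P. \<exists>B. \<forall>t\<in>orthant. p (I_lap sc P f lam t) \<le> B)}"

text \<open>
  In \<open>property_P\<close>, the set \<open>S\<close> collects the indices \<open>j\<close> for which \<open>a\<^sub>j\<close> is the exponential rather
  than its integral, so that \<open>S\<close> runs through all \<open>2\<^sup>n\<close> choices.
\<close>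

definition property_P ::
  "(complex \<Rightarrow> 'x::ab_group_add \<Rightarrow> 'x) \<Rightarrow> ('x \<Rightarrow> real) set \<Rightarrow> (real^'n \<Rightarrow> 'x) \<Rightarrow>
     complex^'n \<Rightarrow> bool" where
  "property_P sc P f lam0 \<longleftrightarrow>
     (\<forall>p\<in>P. \<exists>M>0. \<forall>t\<in>orthant. p (box_integral sc P f t) \<le>
        M * (\<Sum>S\<in>Pow UNIV. \<Prod>j\<in>UNIV.
              if j \<in> S then exp (Re (lam0 $ j) * t $ j)
              else (LINT s|lebesgue_on {0..t $ j}. exp (Re (lam0 $ j) * s))))"

end

theory Submission
  imports Defs
begin

text \<open>
  Let \<open>G\<close> be the iterated primitive of a locally integrable \<open>g\<close> and \<open>\<phi>\<^sub>j\<close> scalar functions of one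
  variable.  Approximating each \<open>\<phi>\<^sub>j\<close> by combinations of indicators of \<open>[0,a]\<close> turns
  \<open>\<integral> (\<Prod>\<^sub>j \<phi>\<^sub>j(s\<^sub>j)) g(s) ds\<close> over the box \<open>[0,t]\<close> into a combination of values of \<open>G\<close>; hence a bound
  \<open>p(G(u)) \<le> C \<Prod>\<^sub>j w\<^sub>j(u\<^sub>j)\<close> gives the bound
  \<open>C \<Prod>\<^sub>j (|\<phi>\<^sub>j(t\<^sub>j)| w\<^sub>j(t\<^sub>j) + \<integral> |\<phi>\<^sub>j'| w\<^sub>j)\<close> for the integral.  With \<open>g = e\<^sup>-\<^sup>\<lambda>\<^sup>s f\<close>, \<open>\<phi>\<^sub>j = e\<^sup>\<lambda>\<^sup>s\<close> and \<open>w\<^sub>j = 1\<close> this is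
  part (ii).  For part (iii), \<open>\<Prod>\<^sub>j \<lambda>\<^sub>j\<close> times the truncated transform of \<open>G\<close> is the integral of \<open>f\<close> against
  \<open>\<Prod>\<^sub>j (e\<^sup>-\<^sup>\<lambda>\<^sup>s - e\<^sup>-\<^sup>\<lambda>\<^sup>t)\<close>.  Expanding the product, the term without factors \<open>e\<^sup>-\<^sup>\<lambda>\<^sup>t\<close> is the truncated
  transform of \<open>f\<close>, and by the same bound with \<open>w\<^sub>j = e\<^sup>\<mu>\<^sup>s\<close>, \<open>\<mu>\<close> between \<open>max (Re \<lambda>\<^sup>0) 0\<close> and \<open>Re \<lambda>\<close>, all other terms
  tend to \<open>0\<close>.
\<close>

section \<open>Integrals of simple functions\<close>

text \<open>Integrals over boxes are never rewritten as iterated integrals; the variables are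
  separated in the scalar factor instead. A product of one-variable combinations of indicators of
  \<open>[0,a]\<close> multiplies out into indicators of boxes with one corner at \<open>0\<close>,
  and over such a box the integral of the function is a value of its primitive. No measurable
  structure is put on the space itself: every estimate is made on real integrals such as that of
  \<open>p (f s)\<close>, one seminorm at a time. The threshold \<open>max (Re \<lambda>0) 0\<close>
  in part (iii) has two sources. An increment of \<open>\<phi>\<close> over a grid cell is paired
  with the primitive at the left end of the cell, so the weight \<open>exp (\<mu> * x)\<close> at
  that end has to be dominated by its values inside the cell, which asks for
  \<open>\<mu> \<ge> 0\<close>. And \<open>\<mu> > 0\<close> absorbs the integral alternatives in
  (P), which for \<open>Re \<lambda>0 \<le> 0\<close> do not decay: each is at most
  \<open>exp (\<mu> * x) / \<mu>\<close>.\<close>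

lemma simple_function_level_lmeasurable:
  fixes K :: "(real^'n) set"
  assumes "K \<in> lmeasurable" "simple_function (lebesgue_on K) h"
  shows "{t \<in> K. h t = y} \<in> lmeasurable"
proof -
  have K: "K \<in> sets lebesgue" using assms(1) by blast
  have "h -` {y} \<inter> space (lebesgue_on K) \<in> sets (lebesgue_on K)"
    using simple_functionD(2)[OF assms(2)] .
  moreover have "h -` {y} \<inter> space (lebesgue_on K) = {t \<in> K. h t = y}"
    using K by (auto simp: space_restrict_space)
  ultimately have "{t \<in> K. h t = y} \<in> sets lebesgue"
    using K by (auto simp: sets_restrict_space_iff)
  then show ?thesis using assms(1) by (rule fmeasurableI2[rotated 2]) auto
qed

lemma measure_level_compose:
  fixes K :: "(real^'n) set"
  assumes K: "K \<in> lmeasurable" and h: "simple_function (lebesgue_on K) h"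
    and I: "finite I" "h ` K \<subseteq> I"
  shows "measure lebesgue {t \<in> K. F (h t) = x} =
    (\<Sum>y\<in>{y\<in>I. F y = x}. measure lebesgue {t \<in> K. h t = y})"
proof -
  have "{t \<in> K. F (h t) = x} = (\<Union>y\<in>{y\<in>I. F y = x}. {t \<in> K. h t = y})"
    using I by auto
  also have "measure lebesgue \<dots> = (\<Sum>y\<in>{y\<in>I. F y = x}. measure lebesgue {t \<in> K. h t = y})"
  proof (rule measure_finite_Union)
    show "emeasure lebesgue {t \<in> K. h t = i} \<noteq> \<infinity>" for i
      using fmeasurableD2[OF simple_function_level_lmeasurable[OF K h]] by simp
    show "(\<lambda>y. {t \<in> K. h t = y}) ` {y \<in> I. F y = x} \<subseteq> sets lebesgue"
      using simple_function_level_lmeasurable[OF K h] by blast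
  qed (use I in \<open>auto simp: disjoint_family_on_def\<close>)
  finally show ?thesis .
qed

text \<open>A simple function has finitely many measurable levels, so composing it with any
  \<open>F\<close> gives a finite combination of indicators. This makes
  \<open>p (g k t - g m t)\<close> integrable without a \<sigma>-algebra on the space of
  values.\<close>

lemma has_bochner_integral_simple_compose:
  fixes K :: "(real^'n) set" and F :: "'a \<Rightarrow> real"
  assumes K: "K \<in> lmeasurable" and h: "simple_function (lebesgue_on K) h"
    and I: "finite I" "h ` K \<subseteq> I"
  shows "has_bochner_integral (lebesgue_on K) (\<lambda>t. F (h t))
    (\<Sum>y\<in>I. measure lebesgue {t \<in> K. h t = y} * F y)"
proof -
  have KL: "K \<in> sets lebesgue" using K by blast
  have "has_bochner_integral (lebesgue_on K)
     (\<lambda>t. \<Sum>y\<in>I. indicator {t \<in> K. h t = y} t * F y)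
     (\<Sum>y\<in>I. measure (lebesgue_on K) {t \<in> K. h t = y} * F y)"
  proof (intro has_bochner_integral_sum has_bochner_integral_mult_left has_bochner_integral_real_indicator)
    fix y
    have lm: "{t \<in> K. h t = y} \<in> lmeasurable" by (rule simple_function_level_lmeasurable[OF K h])
    then show "{t \<in> K. h t = y} \<in> sets (lebesgue_on K)"
      using KL by (auto simp: sets_restrict_space_iff)
    show "emeasure (lebesgue_on K) {t \<in> K. h t = y} < \<infinity>"
      using lm KL by (subst emeasure_restrict_space) (auto simp: fmeasurable_def)
  qed
  moreover have "measure (lebesgue_on K) {t \<in> K. h t = y} = measure lebesgue {t \<in> K. h t = y}" for y
    using KL by (intro measure_restrict_space) auto
  moreover have "(\<Sum>y\<in>I. indicator {t \<in> K. h t = y} t * F y) = F (h t)" if "t \<in> space (lebesgue_on K)" for t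
  proof -
    have "t \<in> K" "h t \<in> I" using that I KL by (auto simp: space_restrict_space)
    then show ?thesis using I by (simp add: indicator_def if_distrib[of "\<lambda>x. x * _"] sum.delta' cong: if_cong)
  qed
  ultimately show ?thesis
    using has_bochner_integral_cong[OF refl _ refl, of "lebesgue_on K"
        "\<lambda>t. \<Sum>y\<in>I. indicator {t \<in> K. h t = y} t * F y" "\<lambda>t. F (h t)"] by simp
qed

lemma simple_function_integrable:
  fixes K :: "(real^'n) set" and F :: "'a \<Rightarrow> real"
  assumes K: "K \<in> lmeasurable" and h: "simple_function (lebesgue_on K) h"
  shows "integrable (lebesgue_on K) (\<lambda>t. F (h t))"
proof -
  have "K \<in> sets lebesgue" using K by blast
  then have "finite (h ` K)" using simple_functionD(1)[OF h] by (simp add: space_restrict_space)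
  from has_bochner_integral_simple_compose[OF K h this order_refl]
  show ?thesis by (simp add: has_bochner_integral_iff)
qed

context sclcs
begin

section \<open>Seminorm inequalities and convergence in the seminorm topology\<close>

lemma seminorm_nonneg: "p \<in> P \<Longrightarrow> 0 \<le> p x"
  and seminorm_triangle: "p \<in> P \<Longrightarrow> p (x + y) \<le> p x + p y"
  and seminorm_scale: "p \<in> P \<Longrightarrow> p (sc c x) = norm c * p x"
  using seminorms[unfolded seminorm_def] by blast+

lemma seminorm_zero: "p \<in> P \<Longrightarrow> p 0 = 0"
  using seminorm_scale[of p 0 0] by simp

lemma seminorm_minus: "p \<in> P \<Longrightarrow> p (- x) = p x"
  using seminorm_scale[of p "-1" x] by simp

lemma seminorm_diff_commute: "p \<in> P \<Longrightarrow> p (x - y) = p (y - x)"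
  using seminorm_minus[of p "x - y"] by simp

lemma seminorm_triangle_diff: "p \<in> P \<Longrightarrow> p (x - z) \<le> p (x - y) + p (y - z)"
  using seminorm_triangle[of p "x - y" "y - z"] by simp

lemma seminorm_diff_le: "p \<in> P \<Longrightarrow> p (x - y) \<le> p x + p y"
  using seminorm_triangle[of p x "- y"] by (simp add: seminorm_minus)

lemma seminorm_le_add_diff: "p \<in> P \<Longrightarrow> p x \<le> p y + p (x - y)"
  using seminorm_triangle[of p y "x - y"] by simp

lemma seminorm_abs_diff: "p \<in> P \<Longrightarrow> \<bar>p x - p y\<bar> \<le> p (x - y)"
  using seminorm_le_add_diff[of p x y] seminorm_le_add_diff[of p y x] by (simp add: seminorm_diff_commute)

lemma seminorm_sum: "p \<in> P \<Longrightarrow> p (sum f A) \<le> (\<Sum>a\<in>A. p (f a))"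
proof (induction A rule: infinite_finite_induct)
  case (insert a A)
  then show ?case using seminorm_triangle[of p "f a" "sum f A"] by simp
qed (simp_all add: seminorm_zero)

lemma topspace_seminorm: "topspace (seminorm_topology P) = UNIV"
proof -
  have "openin (seminorm_topology P) UNIV"
    by (subst openin_seminorm_topology) (auto intro!: exI[of _ "{}"] exI[of _ "1::real"])
  then show ?thesis
    using openin_subset top.extremum_uniqueI by blast
qed

lemma openin_ball: "p \<in> P \<Longrightarrow> openin (seminorm_topology P) {y. p (y - x) < e}"
proof (subst openin_seminorm_topology, intro ballI)
  fix z assume p: "p \<in> P" and z: "z \<in> {y. p (y - x) < e}"
  have "{y. \<forall>q\<in>{p}. q (y - z) < e - p (z - x)} \<subseteq> {y. p (y - x) < e}"
    using seminorm_triangle_diff[OF p, of _ x z] by (force simp: less_diff_eq intro: le_less_trans)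
  then show "\<exists>F d. finite F \<and> F \<subseteq> P \<and> 0 < d \<and> {y. \<forall>q\<in>F. q (y - z) < d} \<subseteq> {y. p (y - x) < e}"
    using p z by (intro exI[of _ "{p}"] exI[of _ "e - p (z - x)"]) simp
qed

text \<open>A basic neighbourhood involves only finitely many seminorms, so their separate eventual
  bounds can be intersected. Convergence in the topology thereby becomes a family of real limits,
  the form used in all later limit arguments.\<close>

lemma limitin_iff:
  "limitin (seminorm_topology P) u l F \<longleftrightarrow> (\<forall>p\<in>P. ((\<lambda>k. p (u k - l)) \<longlongrightarrow> 0) F)"
proof
  assume lim: "limitin (seminorm_topology P) u l F"
  show "\<forall>p\<in>P. ((\<lambda>k. p (u k - l)) \<longlongrightarrow> 0) F"
  proof
    fix p assume p: "p \<in> P"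
    show "((\<lambda>k. p (u k - l)) \<longlongrightarrow> 0) F"
    proof (rule tendstoI)
      fix e :: real assume "0 < e"
      then have "\<forall>\<^sub>F k in F. u k \<in> {y. p (y - l) < e}"
        using lim openin_ball[OF p, of l e] seminorm_zero[OF p] by (auto simp: limitin_def)
      then show "\<forall>\<^sub>F k in F. dist (p (u k - l)) 0 < e"
        using seminorm_nonneg[OF p] by simp
    qed
  qed
next
  assume conv: "\<forall>p\<in>P. ((\<lambda>k. p (u k - l)) \<longlongrightarrow> 0) F"
  show "limitin (seminorm_topology P) u l F"
    unfolding limitin_def
  proof (intro conjI allI impI)
    fix U assume U: "openin (seminorm_topology P) U \<and> l \<in> U"
    then obtain H e where H: "finite H" "H \<subseteq> P" "0 < e" "{y. \<forall>p\<in>H. p (y - l) < e} \<subseteq> U"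
      unfolding openin_seminorm_topology by meson
    have "\<forall>\<^sub>F k in F. \<forall>p\<in>H. p (u k - l) < e"
      using H conv by (intro eventually_ball_finite ballI) (auto intro: order_tendstoD)
    then show "\<forall>\<^sub>F k in F. u k \<in> U"
      by eventually_elim (use H in auto)
  qed (simp add: topspace_seminorm)
qed

text \<open>If no seminorm separates \<open>x\<close> from \<open>y\<close>, the constant sequence
  \<open>x\<close> converges to both, and the Hausdorff property identifies them.\<close>

lemma eq_if_p_diff_zero:
  assumes "\<And>p. p \<in> P \<Longrightarrow> p (x - y) = 0"
  shows "x = y"
proof -
  have "p (x - y) = 0" "p (x - x) = 0" if "p \<in> P" for p
    using assms that by (simp_all add: seminorm_zero)
  then have "limitin (seminorm_topology P) (\<lambda>_. x) x sequentially"
    "limitin (seminorm_topology P) (\<lambda>_. x) y sequentially"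
    unfolding limitin_iff by (metis tendsto_const)+
  then show ?thesis
    using limitin_Hausdorff_unique[OF _ _ _ Hausdorff, of "\<lambda>_. x" x sequentially y] by simp
qed

lemma limitin_add:
  assumes "limitin (seminorm_topology P) u l F" "limitin (seminorm_topology P) v m F"
  shows "limitin (seminorm_topology P) (\<lambda>k. u k + v k) (l + m) F"
  unfolding limitin_iff
proof
  fix p assume p: "p \<in> P"
  have "((\<lambda>k. p (u k - l) + p (v k - m)) \<longlongrightarrow> 0) F"
    using assms p unfolding limitin_iff by (auto intro!: tendsto_add_zero)
  then show "((\<lambda>k. p (u k + v k - (l + m))) \<longlongrightarrow> 0) F"
    by (rule Lim_null_comparison[rotated])
      (use seminorm_triangle[OF p] seminorm_nonneg[OF p] in \<open>auto simp: add_diff_add intro!: always_eventually\<close>)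
qed

lemma limitin_scale:
  assumes "(c \<longlongrightarrow> a) F" "limitin (seminorm_topology P) u l F"
  shows "limitin (seminorm_topology P) (\<lambda>k. sc (c k) (u k)) (sc a l) F"
  unfolding limitin_iff
proof
  fix p assume p: "p \<in> P"
  have "((\<lambda>k. norm (c k) * p (u k - l) + norm (c k - a) * p l) \<longlongrightarrow> norm a * 0 + 0 * p l) F"
    using assms p unfolding limitin_iff by (intro tendsto_intros tendsto_norm_zero LIM_zero) auto
  then have *: "((\<lambda>k. norm (c k) * p (u k - l) + norm (c k - a) * p l) \<longlongrightarrow> 0) F" by simp
  have "sc (c k) (u k) - sc a l = sc (c k) (u k - l) + sc (c k - a) l" for k
    by (simp add: scale_right_diff_distrib scale_left_diff_distrib)
  then have "p (sc (c k) (u k) - sc a l) \<le> norm (c k) * p (u k - l) + norm (c k - a) * p l" for k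
    using seminorm_triangle[OF p, of "sc (c k) (u k - l)" "sc (c k - a) l"] by (simp add: seminorm_scale[OF p])
  then show "((\<lambda>k. p (sc (c k) (u k) - sc a l)) \<longlongrightarrow> 0) F"
    by (intro Lim_null_comparison[OF _ *]) (use seminorm_nonneg[OF p] in \<open>auto intro!: always_eventually\<close>)
qed

text \<open>The sum in \<open>simple_integral\<close> runs over values of the function, so two
  simple functions are summed over unrelated levels. Writing them as compositions with one common
  \<open>h\<close> puts both over the same partition of \<open>K\<close>. The index set
  \<open>I\<close> may exceed the image of \<open>h\<close>; values not attained have empty levels.
  The Riemann sums below rely on this.\<close>

lemma simple_integral_compose:
  fixes K :: "(real^'n) set"
  assumes K: "K \<in> lmeasurable" and h: "simple_function (lebesgue_on K) h"
    and I: "finite I" "h ` K \<subseteq> I"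
  shows "simple_integral sc K (\<lambda>t. F (h t)) =
    (\<Sum>y\<in>I. sc (complex_of_real (measure lebesgue {t \<in> K. h t = y})) (F y))"
proof -
  let ?m = "\<lambda>y. complex_of_real (measure lebesgue {t \<in> K. h t = y})"
  have "simple_integral sc K (\<lambda>t. F (h t)) =
      (\<Sum>x\<in>(\<lambda>t. F (h t)) ` K. sc (of_real (measure lebesgue {t \<in> K. F (h t) = x})) x)"
    by (simp add: simple_integral_def)
  also have "\<dots> = (\<Sum>x\<in>F ` I. sc (of_real (measure lebesgue {t \<in> K. F (h t) = x})) x)"
  proof (rule sum.mono_neutral_left)
    show "\<forall>i\<in>F ` I - (\<lambda>t. F (h t)) ` K.
       sc (complex_of_real (measure lebesgue {t \<in> K. F (h t) = i})) i = 0"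
    proof
      fix i assume "i \<in> F ` I - (\<lambda>t. F (h t)) ` K"
      then have "{t \<in> K. F (h t) = i} = {}" by (auto simp: image_iff)
      then show "sc (complex_of_real (measure lebesgue {t \<in> K. F (h t) = i})) i = 0"
        by (simp only: measure_empty) simp
    qed
  qed (use I in auto)
  also have "\<dots> = (\<Sum>x\<in>F ` I. \<Sum>y\<in>{y\<in>I. F y = x}. sc (?m y) (F y))"
  proof (rule sum.cong)
    fix x
    have "sc (of_real (measure lebesgue {t \<in> K. F (h t) = x})) x = (\<Sum>y\<in>{y\<in>I. F y = x}. sc (?m y) x)"
      by (simp add: measure_level_compose[OF K h I] scale_sum_left)
    also have "\<dots> = (\<Sum>y\<in>{y\<in>I. F y = x}. sc (?m y) (F y))"
      by (intro sum.cong) auto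
    finally show "sc (of_real (measure lebesgue {t \<in> K. F (h t) = x})) x = \<dots>" .
  qed simp
  also have "\<dots> = (\<Sum>y\<in>I. sc (?m y) (F y))"
    using sum.image_gen[OF I(1), of "\<lambda>y. sc (?m y) (F y)" F] by simp
  finally show ?thesis .
qed

lemma finite_simple_image:
  "K \<in> lmeasurable \<Longrightarrow> simple_function (lebesgue_on K) g \<Longrightarrow> finite (g ` K)"
  using simple_functionD(1)[of "lebesgue_on K" g] by (force simp: space_restrict_space fmeasurable_def)

lemma simple_integral_add:
  assumes K: "K \<in> lmeasurable" and "simple_function (lebesgue_on K) g" "simple_function (lebesgue_on K) g'"
  shows "simple_integral sc K (\<lambda>t. g t + g' t) = simple_integral sc K g + simple_integral sc K g'"
proof -
  \<comment> \<open>The pair is the common refinement: both summands and the sum are functions of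
    it, so additivity reduces to distributing a finite sum.\<close>
  let ?h = "\<lambda>t. (g t, g' t)"
  have h: "simple_function (lebesgue_on K) ?h" using assms by simp
  note * = simple_integral_compose[OF K h finite_simple_image[OF K h] order_refl]
  show ?thesis
    using *[of "\<lambda>(x, y). x + y"] *[of fst] *[of snd]
    by (simp add: sum.distrib scale_right_distrib case_prod_beta)
qed

lemma simple_integral_scale:
  assumes K: "K \<in> lmeasurable" and g: "simple_function (lebesgue_on K) g"
  shows "simple_integral sc K (\<lambda>t. sc c (g t)) = sc c (simple_integral sc K g)"
  using simple_integral_compose[OF K g finite_simple_image[OF K g] order_refl, of "sc c"]
    simple_integral_compose[OF K g finite_simple_image[OF K g] order_refl, of "\<lambda>x. x"]
  by (simp add: scale_sum_right mult.commute)

lemma seminorm_simple_integral_le: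
  assumes K: "K \<in> lmeasurable" and g: "simple_function (lebesgue_on K) g" and p: "p \<in> P"
  shows "p (simple_integral sc K g) \<le> (LINT t|lebesgue_on K. p (g t))"
proof -
  note I = finite_simple_image[OF K g] order_refl
  have "p (simple_integral sc K g) \<le> (\<Sum>y\<in>g ` K. measure lebesgue {t \<in> K. g t = y} * p y)"
    unfolding simple_integral_def using seminorm_sum[OF p]
    by (rule order_trans) (simp add: seminorm_scale[OF p])
  also have "\<dots> = (LINT t|lebesgue_on K. p (g t))"
    using has_bochner_integral_simple_compose[OF K g I, of p] by (simp add: has_bochner_integral_iff)
  finally show ?thesis .
qed

lemma seminorm_simple_integral_diff_le:
  assumes K: "K \<in> lmeasurable" and g: "simple_function (lebesgue_on K) g" "simple_function (lebesgue_on K) g'"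
    and p: "p \<in> P"
  shows "p (simple_integral sc K g - simple_integral sc K g') \<le> (LINT t|lebesgue_on K. p (g t - g' t))"
proof -
  have m: "simple_function (lebesgue_on K) (\<lambda>t. sc (-1) (g' t))"
    using simple_function_compose1[OF g(2), of "sc (-1)"] by simp
  have "simple_integral sc K (\<lambda>t. g t + sc (-1) (g' t)) = simple_integral sc K g - simple_integral sc K g'"
    by (subst simple_integral_add[OF K g(1) m]) (simp add: simple_integral_scale[OF K g(2), of "-1", simplified])
  then have "simple_integral sc K (\<lambda>t. g t - g' t) = simple_integral sc K g - simple_integral sc K g'"
    by simp
  moreover have "simple_function (lebesgue_on K) (\<lambda>t. g t - g' t)"
    using simple_function_compose2[OF g, of "(-)"] by simp
  ultimately show ?thesis using seminorm_simple_integral_le[OF K _ p, of "\<lambda>t. g t - g' t"] by simp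
qed

end

section \<open>The integral in a sequentially complete locally convex space\<close>

text \<open>Extending by zero moves the problem to the whole space, where completeness of Lebesgue
  measure allows a change on a null set. This is needed because approximating sequences converge
  only almost everywhere.\<close>

lemma borel_measurable_lebesgue_on_AE_limit:
  fixes u :: "nat \<Rightarrow> real^'n \<Rightarrow> real"
  assumes K: "K \<in> sets lebesgue" and u: "\<And>i. u i \<in> borel_measurable (lebesgue_on K)"
    and lim: "AE t in lebesgue_on K. (\<lambda>i. u i t) \<longlonglongrightarrow> v t"
  shows "v \<in> borel_measurable (lebesgue_on K)"
proof -
  let ?u = "\<lambda>i t. if t \<in> K then u i t else 0"
  have AE: "AE t in lebesgue. t \<in> K \<longrightarrow> (\<lambda>i. u i t) \<longlonglongrightarrow> v t"
    using lim K by (simp add: AE_restrict_space_iff)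
  have "(\<lambda>t. lim (\<lambda>i. ?u i t)) \<in> borel_measurable lebesgue"
    using u K by (intro borel_measurable_lim_metric) (simp add: borel_measurable_if)
  moreover have "AE t in lebesgue. lim (\<lambda>i. ?u i t) = (if t \<in> K then v t else 0)"
    using AE by eventually_elim (auto intro: limI)
  ultimately have "(\<lambda>t. if t \<in> K then v t else 0) \<in> borel_measurable lebesgue"
    by (rule borel_measurable_AE)
  then show ?thesis by (rule borel_measurable_if_D)
qed

context sclcs
begin

text \<open>Measurability is asserted of the real function \<open>p (h t - f t)\<close> only, as an
  almost everywhere limit of real simple functions. The free simple function \<open>h\<close> covers
  both \<open>h = g k\<close> and \<open>h = 0\<close>.\<close>

lemma seminorm_diff_limit_measurable:
  fixes K :: "(real^'n) set"
  assumes K: "K \<in> lmeasurable" and gs: "\<And>k. simple_function (lebesgue_on K) (g k)"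
    and AE: "AE t in lebesgue_on K. limitin (seminorm_topology P) (\<lambda>k. g k t) (f t) sequentially"
    and p: "p \<in> P" and h: "simple_function (lebesgue_on K) h"
  shows "AE t in lebesgue_on K. (\<lambda>k. p (h t - g k t)) \<longlonglongrightarrow> p (h t - f t)"
    and "(\<lambda>t. p (h t - f t)) \<in> borel_measurable (lebesgue_on K)"
proof -
  show lim: "AE t in lebesgue_on K. (\<lambda>k. p (h t - g k t)) \<longlonglongrightarrow> p (h t - f t)"
    using AE
  proof eventually_elim
    fix t assume "limitin (seminorm_topology P) (\<lambda>k. g k t) (f t) sequentially"
    then have lim: "(\<lambda>k. p (g k t - f t)) \<longlonglongrightarrow> 0" using p by (simp add: limitin_iff)
    have "\<bar>p (h t - g k t) - p (h t - f t)\<bar> \<le> p (g k t - f t)" for k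
      using seminorm_abs_diff[OF p, of "h t - g k t" "h t - f t"] seminorm_diff_commute[OF p, of "f t" "g k t"] by simp
    then have "(\<lambda>k. p (h t - g k t) - p (h t - f t)) \<longlonglongrightarrow> 0"
      by (intro Lim_null_comparison[OF _ lim]) auto
    then show "(\<lambda>k. p (h t - g k t)) \<longlonglongrightarrow> p (h t - f t)" by (simp add: LIM_zero_iff)
  qed
  show "(\<lambda>t. p (h t - f t)) \<in> borel_measurable (lebesgue_on K)"
  proof (rule borel_measurable_lebesgue_on_AE_limit)
    show "K \<in> sets lebesgue" using K by blast
    show "(\<lambda>t. p (h t - g k t)) \<in> borel_measurable (lebesgue_on K)" for k
      using simple_function_compose2[OF h gs, of "\<lambda>x y. p (x - y)"] by (rule borel_measurable_simple_function)
  qed (rule lim)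
qed

text \<open>An approximating sequence is only required to be Cauchy in mean. Fatou's lemma in the
  second index turns the Cauchy bound on \<open>p (g k t - g m t)\<close> into the same bound on
  \<open>p (g k t - f t)\<close>, so the sequence converges to \<open>f\<close> in mean.\<close>

lemma approximating_seq_L1:
  assumes K: "K \<in> lmeasurable" and g: "approximating_seq P K f g" and p: "p \<in> P"
  shows "integrable (lebesgue_on K) (\<lambda>t. p (g k t - f t))"
    and "(\<lambda>k. LINT t|lebesgue_on K. p (g k t - f t)) \<longlonglongrightarrow> 0"
proof -
  have gs: "simple_function (lebesgue_on K) (g k)" for k
    using g by (simp add: approximating_seq_def)
  have AE: "AE t in lebesgue_on K. limitin (seminorm_topology P) (\<lambda>k. g k t) (f t) sequentially"
    using g by (simp add: approximating_seq_def)
  have int: "integrable (lebesgue_on K) (\<lambda>t. p (g k t - g m t))" for k m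
    using simple_function_integrable[OF K simple_function_Pair[OF gs gs], of "\<lambda>(x, y). p (x - y)" k m]
    by simp
  have meas: "(\<lambda>t. p (g k t - f t)) \<in> borel_measurable (lebesgue_on K)" for k
    by (rule seminorm_diff_limit_measurable(2)[OF K gs AE p gs])
  have bound: "(\<integral>\<^sup>+t. ennreal (p (g k t - f t)) \<partial>lebesgue_on K) \<le> ennreal e"
    if k0: "\<And>k m. k0 \<le> k \<Longrightarrow> k0 \<le> m \<Longrightarrow> (LINT t|lebesgue_on K. p (g k t - g m t)) \<le> e" and k: "k0 \<le> k"
    for k k0 e
  proof -
    have "AE t in lebesgue_on K. ennreal (p (g k t - f t)) = liminf (\<lambda>m. ennreal (p (g k t - g m t)))"
      using seminorm_diff_limit_measurable(1)[OF K gs AE p gs]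
    proof eventually_elim
      fix t assume "(\<lambda>m. p (g k t - g m t)) \<longlonglongrightarrow> p (g k t - f t)"
      then have "(\<lambda>m. ennreal (p (g k t - g m t))) \<longlonglongrightarrow> ennreal (p (g k t - f t))" by (rule tendsto_ennrealI)
      then show "ennreal (p (g k t - f t)) = liminf (\<lambda>m. ennreal (p (g k t - g m t)))"
        using lim_imp_Liminf trivial_limit_sequentially by fastforce
    qed
    then have "(\<integral>\<^sup>+t. ennreal (p (g k t - f t)) \<partial>lebesgue_on K) =
        (\<integral>\<^sup>+t. liminf (\<lambda>m. ennreal (p (g k t - g m t))) \<partial>lebesgue_on K)"
      by (rule nn_integral_cong_AE)
    also have "\<dots> \<le> liminf (\<lambda>m. \<integral>\<^sup>+t. ennreal (p (g k t - g m t)) \<partial>lebesgue_on K)"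
      by (rule nn_integral_liminf) (use int in \<open>simp add: borel_measurable_integrable\<close>)
    also have "\<dots> \<le> ennreal e"
    proof -
      have "\<forall>\<^sub>F m in sequentially. (\<integral>\<^sup>+t. ennreal (p (g k t - g m t)) \<partial>lebesgue_on K) \<le> ennreal e"
        using eventually_ge_at_top[of k0]
      proof eventually_elim
        case (elim m)
        then show ?case using k0[OF k elim]
          by (subst nn_integral_eq_integral[OF int]) (auto simp: seminorm_nonneg[OF p] intro: ennreal_leI)
      qed
      from Liminf_mono[OF this] show ?thesis by (simp add: Liminf_const)
    qed
    finally show ?thesis .
  qed
  have cauchy: "\<exists>k0. \<forall>k\<ge>k0. \<forall>m\<ge>k0. (LINT t|lebesgue_on K. p (g k t - g m t)) \<le> e" if "0 < e" for e
    using g that p unfolding approximating_seq_def by blast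
  obtain k0 where k0: "\<And>k m. k0 \<le> k \<Longrightarrow> k0 \<le> m \<Longrightarrow> (LINT t|lebesgue_on K. p (g k t - g m t)) \<le> 1"
    using cauchy[of 1] by auto
  \<comment> \<open>Fatou's bound gives integrability for one index of the Cauchy tail; the triangle
    inequality through \<open>g k0\<close> then extends it to every index.\<close>
  have int0: "integrable (lebesgue_on K) (\<lambda>t. p (g k0 t - f t))"
    using bound[of k0 1 k0] k0 meas seminorm_nonneg[OF p]
    by (intro integrableI_nonneg) (auto intro: le_less_trans)
  have int1: "integrable (lebesgue_on K) (\<lambda>t. p (g k t - f t))" for k
    using Bochner_Integration.integrable_add[OF int[of k k0] int0]
    by (rule Bochner_Integration.integrable_bound)
      (use meas seminorm_triangle_diff[OF p] seminorm_nonneg[OF p] in \<open>auto intro!: AE_I2\<close>)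
  then show "integrable (lebesgue_on K) (\<lambda>t. p (g k t - f t))" .
  show "(\<lambda>k. LINT t|lebesgue_on K. p (g k t - f t)) \<longlonglongrightarrow> 0"
  proof (rule LIMSEQ_I)
    fix r :: real assume "0 < r"
    then obtain k0 where k0: "\<And>k m. k0 \<le> k \<Longrightarrow> k0 \<le> m \<Longrightarrow> (LINT t|lebesgue_on K. p (g k t - g m t)) \<le> r / 2"
      using cauchy[of "r/2"] by auto
    have "norm ((LINT t|lebesgue_on K. p (g k t - f t)) - 0) < r" if "k0 \<le> k" for k
    proof -
      have "ennreal (LINT t|lebesgue_on K. p (g k t - f t)) \<le> ennreal (r / 2)"
        using bound[of k0 "r / 2" k] k0 that nn_integral_eq_integral[OF int1[of k]] by (simp add: seminorm_nonneg[OF p])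
      then have "(LINT t|lebesgue_on K. p (g k t - f t)) \<le> r / 2"
        using \<open>0 < r\<close> by (subst (asm) ennreal_le_iff) auto
      moreover have "0 \<le> (LINT t|lebesgue_on K. p (g k t - f t))"
        by (rule integral_nonneg_AE) (simp add: seminorm_nonneg[OF p])
      ultimately show ?thesis using \<open>0 < r\<close> by simp
    qed
    then show "\<exists>no. \<forall>n\<ge>no. norm ((LINT t|lebesgue_on K. p (g n t - f t)) - 0) < r" by blast
  qed
qed

text \<open>The converse of \<open>approximating_seq_L1\<close>: mean convergence to
  \<open>f\<close> implies the Cauchy condition, so later constructions only have to control the
  distance to the limit.\<close>

lemma approximating_seqI:
  assumes K: "K \<in> lmeasurable"
    and gs: "\<And>k. simple_function (lebesgue_on K) (g k)"
    and AE: "AE t in lebesgue_on K. limitin (seminorm_topology P) (\<lambda>k. g k t) (f t) sequentially"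
    and int: "\<And>p k. p \<in> P \<Longrightarrow> integrable (lebesgue_on K) (\<lambda>t. p (g k t - f t))"
    and lim: "\<And>p. p \<in> P \<Longrightarrow> (\<lambda>k. LINT t|lebesgue_on K. p (g k t - f t)) \<longlonglongrightarrow> 0"
  shows "approximating_seq P K f g"
  unfolding approximating_seq_def
proof (intro conjI allI impI ballI gs AE)
  fix e :: real and p assume e: "0 < e" and p: "p \<in> P"
  obtain k0 where k0: "\<And>k. k0 \<le> k \<Longrightarrow> (LINT t|lebesgue_on K. p (g k t - f t)) < e / 2"
    using order_tendstoD(2)[OF lim[OF p], of "e / 2"] e by (auto simp: eventually_sequentially)
  have "(LINT t|lebesgue_on K. p (g k t - g m t)) \<le> e" if km: "k0 \<le> k" "k0 \<le> m" for k m
  proof -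
    have "(LINT t|lebesgue_on K. p (g k t - g m t))
        \<le> (LINT t|lebesgue_on K. p (g k t - f t) + p (g m t - f t))"
    proof (rule integral_mono)
      show "integrable (lebesgue_on K) (\<lambda>t. p (g k t - g m t))"
        using simple_function_integrable[OF K simple_function_Pair[OF gs gs], of "\<lambda>(x, y). p (x - y)" k m]
        by simp
      show "p (g k t - g m t) \<le> p (g k t - f t) + p (g m t - f t)" for t
        using seminorm_triangle_diff[OF p, of "g k t" "g m t" "f t"] seminorm_diff_commute[OF p, of "f t" "g m t"] by simp
    qed (use int p in auto)
    also have "\<dots> \<le> e" using k0[OF km(1)] k0[OF km(2)] int[OF p] by simp
    finally show ?thesis .
  qed
  then show "\<exists>k0. \<forall>k\<ge>k0. \<forall>m\<ge>k0. (LINT t|lebesgue_on K. p (g k t - g m t)) \<le> e" by blast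
qed

lemma lcs_integrable_seminorm:
  assumes K: "K \<in> lmeasurable" and f: "lcs_integrable P K f" and p: "p \<in> P"
  shows "integrable (lebesgue_on K) (\<lambda>t. p (f t))"
proof -
  obtain g where g: "approximating_seq P K f g" using f by (auto simp: lcs_integrable_def)
  have gs: "simple_function (lebesgue_on K) (g k)" for k using g by (simp add: approximating_seq_def)
  have "(\<lambda>t. p (0 - f t)) \<in> borel_measurable (lebesgue_on K)"
    by (rule seminorm_diff_limit_measurable(2)[where g = g, OF K gs _ p]) (use g in \<open>simp_all add: approximating_seq_def\<close>)
  then have m: "(\<lambda>t. p (f t)) \<in> borel_measurable (lebesgue_on K)" by (simp add: seminorm_minus[OF p])
  have "integrable (lebesgue_on K) (\<lambda>t. p (g 0 t) + p (g 0 t - f t))"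
    using simple_function_integrable[OF K gs, of p 0] approximating_seq_L1(1)[OF K g p, of 0] by simp
  then show ?thesis
    by (rule Bochner_Integration.integrable_bound[OF _ m])
      (use seminorm_le_add_diff[OF p] seminorm_diff_commute[OF p] seminorm_nonneg[OF p] in \<open>auto intro!: AE_I2 simp: seminorm_diff_commute[OF p, of "g 0 _"]\<close>)
qed

text \<open>Cauchy in mean makes the simple integrals a Cauchy sequence for every seminorm, which is
  exactly what sequential completeness can handle.\<close>

lemma approximating_seq_limit_exists:
  assumes K: "K \<in> lmeasurable" and g: "approximating_seq P K f g"
  shows "\<exists>I. limitin (seminorm_topology P) (\<lambda>k. simple_integral sc K (g k)) I sequentially"
proof (rule sequentially_complete, intro ballI allI impI)
  fix p e :: "_" assume p: "p \<in> P" and e: "0 < (e::real)"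
  obtain k0 where k0: "\<And>k m. k0 \<le> k \<Longrightarrow> k0 \<le> m \<Longrightarrow> (LINT t|lebesgue_on K. p (g k t - g m t)) \<le> e / 2"
    using g half_gt_zero[OF e] p unfolding approximating_seq_def by meson
  have gs: "simple_function (lebesgue_on K) (g k)" for k using g by (simp add: approximating_seq_def)
  have "p (simple_integral sc K (g k) - simple_integral sc K (g m)) < e" if "k0 \<le> k" "k0 \<le> m" for k m
    using seminorm_simple_integral_diff_le[OF K gs gs p, of k m] k0[OF that] e by simp
  then show "\<exists>N. \<forall>k\<ge>N. \<forall>m\<ge>N. p (simple_integral sc K (g k) - simple_integral sc K (g m)) < e" by blast
qed

text \<open>Justifies the definite description in \<open>lcs_integral\<close>. Two approximating
  sequences of the same \<open>f\<close> are close to each other in mean by way of \<open>f\<close>,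
  so no seminorm separates the limits of their simple integrals.\<close>

lemma approximating_seq_limit_unique:
  assumes K: "K \<in> lmeasurable" and g: "approximating_seq P K f g" "approximating_seq P K f g'"
    and I: "limitin (seminorm_topology P) (\<lambda>k. simple_integral sc K (g k)) I sequentially"
      "limitin (seminorm_topology P) (\<lambda>k. simple_integral sc K (g' k)) I' sequentially"
  shows "I = I'"
proof (rule eq_if_p_diff_zero)
  fix p assume p: "p \<in> P"
  let ?i = "\<lambda>g k. LINT t|lebesgue_on K. p (g k t - f t)" and ?s = "simple_integral sc K"
  have gs: "simple_function (lebesgue_on K) (g k)" "simple_function (lebesgue_on K) (g' k)" for k
    using g by (simp_all add: approximating_seq_def)
  have "p (I - I') \<le> p (?s (g k) - I) + (?i g k + ?i g' k) + p (?s (g' k) - I')" for k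
  proof -
    have "p (?s (g k) - ?s (g' k)) \<le> (LINT t|lebesgue_on K. p (g k t - g' k t))"
      by (rule seminorm_simple_integral_diff_le[OF K gs p])
    also have "\<dots> \<le> (LINT t|lebesgue_on K. p (g k t - f t) + p (g' k t - f t))"
    proof (rule integral_mono)
      show "integrable (lebesgue_on K) (\<lambda>t. p (g k t - g' k t))"
        using simple_function_integrable[OF K simple_function_Pair[OF gs], of "\<lambda>(x, y). p (x - y)" k k]
        by simp
      show "p (g k t - g' k t) \<le> p (g k t - f t) + p (g' k t - f t)" for t
        using seminorm_triangle_diff[OF p, of "g k t" "g' k t" "f t"] seminorm_diff_commute[OF p, of "f t" "g' k t"] by simp
    qed (use approximating_seq_L1(1)[OF K _ p] g in auto)
    also have "\<dots> = ?i g k + ?i g' k"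
      using approximating_seq_L1(1)[OF K _ p] g by simp
    finally show ?thesis
      using seminorm_triangle_diff[OF p, of I I' "?s (g k)"] seminorm_triangle_diff[OF p, of "?s (g k)" I' "?s (g' k)"]
        seminorm_diff_commute[OF p, of I "?s (g k)"] by linarith
  qed
  moreover have "(\<lambda>k. p (?s (g k) - I) + (?i g k + ?i g' k) + p (?s (g' k) - I')) \<longlonglongrightarrow> 0"
    using I p approximating_seq_L1(2)[OF K g(1) p] approximating_seq_L1(2)[OF K g(2) p]
    unfolding limitin_iff by (intro tendsto_add_zero) auto
  ultimately have "p (I - I') \<le> 0"
    by (intro LIMSEQ_le_const[of _ 0]) auto
  then show "p (I - I') = 0" using seminorm_nonneg[OF p, of "I - I'"] by simp
qed

lemma lcs_integral_eqI:
  assumes K: "K \<in> lmeasurable" and g: "approximating_seq P K f g"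
    and I: "limitin (seminorm_topology P) (\<lambda>k. simple_integral sc K (g k)) I sequentially"
  shows "lcs_integral sc P K f = I"
  unfolding lcs_integral_def
  by (rule the_equality) (use g I approximating_seq_limit_unique[OF K] in blast)+

lemma limitin_lcs_integral:
  assumes K: "K \<in> lmeasurable" and g: "approximating_seq P K f g"
  shows "limitin (seminorm_topology P) (\<lambda>k. simple_integral sc K (g k)) (lcs_integral sc P K f) sequentially"
  using approximating_seq_limit_exists[OF K g] lcs_integral_eqI[OF K g] by auto

lemma lcs_integral_norm_bound:
  assumes K: "K \<in> lmeasurable" and f: "lcs_integrable P K f" and p: "p \<in> P"
  shows "p (lcs_integral sc P K f) \<le> (LINT t|lebesgue_on K. p (f t))"
proof -
  obtain g where g: "approximating_seq P K f g" using f by (auto simp: lcs_integrable_def)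
  have gs: "simple_function (lebesgue_on K) (g k)" for k using g by (simp add: approximating_seq_def)
  let ?I = "lcs_integral sc P K f" and ?s = "\<lambda>k. simple_integral sc K (g k)"
  have int: "integrable (lebesgue_on K) (\<lambda>t. p (f t))" by (rule lcs_integrable_seminorm[OF K f p])
  have "p ?I \<le> p (?s k - ?I) + (LINT t|lebesgue_on K. p (f t)) + (LINT t|lebesgue_on K. p (g k t - f t))" for k
  proof -
    have "(LINT t|lebesgue_on K. p (g k t)) \<le> (LINT t|lebesgue_on K. p (f t) + p (g k t - f t))"
      by (rule integral_mono) (use simple_function_integrable[OF K gs] int
          approximating_seq_L1(1)[OF K g p] seminorm_le_add_diff[OF p] in auto)
    also have "\<dots> = (LINT t|lebesgue_on K. p (f t)) + (LINT t|lebesgue_on K. p (g k t - f t))"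
      using int approximating_seq_L1(1)[OF K g p] by simp
    finally show ?thesis
      using seminorm_simple_integral_le[OF K gs p, of k] seminorm_le_add_diff[OF p, of ?I "?s k"] seminorm_diff_commute[OF p, of ?I "?s k"]
      by linarith
  qed
  moreover have "(\<lambda>k. p (?s k - ?I) + (LINT t|lebesgue_on K. p (f t)) + (LINT t|lebesgue_on K. p (g k t - f t)))
      \<longlonglongrightarrow> 0 + (LINT t|lebesgue_on K. p (f t)) + 0"
    using limitin_lcs_integral[OF K g] p approximating_seq_L1(2)[OF K g p]
    unfolding limitin_iff by (intro tendsto_add tendsto_const) auto
  ultimately show ?thesis by (intro LIMSEQ_le_const[of _ "LINT t|lebesgue_on K. p (f t)"]) auto
qed


section \<open>Linearity, scalar multipliers, restriction and dominated convergence\<close>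

lemma approximating_seq_cong:
  assumes "K \<in> lmeasurable" "\<And>t. t \<in> K \<Longrightarrow> f t = f' t"
  shows "approximating_seq P K f g = approximating_seq P K f' g"
proof -
  have "K \<in> sets lebesgue" using assms(1) by blast
  then have "(AE t in lebesgue_on K. limitin (seminorm_topology P) (\<lambda>k. g k t) (f t) sequentially)
    = (AE t in lebesgue_on K. limitin (seminorm_topology P) (\<lambda>k. g k t) (f' t) sequentially)"
    using assms(2) by (intro AE_cong) (simp add: space_restrict_space)
  then show ?thesis by (simp add: approximating_seq_def)
qed

lemma lcs_integrable_cong:
  assumes "K \<in> lmeasurable" "\<And>t. t \<in> K \<Longrightarrow> f t = f' t"
  shows "lcs_integrable P K f = lcs_integrable P K f'"
  using approximating_seq_cong[OF assms] by (simp add: lcs_integrable_def)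

lemma lcs_integral_cong:
  assumes "K \<in> lmeasurable" "\<And>t. t \<in> K \<Longrightarrow> f t = f' t"
  shows "lcs_integral sc P K f = lcs_integral sc P K f'"
  using approximating_seq_cong[OF assms] by (simp add: lcs_integral_def)

text \<open>The majorant may vary with \<open>k\<close> and only its integrals have to vanish. This
  suits sums and products, whose error is naturally bounded by the mean errors of the
  ingredients.\<close>

lemma approximating_seq_dominated:
  assumes K: "K \<in> lmeasurable"
    and gs: "\<And>k. simple_function (lebesgue_on K) (g k)"
    and AE: "AE t in lebesgue_on K. limitin (seminorm_topology P) (\<lambda>k. g k t) (f t) sequentially"
    and d: "\<And>p k. p \<in> P \<Longrightarrow> (\<lambda>t. d p k t) \<in> borel_measurable (lebesgue_on K) \<and>
       integrable (lebesgue_on K) (d p k) \<and> (\<forall>t\<in>K. p (g k t - f t) \<le> d p k t)"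
    and lim: "\<And>p. p \<in> P \<Longrightarrow> (\<lambda>k. LINT t|lebesgue_on K. d p k t) \<longlonglongrightarrow> 0"
  shows "approximating_seq P K f g"
proof (rule approximating_seqI[OF K gs AE])
  have KL: "K \<in> sets lebesgue" using K by blast
  fix p assume p: "p \<in> P"
  show int: "integrable (lebesgue_on K) (\<lambda>t. p (g k t - f t))" for k
  proof (rule Bochner_Integration.integrable_bound)
    show "integrable (lebesgue_on K) (d p k)" using d[OF p] by blast
    show "AE t in lebesgue_on K. norm (p (g k t - f t)) \<le> norm (d p k t)"
      using d[OF p, of k] seminorm_nonneg[OF p] KL by (intro AE_I2) (force simp: space_restrict_space)
    show "(\<lambda>t. p (g k t - f t)) \<in> borel_measurable (lebesgue_on K)"
      by (rule seminorm_diff_limit_measurable(2)[OF K gs AE p gs])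
  qed
  show "(\<lambda>k. LINT t|lebesgue_on K. p (g k t - f t)) \<longlonglongrightarrow> 0"
  proof (rule Lim_null_comparison[OF _ lim[OF p]], rule always_eventually, rule allI)
    fix k
    have "(LINT t|lebesgue_on K. p (g k t - f t)) \<le> (LINT t|lebesgue_on K. d p k t)"
      using d[OF p, of k] KL by (intro integral_mono int) (auto simp: space_restrict_space)
    moreover have "0 \<le> (LINT t|lebesgue_on K. p (g k t - f t))"
      by (rule integral_nonneg_AE) (simp add: seminorm_nonneg[OF p])
    ultimately show "norm (LINT t|lebesgue_on K. p (g k t - f t)) \<le> (LINT t|lebesgue_on K. d p k t)" by simp
  qed
qed

text \<open>On a set of finite measure a constant is an integrable majorant, so bounded pointwise
  convergence already gives mean convergence. Functions sampled on a grid are treated this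
  way.\<close>

lemma approximating_seq_bounded:
  assumes K: "K \<in> lmeasurable"
    and gs: "\<And>k. simple_function (lebesgue_on K) (g k)"
    and lim: "\<And>t. t \<in> K \<Longrightarrow> limitin (seminorm_topology P) (\<lambda>k. g k t) (f t) sequentially"
    and B: "\<And>p k t. p \<in> P \<Longrightarrow> t \<in> K \<Longrightarrow> p (g k t - f t) \<le> B p"
  shows "approximating_seq P K f g"
proof (rule approximating_seqI[OF K gs])
  have KL: "K \<in> sets lebesgue" using K by blast
  interpret finite_measure "lebesgue_on K" by (rule finite_measure_lebesgue_on[OF K])
  show AE: "AE t in lebesgue_on K. limitin (seminorm_topology P) (\<lambda>k. g k t) (f t) sequentially"
    using lim KL by (intro AE_I2) (simp add: space_restrict_space)
  fix p assume p: "p \<in> P"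
  have m: "(\<lambda>t. p (g k t - f t)) \<in> borel_measurable (lebesgue_on K)" for k
    by (rule seminorm_diff_limit_measurable(2)[OF K gs AE p gs])
  have bound: "AE t in lebesgue_on K. norm (p (g k t - f t)) \<le> B p" for k
    using B[OF p] KL seminorm_nonneg[OF p] by (intro AE_I2) (simp add: space_restrict_space)
  show "integrable (lebesgue_on K) (\<lambda>t. p (g k t - f t))" for k
    by (rule integrable_const_bound[OF bound m])
  have "(\<lambda>k. LINT t|lebesgue_on K. p (g k t - f t)) \<longlonglongrightarrow> (LINT t|lebesgue_on K. 0)"
  proof (rule integral_dominated_convergence[where w = "\<lambda>_. B p"])
    show "AE t in lebesgue_on K. (\<lambda>k. p (g k t - f t)) \<longlonglongrightarrow> 0"
      using AE by eventually_elim (simp add: limitin_iff p)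
  qed (use m bound in auto)
  then show "(\<lambda>k. LINT t|lebesgue_on K. p (g k t - f t)) \<longlonglongrightarrow> 0" by simp
qed

lemma approximating_seq_simple: "approximating_seq P K f g \<Longrightarrow> simple_function (lebesgue_on K) (g k)"
  by (simp add: approximating_seq_def)

lemma approximating_seq_add:
  assumes K: "K \<in> lmeasurable" and g: "approximating_seq P K f g" "approximating_seq P K f' g'"
  shows "approximating_seq P K (\<lambda>t. f t + f' t) (\<lambda>k t. g k t + g' k t)"
proof (rule approximating_seq_dominated[OF K])
  note gs = approximating_seq_simple[OF g(1)] approximating_seq_simple[OF g(2)]
  show "simple_function (lebesgue_on K) (\<lambda>t. g k t + g' k t)" for k
    using simple_function_compose2[OF gs, of "(+)"] .
  have "AE t in lebesgue_on K. limitin (seminorm_topology P) (\<lambda>k. g k t) (f t) sequentially"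
     "AE t in lebesgue_on K. limitin (seminorm_topology P) (\<lambda>k. g' k t) (f' t) sequentially"
    using g by (simp_all add: approximating_seq_def)
  then show "AE t in lebesgue_on K. limitin (seminorm_topology P) (\<lambda>k. g k t + g' k t) (f t + f' t) sequentially"
    by eventually_elim (rule limitin_add)
  fix p assume p: "p \<in> P"
  note L1 = approximating_seq_L1[OF K g(1) p] approximating_seq_L1[OF K g(2) p]
  show "(\<lambda>t. p (g k t - f t) + p (g' k t - f' t)) \<in> borel_measurable (lebesgue_on K) \<and>
     integrable (lebesgue_on K) (\<lambda>t. p (g k t - f t) + p (g' k t - f' t)) \<and>
     (\<forall>t\<in>K. p (g k t + g' k t - (f t + f' t)) \<le> p (g k t - f t) + p (g' k t - f' t))" for k
    using L1(1)[of k] L1(3)[of k] seminorm_triangle[OF p, of "g k _ - f _" "g' k _ - f' _"]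
    by (auto simp: add_diff_add intro: borel_measurable_integrable borel_measurable_add)
  show "(\<lambda>k. LINT t|lebesgue_on K. p (g k t - f t) + p (g' k t - f' t)) \<longlonglongrightarrow> 0"
    using tendsto_add_zero[OF L1(2,4)] L1(1,3) by simp
qed

text \<open>The error splits as \<open>sc s (g - f) + sc (s - \<psi>) f\<close>. The first part is
  at most \<open>2 * B\<close> times the mean error of \<open>g\<close>, the second vanishes by real
  dominated convergence. The approximating sequence is named explicitly so that integrals, and not
  only integrability, can be read off from it.\<close>

lemma approximating_seq_bounded_mult:
  fixes \<psi> :: "real^'n \<Rightarrow> complex"
  assumes K: "K \<in> lmeasurable" and g: "approximating_seq P K f g"
    and \<psi>: "\<psi> \<in> borel_measurable (lebesgue_on K)" "\<And>t. t \<in> K \<Longrightarrow> norm (\<psi> t) \<le> B"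
    and s: "\<And>i. simple_function (lebesgue_on K) (s i)" "\<And>t. t \<in> K \<Longrightarrow> (\<lambda>i. s i t) \<longlonglongrightarrow> \<psi> t"
      "\<And>i t. t \<in> K \<Longrightarrow> norm (s i t) \<le> 2 * norm (\<psi> t)"
  shows "approximating_seq P K (\<lambda>t. sc (\<psi> t) (f t)) (\<lambda>k t. sc (s k t) (g k t))"
proof (rule approximating_seq_dominated[OF K])
  have KL: "K \<in> sets lebesgue" using K by blast
  note gs = approximating_seq_simple[OF g]
  show "simple_function (lebesgue_on K) (\<lambda>t. sc (s k t) (g k t))" for k
    using simple_function_compose2[OF s(1) gs, of sc] .
  have "AE t in lebesgue_on K. limitin (seminorm_topology P) (\<lambda>k. g k t) (f t) sequentially"
    using g by (simp_all add: approximating_seq_def)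
  then show "AE t in lebesgue_on K. limitin (seminorm_topology P) (\<lambda>k. sc (s k t) (g k t)) (sc (\<psi> t) (f t)) sequentially"
    using AE_space
    by eventually_elim (rule limitin_scale, use s(2) KL in \<open>auto simp: space_restrict_space\<close>)
  fix p assume p: "p \<in> P"
  note L1 = approximating_seq_L1[OF K g p]
  have f: "integrable (lebesgue_on K) (\<lambda>t. p (f t))"
    using g by (intro lcs_integrable_seminorm[OF K _ p]) (auto simp: lcs_integrable_def)
  have sm: "s k \<in> borel_measurable (lebesgue_on K)" for k by (rule borel_measurable_simple_function[OF s(1)])
  \<comment> \<open>The constant is \<open>2 * B + B\<close>. The absolute value keeps the majorant
    nonnegative even if \<open>K\<close> is empty and \<open>B\<close> negative.\<close>
  have B: "norm (s k t - \<psi> t) \<le> 3 * \<bar>B\<bar>" if "t \<in> K" for k t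
    using norm_triangle_ineq4[of "s k t" "\<psi> t"] s(3)[OF that, of k] \<psi>(2)[OF that] abs_ge_self[of B] by linarith
  have int: "integrable (lebesgue_on K) (\<lambda>t. norm (s k t - \<psi> t) * p (f t))" for k
  proof (rule Bochner_Integration.integrable_bound[OF integrable_mult_right[OF f, of "3 * \<bar>B\<bar>"]])
    show "(\<lambda>t. norm (s k t - \<psi> t) * p (f t)) \<in> borel_measurable (lebesgue_on K)"
      using sm \<psi>(1) borel_measurable_integrable[OF f] by simp
    show "AE t in lebesgue_on K. norm (norm (s k t - \<psi> t) * p (f t)) \<le> norm (3 * \<bar>B\<bar> * p (f t))"
      using B seminorm_nonneg[OF p] KL
      by (intro AE_I2) (auto simp: space_restrict_space abs_mult intro!: mult_right_mono intro: order_trans)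
  qed
  define d where "d k t = 2 * B * p (g k t - f t) + norm (s k t - \<psi> t) * p (f t)" for k t
  have dint: "integrable (lebesgue_on K) (d k)" for k
    unfolding d_def using L1(1) int by (intro Bochner_Integration.integrable_add integrable_mult_right)
  have le: "p (sc (s k t) (g k t) - sc (\<psi> t) (f t)) \<le> d k t" if t: "t \<in> K" for k t
  proof -
    have "sc (s k t) (g k t) - sc (\<psi> t) (f t) = sc (s k t) (g k t - f t) + sc (s k t - \<psi> t) (f t)"
      by (simp add: scale_right_diff_distrib scale_left_diff_distrib)
    then have "p (sc (s k t) (g k t) - sc (\<psi> t) (f t)) \<le> norm (s k t) * p (g k t - f t) + norm (s k t - \<psi> t) * p (f t)"
      using seminorm_triangle[OF p, of "sc (s k t) (g k t - f t)" "sc (s k t - \<psi> t) (f t)"] by (simp add: seminorm_scale[OF p])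
    also have "\<dots> \<le> d k t"
      unfolding d_def using s(3)[OF t, of k] \<psi>(2)[OF t] seminorm_nonneg[OF p]
      by (intro add_right_mono mult_right_mono) (auto intro: order_trans)
    finally show ?thesis .
  qed
  show "(\<lambda>t. d k t) \<in> borel_measurable (lebesgue_on K) \<and> integrable (lebesgue_on K) (d k) \<and>
     (\<forall>t\<in>K. p (sc (s k t) (g k t) - sc (\<psi> t) (f t)) \<le> d k t)" for k
    using dint[of k] le by auto
  have "(\<lambda>k. LINT t|lebesgue_on K. norm (s k t - \<psi> t) * p (f t)) \<longlonglongrightarrow> (LINT t|lebesgue_on K. 0)"
  proof (rule integral_dominated_convergence[where w = "\<lambda>t. 3 * \<bar>B\<bar> * p (f t)"])
    show "AE t in lebesgue_on K. (\<lambda>k. norm (s k t - \<psi> t) * p (f t)) \<longlonglongrightarrow> 0"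
      using s(2) KL
      by (intro AE_I2) (auto simp: space_restrict_space intro!: tendsto_mult_left_zero tendsto_norm_zero LIM_zero)
    show "AE t in lebesgue_on K. norm (norm (s k t - \<psi> t) * p (f t)) \<le> 3 * \<bar>B\<bar> * p (f t)" for k
      using B seminorm_nonneg[OF p] KL
      by (intro AE_I2) (auto simp: space_restrict_space abs_mult intro!: mult_right_mono)
  qed (use int f in \<open>auto intro: borel_measurable_integrable\<close>)
  then have "(\<lambda>k. 2 * B * (LINT t|lebesgue_on K. p (g k t - f t)) + (LINT t|lebesgue_on K. norm (s k t - \<psi> t) * p (f t)))
      \<longlonglongrightarrow> 2 * B * 0 + 0"
    using L1(2) by (intro tendsto_intros) auto
  then show "(\<lambda>k. LINT t|lebesgue_on K. d k t) \<longlonglongrightarrow> 0"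
    unfolding d_def using L1(1) int by simp
qed

lemma lcs_integrable_bounded_mult:
  fixes \<psi> :: "real^'n \<Rightarrow> complex"
  assumes K: "K \<in> lmeasurable" and f: "lcs_integrable P K f"
    and \<psi>: "\<psi> \<in> borel_measurable (lebesgue_on K)" "\<And>t. t \<in> K \<Longrightarrow> norm (\<psi> t) \<le> B"
  shows "lcs_integrable P K (\<lambda>t. sc (\<psi> t) (f t))"
proof -
  have KL: "K \<in> sets lebesgue" using K by blast
  obtain g where g: "approximating_seq P K f g" using f by (auto simp: lcs_integrable_def)
  obtain s where s: "\<forall>i. simple_function (lebesgue_on K) (s i)"
      "\<forall>t\<in>K. (\<lambda>i. s i t) \<longlonglongrightarrow> \<psi> t" "\<forall>i. \<forall>t\<in>K. norm (s i t) \<le> 2 * norm (\<psi> t)"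
    using borel_measurable_implies_sequence_metric[OF \<psi>(1), of 0] KL
    by (auto simp: space_restrict_space)
  have "approximating_seq P K (\<lambda>t. sc (\<psi> t) (f t)) (\<lambda>k t. sc (s k t) (g k t))"
    by (rule approximating_seq_bounded_mult[OF K g \<psi>]) (use s in auto)
  then show ?thesis
    unfolding lcs_integrable_def by blast
qed

lemma lcs_integrable_continuous_mult:
  fixes \<psi> :: "real^'n \<Rightarrow> complex"
  assumes K: "compact K" and f: "lcs_integrable P K f" and \<psi>: "continuous_on K \<psi>"
  shows "lcs_integrable P K (\<lambda>t. sc (\<psi> t) (f t))"
proof -
  have KL: "K \<in> lmeasurable" by (rule lmeasurable_compact[OF K])
  have "bounded (\<psi> ` K)" by (rule compact_imp_bounded[OF compact_continuous_image[OF \<psi> K]])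
  then obtain B where B: "\<And>s. s \<in> K \<Longrightarrow> norm (\<psi> s) \<le> B"
    unfolding bounded_iff by blast
  have "\<psi> \<in> borel_measurable (lebesgue_on K)"
    by (rule continuous_imp_measurable_on_sets_lebesgue[OF \<psi>]) (use KL in blast)
  from lcs_integrable_bounded_mult[OF KL f this B] show ?thesis .
qed

lemma lcs_integrable_scale:
  assumes K: "K \<in> lmeasurable" and f: "lcs_integrable P K f"
  shows "lcs_integrable P K (\<lambda>t. sc c (f t))"
  by (rule lcs_integrable_bounded_mult[OF K f, of _ "norm c"]) auto

lemma lcs_integral_scale:
  assumes K: "K \<in> lmeasurable" and f: "lcs_integrable P K f"
  shows "lcs_integral sc P K (\<lambda>t. sc c (f t)) = sc c (lcs_integral sc P K f)"
proof -
  obtain g where g: "approximating_seq P K f g" using f by (auto simp: lcs_integrable_def)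
  have "approximating_seq P K (\<lambda>t. sc c (f t)) (\<lambda>k t. sc c (g k t))"
    by (rule approximating_seq_bounded_mult[OF K g, of _ "norm c"]) auto
  then show ?thesis
  proof (rule lcs_integral_eqI[OF K])
    show "limitin (seminorm_topology P) (\<lambda>k. simple_integral sc K (\<lambda>t. sc c (g k t)))
       (sc c (lcs_integral sc P K f)) sequentially"
      using limitin_scale[OF tendsto_const limitin_lcs_integral[OF K g]]
      by (simp add: simple_integral_scale[OF K approximating_seq_simple[OF g]])
  qed
qed

lemma lcs_integrable_add:
  assumes K: "K \<in> lmeasurable" and f: "lcs_integrable P K f" "lcs_integrable P K f'"
  shows "lcs_integrable P K (\<lambda>t. f t + f' t)"
  using f approximating_seq_add[OF K] unfolding lcs_integrable_def by blast

lemma lcs_integral_add: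
  assumes K: "K \<in> lmeasurable" and f: "lcs_integrable P K f" "lcs_integrable P K f'"
  shows "lcs_integral sc P K (\<lambda>t. f t + f' t) = lcs_integral sc P K f + lcs_integral sc P K f'"
proof -
  obtain g g' where g: "approximating_seq P K f g" "approximating_seq P K f' g'"
    using f by (auto simp: lcs_integrable_def)
  show ?thesis
  proof (rule lcs_integral_eqI[OF K approximating_seq_add[OF K g]])
    show "limitin (seminorm_topology P) (\<lambda>k. simple_integral sc K (\<lambda>t. g k t + g' k t))
       (lcs_integral sc P K f + lcs_integral sc P K f') sequentially"
      using limitin_add[OF limitin_lcs_integral[OF K g(1)] limitin_lcs_integral[OF K g(2)]]
      by (simp add: simple_integral_add[OF K approximating_seq_simple[OF g(1)] approximating_seq_simple[OF g(2)]])
  qed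
qed

lemma lcs_integrable_diff:
  assumes K: "K \<in> lmeasurable" and f: "lcs_integrable P K f" "lcs_integrable P K f'"
  shows "lcs_integrable P K (\<lambda>t. f t - f' t)"
  using lcs_integrable_add[OF K f(1) lcs_integrable_scale[OF K f(2), of "-1"]] by simp

lemma lcs_integral_diff:
  assumes K: "K \<in> lmeasurable" and f: "lcs_integrable P K f" "lcs_integrable P K f'"
  shows "lcs_integral sc P K (\<lambda>t. f t - f' t) = lcs_integral sc P K f - lcs_integral sc P K f'"
  using lcs_integral_add[OF K f(1) lcs_integrable_scale[OF K f(2), of "-1"]]
    lcs_integral_scale[OF K f(2), of "-1"] by simp

lemma lcs_integral_zero:
  assumes K: "K \<in> lmeasurable"
  shows "lcs_integrable P K (\<lambda>t. 0)" "lcs_integral sc P K (\<lambda>t. 0) = 0"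
proof -
  have "approximating_seq P K (\<lambda>t. 0) (\<lambda>k t. 0)"
    unfolding approximating_seq_def by (auto simp: limitin_iff seminorm_zero topspace_seminorm)
  then show "lcs_integrable P K (\<lambda>t. 0)" by (auto simp: lcs_integrable_def)
  from lcs_integral_scale[OF K this, of 0] show "lcs_integral sc P K (\<lambda>t. 0) = 0" by simp
qed

lemma lcs_integral_sum:
  assumes K: "K \<in> lmeasurable" and f: "\<And>i. i \<in> A \<Longrightarrow> lcs_integrable P K (f i)"
  shows "lcs_integrable P K (\<lambda>t. \<Sum>i\<in>A. f i t) \<and>
     lcs_integral sc P K (\<lambda>t. \<Sum>i\<in>A. f i t) = (\<Sum>i\<in>A. lcs_integral sc P K (f i))"
  using f
proof (induction A rule: infinite_finite_induct)
  case (insert i A)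
  then show ?case
    using lcs_integrable_add[OF K, of "f i"] lcs_integral_add[OF K, of "f i"] by simp
qed (simp_all add: lcs_integral_zero[OF K])

text \<open>Approximating sequences restrict to measurable subsets. The point of the second claim is
  that all values of the primitive on a box become integrals over that one fixed box, with only a
  scalar indicator varying.\<close>

lemma lcs_integral_subset:
  assumes K: "K \<in> lmeasurable" and A: "A \<in> sets lebesgue" "A \<subseteq> K" and f: "lcs_integrable P K f"
  shows "lcs_integrable P A f"
    and "lcs_integral sc P A f = lcs_integral sc P K (\<lambda>t. sc (indicator A t) (f t))"
proof -
  have KL: "K \<in> sets lebesgue" using K by blast
  have AM: "A \<in> lmeasurable" using fmeasurableI2[OF K A(2,1)] .
  obtain g where g: "approximating_seq P K f g" using f by (auto simp: lcs_integrable_def)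
  note gs = approximating_seq_simple[OF g]
  have ind: "simple_function (lebesgue_on K) (indicator A :: _ \<Rightarrow> complex)"
    using A KL by (intro simple_function_indicator) (auto simp: sets_restrict_space_iff)
  have *: "approximating_seq P K (\<lambda>t. sc (indicator A t) (f t)) (\<lambda>k t. sc (indicator A t) (g k t))"
    by (rule approximating_seq_bounded_mult[OF K g, of _ 1])
      (use borel_measurable_simple_function[OF ind] ind in \<open>auto split: split_indicator\<close>)
  have sub: "simple_function (lebesgue_on A) (g k)" for k
  proof -
    have "finite (g k ` A)"
      using finite_subset[OF image_mono[OF A(2)] finite_simple_image[OF K gs[of k]]] .
    moreover have "g k -` {x} \<inter> A \<in> sets (lebesgue_on A)" for x
    proof -
      have "{t \<in> K. g k t = x} \<in> sets lebesgue"
        using simple_function_level_lmeasurable[OF K gs] by blast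
      moreover have "g k -` {x} \<inter> A = {t \<in> K. g k t = x} \<inter> A" using A by auto
      ultimately show ?thesis using A by (auto simp: sets_restrict_space_iff)
    qed
    ultimately show ?thesis
      using A by (simp add: simple_function_def space_restrict_space)
  qed
  have le: "(LINT t|lebesgue_on A. p (g k t - g m t)) \<le> (LINT t|lebesgue_on K. p (g k t - g m t))"
    if p: "p \<in> P" for p k m
  proof -
    have int: "integrable (lebesgue_on K) (\<lambda>t. p (g k t - g m t))"
      using simple_function_integrable[OF K simple_function_Pair[OF gs gs], of "\<lambda>(x, y). p (x - y)" k m]
      by simp
    then have int': "integrable lebesgue (\<lambda>t. indicator K t * p (g k t - g m t))"
      using KL by (simp add: integrable_restrict_space)
    have intA: "integrable (lebesgue_on A) (\<lambda>t. p (g k t - g m t))"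
      using simple_function_integrable[OF AM simple_function_Pair[OF sub sub], of "\<lambda>(x, y). p (x - y)" k m]
      by simp
    then have intA': "integrable lebesgue (\<lambda>t. indicator A t * p (g k t - g m t))"
      using A by (simp add: integrable_restrict_space)
    show ?thesis
      using int' intA' A KL seminorm_nonneg[OF p]
      by (simp add: integral_restrict_space) (rule integral_mono, auto simp: indicator_def)
  qed
  have gA: "approximating_seq P A f g"
    unfolding approximating_seq_def
  proof (intro conjI allI impI ballI sub)
    have "AE t in lebesgue_on K. limitin (seminorm_topology P) (\<lambda>k. g k t) (f t) sequentially"
      using g by (simp add: approximating_seq_def)
    then show "AE t in lebesgue_on A. limitin (seminorm_topology P) (\<lambda>k. g k t) (f t) sequentially"
      using A KL by (auto simp: AE_restrict_space_iff)
    fix e :: real and p assume "0 < e" and p: "p \<in> P"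
    then obtain k0 where "\<And>k m. k0 \<le> k \<Longrightarrow> k0 \<le> m \<Longrightarrow> (LINT t|lebesgue_on K. p (g k t - g m t)) \<le> e"
      using g unfolding approximating_seq_def by meson
    then show "\<exists>k0. \<forall>k\<ge>k0. \<forall>m\<ge>k0. (LINT t|lebesgue_on A. p (g k t - g m t)) \<le> e"
      using le[OF p] by (meson order_trans)
  qed
  then show "lcs_integrable P A f" by (auto simp: lcs_integrable_def)
  have eq: "simple_integral sc A (g k) = simple_integral sc K (\<lambda>t. sc (indicator A t) (g k t))" for k
  proof -
    \<comment> \<open>Pairing with the indicator splits each level of \<open>g k\<close> into its
      parts inside and outside \<open>A\<close>. Pairs with first entry \<open>0\<close> contribute
      nothing; those with first entry \<open>1\<close> are the levels on \<open>A\<close>.\<close>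
    let ?h = "\<lambda>t. (indicator A t :: complex, g k t)"
    let ?I = "?h ` K"
    have h: "simple_function (lebesgue_on K) ?h" by (rule simple_function_Pair[OF ind gs])
    have fin: "finite ?I" by (rule finite_simple_image[OF K h])
    have "simple_integral sc K (\<lambda>t. sc (indicator A t) (g k t)) =
       (\<Sum>y\<in>?I. sc (of_real (measure lebesgue {t \<in> K. ?h t = y})) (case y of (c, x) \<Rightarrow> sc c x))"
      using simple_integral_compose[OF K h fin order_refl, of "\<lambda>(c, x). sc c x"] by simp
    also have "\<dots> = (\<Sum>y\<in>(\<lambda>x. (1, x)) ` g k ` A. sc (of_real (measure lebesgue {t \<in> K. ?h t = y})) (case y of (c, x) \<Rightarrow> sc c x))"
    proof (rule sum.mono_neutral_right[OF fin])
      show "(\<lambda>x. (1, x)) ` g k ` A \<subseteq> ?I" using A by (force simp: image_iff)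
      show "\<forall>y\<in>?I - (\<lambda>x. (1, x)) ` g k ` A.
         sc (of_real (measure lebesgue {t \<in> K. ?h t = y})) (case y of (c, x) \<Rightarrow> sc c x) = 0"
      proof
        fix y assume "y \<in> ?I - (\<lambda>x. (1, x)) ` g k ` A"
        then obtain t where t: "t \<in> K" "y = ?h t" "y \<notin> (\<lambda>x. (1, x)) ` g k ` A" by blast
        then have "t \<notin> A" by auto
        with t show "sc (of_real (measure lebesgue {t \<in> K. ?h t = y})) (case y of (c, x) \<Rightarrow> sc c x) = 0"
          by simp
      qed
    qed
    also have "\<dots> = (\<Sum>x\<in>g k ` A. sc (of_real (measure lebesgue {t \<in> K. ?h t = (1, x)})) x)"
      by (subst sum.reindex) (auto simp: inj_on_def)
    also have "\<dots> = simple_integral sc A (g k)"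
    proof -
      have "{t \<in> K. ?h t = (1, x)} = {t \<in> A. g k t = x}" for x
        using A by (auto simp: indicator_def split: if_splits)
      then show ?thesis by (simp add: simple_integral_def)
    qed
    finally show ?thesis by simp
  qed
  show "lcs_integral sc P A f = lcs_integral sc P K (\<lambda>t. sc (indicator A t) (f t))"
    by (rule lcs_integral_eqI[OF AM gA]) (simp add: eq limitin_lcs_integral[OF K *])
qed

text \<open>The seminorm of the difference is at most the real integral of
  \<open>norm (\<psi> i t - \<psi>' t) * p (f t)\<close>, where dominated convergence applies.
  Convergence almost everywhere is allowed because indicators of moving boxes may fail to converge
  on the faces of the limit box.\<close>

lemma limitin_lcs_integral_dominated:
  fixes \<psi> :: "nat \<Rightarrow> real^'n \<Rightarrow> complex"
  assumes K: "K \<in> lmeasurable" and f: "lcs_integrable P K f"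
    and m: "\<And>i. \<psi> i \<in> borel_measurable (lebesgue_on K)" "\<psi>' \<in> borel_measurable (lebesgue_on K)"
    and B: "\<And>i t. t \<in> K \<Longrightarrow> norm (\<psi> i t) \<le> B"
    and lim: "AE t in lebesgue_on K. (\<lambda>i. \<psi> i t) \<longlonglongrightarrow> \<psi>' t" and B': "\<And>t. t \<in> K \<Longrightarrow> norm (\<psi>' t) \<le> B"
  shows "limitin (seminorm_topology P) (\<lambda>i. lcs_integral sc P K (\<lambda>t. sc (\<psi> i t) (f t)))
      (lcs_integral sc P K (\<lambda>t. sc (\<psi>' t) (f t))) sequentially"
  unfolding limitin_iff
proof
  have KL: "K \<in> sets lebesgue" using K by blast
  fix p assume p: "p \<in> P"
  have fp: "integrable (lebesgue_on K) (\<lambda>t. p (f t))" by (rule lcs_integrable_seminorm[OF K f p])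
  have BB: "norm (\<psi> i t - \<psi>' t) \<le> 2 * B" if "t \<in> K" for i t
    using norm_triangle_ineq4[of "\<psi> i t" "\<psi>' t"] B[OF that, of i] B'[OF that] by linarith
  have meas: "(\<lambda>t. norm (\<psi> i t - \<psi>' t) * p (f t)) \<in> borel_measurable (lebesgue_on K)" for i
    using m borel_measurable_integrable[OF fp] by simp
  have "(\<lambda>i. LINT t|lebesgue_on K. norm (\<psi> i t - \<psi>' t) * p (f t)) \<longlonglongrightarrow> (LINT t|lebesgue_on K. 0)"
  proof (rule integral_dominated_convergence[where w = "\<lambda>t. 2 * B * p (f t)"])
    show "AE t in lebesgue_on K. (\<lambda>i. norm (\<psi> i t - \<psi>' t) * p (f t)) \<longlonglongrightarrow> 0"
      using lim by eventually_elim (auto intro!: tendsto_mult_left_zero tendsto_norm_zero LIM_zero)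
    show "AE t in lebesgue_on K. norm (norm (\<psi> i t - \<psi>' t) * p (f t)) \<le> 2 * B * p (f t)" for i
      using BB seminorm_nonneg[OF p] KL
      by (intro AE_I2) (auto simp: space_restrict_space abs_mult intro!: mult_right_mono)
  qed (use meas fp in auto)
  then have lim0: "(\<lambda>i. LINT t|lebesgue_on K. norm (\<psi> i t - \<psi>' t) * p (f t)) \<longlonglongrightarrow> 0" by simp
  have "p (lcs_integral sc P K (\<lambda>t. sc (\<psi> i t) (f t)) - lcs_integral sc P K (\<lambda>t. sc (\<psi>' t) (f t)))
     \<le> (LINT t|lebesgue_on K. norm (\<psi> i t - \<psi>' t) * p (f t))" for i
  proof -
    note i = lcs_integrable_bounded_mult[OF K f m(1) B] lcs_integrable_bounded_mult[OF K f m(2) B']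
    have "lcs_integral sc P K (\<lambda>t. sc (\<psi> i t) (f t)) - lcs_integral sc P K (\<lambda>t. sc (\<psi>' t) (f t))
       = lcs_integral sc P K (\<lambda>t. sc (\<psi> i t) (f t) - sc (\<psi>' t) (f t))"
      using lcs_integral_diff[OF K i] by simp
    also have "p \<dots> \<le> (LINT t|lebesgue_on K. p (sc (\<psi> i t) (f t) - sc (\<psi>' t) (f t)))"
      by (rule lcs_integral_norm_bound[OF K lcs_integrable_diff[OF K i] p])
    also have "\<dots> = (LINT t|lebesgue_on K. norm (\<psi> i t - \<psi>' t) * p (f t))"
      by (simp add: scale_left_diff_distrib[symmetric] seminorm_scale[OF p])
    finally show ?thesis .
  qed
  then show "(\<lambda>i. p (lcs_integral sc P K (\<lambda>t. sc (\<psi> i t) (f t)) - lcs_integral sc P K (\<lambda>t. sc (\<psi>' t) (f t)))) \<longlonglongrightarrow> 0"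
    by (intro Lim_null_comparison[OF _ lim0] always_eventually) (simp add: seminorm_nonneg[OF p])
qed

end

section \<open>Partial summation on boxes\<close>

lemma mem_cbox_zero: "s \<in> cbox 0 (t :: real^'n) \<longleftrightarrow> (\<forall>j. 0 \<le> s $ j \<and> s $ j \<le> t $ j)"
  by (simp add: mem_box_cart)

lemma cbox_zero_subset_orthant: "cbox 0 t \<subseteq> orthant"
  by (auto simp: mem_cbox_zero orthant_def)

lemma cbox_zero_mono: "u \<in> cbox 0 t \<Longrightarrow> cbox 0 u \<subseteq> cbox 0 (t :: real^'n)"
proof
  fix x assume "u \<in> cbox 0 t" "x \<in> cbox 0 u"
  then have "0 \<le> x $ j \<and> x $ j \<le> u $ j \<and> u $ j \<le> t $ j" for j by (simp add: mem_cbox_zero)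
  then show "x \<in> cbox 0 t" unfolding mem_cbox_zero by (blast intro: order_trans)
qed

lemma borel_imp_lebesgue_on: "f \<in> borel_measurable borel \<Longrightarrow> f \<in> borel_measurable (lebesgue_on K)"
  by (intro measurable_restrict_space1 measurable_completion) simp

lemma grid_mono: "0 \<le> b \<Longrightarrow> i \<le> k \<Longrightarrow> b * real i / real N \<le> b * real k / real N"
  by (intro divide_right_mono mult_left_mono) auto

lemma grid_bounds:
  assumes "0 \<le> b" "i \<le> N" "0 < N"
  shows "0 \<le> b * real i / real N" "b * real i / real N \<le> b"
  using grid_mono[OF assms(1,2), of N] assms by simp_all

text \<open>The coefficients of Abel summation: for \<open>0 < N\<close> and
  \<open>m \<le> N\<close> the weights with index from \<open>m\<close> to \<open>N\<close>
  telescope to \<open>\<phi> (b * m / N)\<close>. The last weight is \<open>\<phi> b\<close> itself,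
  which closes the telescope.\<close>

definition step_weight :: "(real \<Rightarrow> complex) \<Rightarrow> real \<Rightarrow> nat \<Rightarrow> nat \<Rightarrow> complex" where
  "step_weight \<phi> b N i = (if i < N then \<phi> (b * i / N) - \<phi> (b * Suc i / N) else \<phi> b)"

text \<open>
  \<open>step_fun \<phi> b N\<close> is \<open>\<phi>\<close> rounded up to the grid of mesh \<open>b / N\<close> (lemma \<open>step_fun_eq\<close>), written with
  indicators of initial intervals only, so that products of such functions integrate \<open>f\<close> to values of
  \<^const>\<open>box_integral\<close>.
\<close>

definition step_fun :: "(real \<Rightarrow> complex) \<Rightarrow> real \<Rightarrow> nat \<Rightarrow> real \<Rightarrow> complex" where
  "step_fun \<phi> b N s = (\<Sum>i\<le>N. step_weight \<phi> b N i * indicator {..b * i / N} s)"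

text \<open>With \<open>m\<close> the least index whose grid point is not below \<open>s\<close>,
  exactly the indicators from \<open>m\<close> on are \<open>1\<close> at \<open>s\<close>, so the
  weights telescope. Minimality of \<open>m\<close> also keeps the grid point within one mesh of
  \<open>s\<close>.\<close>

lemma step_fun_eq:
  fixes b :: real
  assumes s: "0 \<le> s" "s \<le> b" and N: "0 < N"
  obtains m :: nat where "m \<le> N" "s \<le> b * m / N" "b * m / N \<le> s + b / N" "step_fun \<phi> b N s = \<phi> (b * m / N)"
proof -
  define m where "m = (LEAST i. s \<le> b * real i / N)"
  have ex: "s \<le> b * real N / N" using s N by simp
  have 1: "s \<le> b * m / N" unfolding m_def by (rule LeastI[of _ N]) (rule ex)
  have 2: "m \<le> N" unfolding m_def by (rule Least_le) (rule ex)
  have 3: "\<not> s \<le> b * i / N" if "i < m" for i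
    using that not_less_Least[of i "\<lambda>i. s \<le> b * real i / N"] by (simp add: m_def)
  have 4: "s \<le> b * i / N" if "m \<le> i" for i
    using order_trans[OF 1 grid_mono[OF _ that]] s by simp
  have 5: "b * m / N \<le> s + b / N"
  proof (cases m)
    case (Suc k)
    have "b * real (Suc k) / N = b * real k / N + b / N"
      by (simp add: distrib_left add_divide_distrib)
    then show ?thesis using 3[of k] Suc by simp
  next
    case 0
    then show ?thesis using s by simp
  qed
  have "step_fun \<phi> b N s = (\<Sum>i<N. step_weight \<phi> b N i * indicator {..b * i / N} s) + \<phi> b"
    using s N by (simp add: step_fun_def lessThan_Suc_atMost[symmetric] step_weight_def)
  also have "(\<Sum>i<N. step_weight \<phi> b N i * indicator {..b * i / N} s)
      = (\<Sum>i\<in>{m..<N}. \<phi> (b * i / N) - \<phi> (b * Suc i / N))"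
    by (rule sum.mono_neutral_cong_right) (use 3 4 in \<open>auto simp: step_weight_def indicator_def not_le\<close>)
  also have "\<dots> = \<phi> (b * m / N) - \<phi> (b * N / N)"
    using sum_Suc_diff'[OF 2, of "\<lambda>i. - \<phi> (b * i / N)"] by simp
  finally have "step_fun \<phi> b N s = \<phi> (b * m / N)" using N by simp
  with 1 2 5 show ?thesis using that by blast
qed

lemma step_fun_tendsto:
  assumes s: "0 \<le> s" "s \<le> b" and \<phi>: "continuous_on {0..b} \<phi>"
  shows "(\<lambda>n. step_fun \<phi> b (Suc n) s) \<longlonglongrightarrow> \<phi> s"
proof -
  have "\<exists>x. s \<le> x \<and> x \<le> s + b / Suc n \<and> x \<le> b \<and> step_fun \<phi> b (Suc n) s = \<phi> x" for n
  proof -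
    obtain m :: nat where m: "m \<le> Suc n" "s \<le> b * m / Suc n" "b * m / Suc n \<le> s + b / Suc n"
        "step_fun \<phi> b (Suc n) s = \<phi> (b * m / Suc n)"
      by (rule step_fun_eq[OF s zero_less_Suc, of n \<phi>])
    moreover have "b * m / Suc n \<le> b"
      by (rule grid_bounds(2)) (use m(1) s in auto)
    ultimately show ?thesis by (intro exI[of _ "b * m / Suc n"] conjI)
  qed
  then obtain x where "\<forall>n. s \<le> x n \<and> x n \<le> s + b / Suc n \<and> x n \<le> b \<and> step_fun \<phi> b (Suc n) s = \<phi> (x n)"
    using choice[of "\<lambda>n x. s \<le> x \<and> x \<le> s + b / Suc n \<and> x \<le> b \<and> step_fun \<phi> b (Suc n) s = \<phi> x"] by blast
  then have x: "\<And>n. s \<le> x n" "\<And>n. x n \<le> s + b / Suc n" "\<And>n. x n \<le> b"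
      "\<And>n. step_fun \<phi> b (Suc n) s = \<phi> (x n)"
    by simp_all
  have "(\<lambda>n. s + b * inverse (Suc n)) \<longlonglongrightarrow> s + b * 0"
    by (intro tendsto_intros LIMSEQ_inverse_real_of_nat)
  then have "(\<lambda>n. s + b / Suc n) \<longlonglongrightarrow> s" by (simp add: divide_inverse)
  then have "x \<longlonglongrightarrow> s"
    by (rule tendsto_sandwich[OF _ _ tendsto_const, rotated 2]) (use x in auto)
  then show ?thesis
    unfolding x(4) using x s by (intro continuous_on_tendsto_compose[OF \<phi>]) (auto intro!: always_eventually intro: order_trans)
qed

lemma step_fun_bounded:
  assumes b: "0 \<le> b" and \<phi>: "continuous_on {0..b} \<phi>"
  obtains B where "\<And>s. 0 \<le> s \<Longrightarrow> s \<le> b \<Longrightarrow> norm (\<phi> s) \<le> B"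
    "\<And>s n. 0 \<le> s \<Longrightarrow> s \<le> b \<Longrightarrow> norm (step_fun \<phi> b (Suc n) s) \<le> B"
proof -
  have "bounded (\<phi> ` {0..b})"
    using compact_continuous_image[OF \<phi>] by (simp add: compact_imp_bounded)
  then obtain B where B: "norm (\<phi> x) \<le> B" if "0 \<le> x" "x \<le> b" for x
    unfolding bounded_iff by (meson atLeastAtMost_iff imageI)
  have "norm (step_fun \<phi> b (Suc n) s) \<le> B" if s: "0 \<le> s" "s \<le> b" for s n
  proof -
    obtain m :: nat where m: "m \<le> Suc n" "step_fun \<phi> b (Suc n) s = \<phi> (b * m / Suc n)"
      by (rule step_fun_eq[OF s zero_less_Suc, of n \<phi>]) auto
    have "b * m / Suc n \<le> b"
      by (rule grid_bounds(2)) (use m(1) s in auto)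
    then show ?thesis using m(2) B[of "b * m / Suc n"] b by simp
  qed
  with B show ?thesis using that by blast
qed

lemma step_fun_measurable [measurable]: "step_fun \<phi> b N \<in> borel_measurable borel"
  unfolding step_fun_def by measurable

context sclcs
begin

lemma limitin_seminorm_le:
  assumes lim: "limitin (seminorm_topology P) u l sequentially" and p: "p \<in> P"
    and le: "\<And>k. p (u k) \<le> c"
  shows "p l \<le> c"
proof -
  have "(\<lambda>k. c + p (u k - l)) \<longlonglongrightarrow> c + 0"
    using lim p unfolding limitin_iff by (intro tendsto_intros) auto
  moreover have "p l \<le> c + p (u k - l)" for k
    using seminorm_le_add_diff[OF p, of l "u k"] seminorm_diff_commute[OF p, of l "u k"] le[of k] by simp
  ultimately show ?thesis by (intro LIMSEQ_le_const[of _ c]) auto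
qed

lemma locally_integrable_cbox: "locally_integrable P f \<Longrightarrow> lcs_integrable P (cbox 0 t) f"
  using cbox_zero_subset_orthant[of t] by (simp add: locally_integrable_def)

lemma box_integral_indicator:
  assumes f: "lcs_integrable P (cbox 0 t) f" and u: "u \<in> cbox 0 t"
  shows "box_integral sc P f u = lcs_integral sc P (cbox 0 t) (\<lambda>s. sc (indicator (cbox 0 u) s) (f s))"
  unfolding box_integral_def
  by (rule lcs_integral_subset(2)[OF _ _ cbox_zero_mono[OF u] f]) auto

text \<open>Multiplying out the product gives one term per choice \<open>k\<close> of an index in
  each coordinate. On \<open>cbox 0 t\<close> the product of the chosen indicators is the indicator
  of the box with upper corner \<open>a j (k j)\<close>, so that term integrates to a value of the
  primitive.\<close>

lemma lcs_integral_prod_indicators: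
  fixes c :: "'n::finite \<Rightarrow> nat \<Rightarrow> complex" and a :: "'n \<Rightarrow> nat \<Rightarrow> real"
  assumes f: "lcs_integrable P (cbox 0 t) f" and I: "finite I"
    and a: "\<And>j i. i \<in> I \<Longrightarrow> 0 \<le> a j i \<and> a j i \<le> t $ j"
  shows "lcs_integral sc P (cbox 0 t) (\<lambda>s. sc (\<Prod>j\<in>UNIV. \<Sum>i\<in>I. c j i * indicator {..a j i} (s $ j)) (f s))
    = (\<Sum>k\<in>PiE UNIV (\<lambda>_. I). sc (\<Prod>j\<in>UNIV. c j (k j)) (box_integral sc P f (\<chi> j. a j (k j))))"
proof -
  have K: "cbox 0 t \<in> lmeasurable" by simp
  let ?g = "\<lambda>k s. sc (indicator (cbox 0 (\<chi> j. a j (k j))) s) (f s)"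
  have int: "lcs_integrable P (cbox 0 t) (?g k)" for k
  proof (rule lcs_integrable_bounded_mult[OF K f, of _ 1])
    show "indicator (cbox 0 (\<chi> j. a j (k j))) \<in> borel_measurable (lebesgue_on (cbox 0 t))"
      by (rule borel_imp_lebesgue_on) simp
  qed (auto split: split_indicator)
  have u: "(\<chi> j. a j (k j)) \<in> cbox 0 t" if "k \<in> PiE UNIV (\<lambda>_. I)" for k
    using a that by (auto simp: mem_cbox_zero)
  have "lcs_integral sc P (cbox 0 t) (\<lambda>s. sc (\<Prod>j\<in>UNIV. \<Sum>i\<in>I. c j i * indicator {..a j i} (s $ j)) (f s))
    = lcs_integral sc P (cbox 0 t) (\<lambda>s. \<Sum>k\<in>PiE UNIV (\<lambda>_. I). sc (\<Prod>j\<in>UNIV. c j (k j)) (?g k s))"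
  proof (rule lcs_integral_cong[OF K])
    fix s assume s: "s \<in> cbox 0 t"
    have ind: "(\<Prod>j\<in>UNIV. indicator {..a j (k j)} (s $ j)) = (indicator (cbox 0 (\<chi> j. a j (k j))) s :: complex)" for k
    proof (cases "\<forall>j. s $ j \<le> a j (k j)")
      case True
      then show ?thesis using s by (simp add: indicator_def mem_cbox_zero)
    next
      case False
      then obtain j where "\<not> s $ j \<le> a j (k j)" by auto
      then have "(\<Prod>j\<in>UNIV. indicator {..a j (k j)} (s $ j)) = (0::complex)"
        by (intro prod_zero) (auto intro!: exI[of _ j])
      moreover have "s \<notin> cbox 0 (\<chi> j. a j (k j))" using False by (auto simp: mem_cbox_zero)
      ultimately show ?thesis by simp
    qed
    have "(\<Prod>j\<in>UNIV. \<Sum>i\<in>I. c j i * indicator {..a j i} (s $ j))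
       = (\<Sum>k\<in>PiE UNIV (\<lambda>_. I). \<Prod>j\<in>UNIV. c j (k j) * indicator {..a j (k j)} (s $ j))"
      by (rule prod_sum_PiE) (use I in auto)
    also have "\<dots> = (\<Sum>k\<in>PiE UNIV (\<lambda>_. I). (\<Prod>j\<in>UNIV. c j (k j)) * indicator (cbox 0 (\<chi> j. a j (k j))) s)"
      by (simp add: prod.distrib ind)
    finally show "sc (\<Prod>j\<in>UNIV. \<Sum>i\<in>I. c j i * indicator {..a j i} (s $ j)) (f s)
       = (\<Sum>k\<in>PiE UNIV (\<lambda>_. I). sc (\<Prod>j\<in>UNIV. c j (k j)) (?g k s))"
      by (simp add: scale_sum_left)
  qed
  also have "\<dots> = (\<Sum>k\<in>PiE UNIV (\<lambda>_. I). lcs_integral sc P (cbox 0 t) (\<lambda>s. sc (\<Prod>j\<in>UNIV. c j (k j)) (?g k s)))"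
    by (rule lcs_integral_sum[OF K, THEN conjunct2]) (rule lcs_integrable_scale[OF K int])
  also have "\<dots> = (\<Sum>k\<in>PiE UNIV (\<lambda>_. I). sc (\<Prod>j\<in>UNIV. c j (k j)) (box_integral sc P f (\<chi> j. a j (k j))))"
    by (intro sum.cong refl) (simp add: lcs_integral_scale[OF K int] box_integral_indicator[OF f u] del: scale_scale)
  finally show ?thesis .
qed

text \<open>The constants \<open>d j\<close> serve two uses: \<open>0\<close> for the a priori
  bound, and \<open>\<phi> j (t $ j)\<close> for the identity between the transforms of
  \<open>f\<close> and of its primitive.\<close>

lemma limitin_step_fun:
  fixes \<phi> :: "'n::finite \<Rightarrow> real \<Rightarrow> complex"
  assumes t: "t \<in> orthant" and f: "lcs_integrable P (cbox 0 t) f"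
    and \<phi>: "\<And>j. continuous_on {0..t $ j} (\<phi> j)"
  shows "limitin (seminorm_topology P)
     (\<lambda>n. lcs_integral sc P (cbox 0 t) (\<lambda>s. sc (\<Prod>j\<in>UNIV. step_fun (\<phi> j) (t $ j) (Suc n) (s $ j) - d j) (f s)))
     (lcs_integral sc P (cbox 0 t) (\<lambda>s. sc (\<Prod>j\<in>UNIV. \<phi> j (s $ j) - d j) (f s))) sequentially"
proof -
  have "\<exists>B. \<forall>s. 0 \<le> s \<longrightarrow> s \<le> t $ j \<longrightarrow> norm (\<phi> j s) \<le> B \<and> (\<forall>n. norm (step_fun (\<phi> j) (t $ j) (Suc n) s) \<le> B)" for j
    using step_fun_bounded[OF _ \<phi>[of j]] t by (simp add: orthant_def) metis
  then obtain B where B: "\<And>j s. 0 \<le> s \<Longrightarrow> s \<le> t $ j \<Longrightarrow> norm (\<phi> j s) \<le> B j"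
     "\<And>j s n. 0 \<le> s \<Longrightarrow> s \<le> t $ j \<Longrightarrow> norm (step_fun (\<phi> j) (t $ j) (Suc n) s) \<le> B j"
    by metis
  show ?thesis
  proof (rule limitin_lcs_integral_dominated[OF _ f, where B = "\<Prod>j\<in>UNIV. B j + norm (d j)"])
    show "(\<lambda>s :: real^'n. \<Prod>j\<in>UNIV. step_fun (\<phi> j) (t $ j) (Suc n) (s $ j) - d j) \<in> borel_measurable (lebesgue_on (cbox 0 t))" for n
      by (rule borel_imp_lebesgue_on) measurable
    have "continuous_on (cbox 0 t) (\<lambda>s :: real^'n. \<Prod>j\<in>UNIV. \<phi> j (s $ j) - d j)"
      by (intro continuous_intros continuous_on_compose2[OF \<phi>]) (auto simp: mem_cbox_zero)
    then show "(\<lambda>s :: real^'n. \<Prod>j\<in>UNIV. \<phi> j (s $ j) - d j) \<in> borel_measurable (lebesgue_on (cbox 0 t))"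
      by (rule continuous_imp_measurable_on_sets_lebesgue) simp
    show "norm (\<Prod>j\<in>UNIV. step_fun (\<phi> j) (t $ j) (Suc n) (s $ j) - d j) \<le> (\<Prod>j\<in>UNIV. B j + norm (d j))"
      if "s \<in> cbox 0 t" for n s
      unfolding prod_norm[symmetric] using that B(2)
      by (intro prod_mono) (auto simp: mem_cbox_zero intro!: order_trans[OF norm_triangle_ineq4] add_right_mono)
    show "norm (\<Prod>j\<in>UNIV. \<phi> j (s $ j) - d j) \<le> (\<Prod>j\<in>UNIV. B j + norm (d j))"
      if "s \<in> cbox 0 t" for s
      unfolding prod_norm[symmetric] using that B(1)
      by (intro prod_mono) (auto simp: mem_cbox_zero intro!: order_trans[OF norm_triangle_ineq4] add_right_mono)
    show "AE s in lebesgue_on (cbox 0 t). (\<lambda>n. \<Prod>j\<in>UNIV. step_fun (\<phi> j) (t $ j) (Suc n) (s $ j) - d j)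
       \<longlonglongrightarrow> (\<Prod>j\<in>UNIV. \<phi> j (s $ j) - d j)"
      by (intro AE_I2 tendsto_prod tendsto_diff tendsto_const step_fun_tendsto \<phi>)
        (auto simp: space_restrict_space mem_cbox_zero)
  qed simp
qed

text \<open>
  The hypothesis on \<open>V\<close> is chosen so that the variation of the step functions, weighted by \<open>w\<close>,
  telescopes.
\<close>

lemma lcs_integral_prod_bound:
  fixes \<phi> :: "'n::finite \<Rightarrow> real \<Rightarrow> complex" and w V :: "'n \<Rightarrow> real \<Rightarrow> real"
  assumes t: "t \<in> orthant" and f: "lcs_integrable P (cbox 0 t) f" and p: "p \<in> P"
    and \<phi>: "\<And>j. continuous_on {0..t $ j} (\<phi> j)"
    and G: "\<And>u. u \<in> cbox 0 t \<Longrightarrow> p (box_integral sc P f u) \<le> C * (\<Prod>j\<in>UNIV. w j (u $ j))" and C: "0 \<le> C"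
    and w: "\<And>j x. 0 \<le> x \<Longrightarrow> x \<le> t $ j \<Longrightarrow> 0 \<le> w j x"
    and V: "\<And>j x y. 0 \<le> x \<Longrightarrow> x \<le> y \<Longrightarrow> y \<le> t $ j \<Longrightarrow> norm (\<phi> j y - \<phi> j x) * w j x \<le> V j y - V j x"
  shows "p (lcs_integral sc P (cbox 0 t) (\<lambda>s. sc (\<Prod>j\<in>UNIV. \<phi> j (s $ j)) (f s)))
    \<le> C * (\<Prod>j\<in>UNIV. norm (\<phi> j (t $ j)) * w j (t $ j) + (V j (t $ j) - V j 0))"
proof (rule limitin_seminorm_le[OF _ p])
  show "limitin (seminorm_topology P)
     (\<lambda>n. lcs_integral sc P (cbox 0 t) (\<lambda>s. sc (\<Prod>j\<in>UNIV. step_fun (\<phi> j) (t $ j) (Suc n) (s $ j)) (f s)))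
     (lcs_integral sc P (cbox 0 t) (\<lambda>s. sc (\<Prod>j\<in>UNIV. \<phi> j (s $ j)) (f s))) sequentially"
    using limitin_step_fun[OF t f \<phi>, of "\<lambda>_. 0"] by simp
  have "p (lcs_integral sc P (cbox 0 t) (\<lambda>s. sc (\<Prod>j\<in>UNIV. step_fun (\<phi> j) (t $ j) N (s $ j)) (f s)))
     \<le> C * (\<Prod>j\<in>UNIV. norm (\<phi> j (t $ j)) * w j (t $ j) + (V j (t $ j) - V j 0))" if N: "0 < N" for N
  proof -
    let ?a = "\<lambda>j i. t $ j * real i / real N" and ?c = "\<lambda>j. step_weight (\<phi> j) (t $ j) N"
    have t0: "0 \<le> t $ j" for j using t by (simp add: orthant_def)
    have a: "0 \<le> ?a j i \<and> ?a j i \<le> t $ j" if "i \<in> {..N}" for i j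
      using grid_bounds[OF t0, of i N j] that N by simp
    have "lcs_integral sc P (cbox 0 t) (\<lambda>s. sc (\<Prod>j\<in>UNIV. step_fun (\<phi> j) (t $ j) N (s $ j)) (f s))
       = (\<Sum>k\<in>PiE UNIV (\<lambda>_. {..N}). sc (\<Prod>j\<in>UNIV. ?c j (k j)) (box_integral sc P f (\<chi> j. ?a j (k j))))"
      unfolding step_fun_def by (rule lcs_integral_prod_indicators[OF f _ a]) auto
    also have "p \<dots> \<le> (\<Sum>k\<in>PiE UNIV (\<lambda>_. {..N}). C * (\<Prod>j\<in>UNIV. norm (?c j (k j)) * w j (?a j (k j))))"
    proof (rule order_trans[OF seminorm_sum[OF p]], rule sum_mono)
      fix k :: "'n \<Rightarrow> nat" assume k: "k \<in> PiE UNIV (\<lambda>_. {..N})"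
      then have "(\<chi> j. ?a j (k j)) \<in> cbox 0 t" using a by (auto simp: mem_cbox_zero)
      from G[OF this] have "p (box_integral sc P f (\<chi> j. ?a j (k j))) \<le> C * (\<Prod>j\<in>UNIV. w j (?a j (k j)))"
        by simp
      then have "norm (\<Prod>j\<in>UNIV. ?c j (k j)) * p (box_integral sc P f (\<chi> j. ?a j (k j)))
          \<le> norm (\<Prod>j\<in>UNIV. ?c j (k j)) * (C * (\<Prod>j\<in>UNIV. w j (?a j (k j))))"
        by (rule mult_left_mono) simp
      then show "p (sc (\<Prod>j\<in>UNIV. ?c j (k j)) (box_integral sc P f (\<chi> j. ?a j (k j))))
         \<le> C * (\<Prod>j\<in>UNIV. norm (?c j (k j)) * w j (?a j (k j)))"
        by (simp add: seminorm_scale[OF p] prod.distrib prod_norm[symmetric] mult_ac)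
    qed
    \<comment> \<open>Because the bound on the primitive is itself a product over the coordinates,
      the sum over index functions factors back into one-variable sums.\<close>
    also have "\<dots> = C * (\<Prod>j\<in>UNIV. \<Sum>i\<le>N. norm (?c j i) * w j (?a j i))"
      by (subst prod_sum_PiE) (auto simp: sum_distrib_left)
    also have "\<dots> \<le> C * (\<Prod>j\<in>UNIV. norm (\<phi> j (t $ j)) * w j (t $ j) + (V j (t $ j) - V j 0))"
    proof (intro mult_left_mono[OF _ C] prod_mono conjI)
      fix j
      show "0 \<le> (\<Sum>i\<le>N. norm (?c j i) * w j (?a j i))"
        using a w by (intro sum_nonneg mult_nonneg_nonneg) auto
      \<comment> \<open>The top weight is a value of \<open>\<phi>\<close> and gives the endpoint
        term; the other weights are increments of \<open>\<phi>\<close> and give the weighted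
        variation.\<close>
      have "(\<Sum>i\<le>N. norm (?c j i) * w j (?a j i)) = (\<Sum>i<N. norm (?c j i) * w j (?a j i)) + norm (\<phi> j (t $ j)) * w j (t $ j)"
        using N by (simp add: lessThan_Suc_atMost[symmetric] step_weight_def)
      also have "(\<Sum>i<N. norm (?c j i) * w j (?a j i)) \<le> (\<Sum>i<N. V j (?a j (Suc i)) - V j (?a j i))"
      proof (rule sum_mono)
        fix i assume "i \<in> {..<N}"
        then have i: "i < N" by simp
        have "norm (\<phi> j (?a j (Suc i)) - \<phi> j (?a j i)) * w j (?a j i) \<le> V j (?a j (Suc i)) - V j (?a j i)"
          using a[of i j] a[of "Suc i" j] i grid_mono[OF t0, of i "Suc i" j N] by (intro V) auto
        then show "norm (?c j i) * w j (?a j i) \<le> V j (?a j (Suc i)) - V j (?a j i)"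
          using i by (simp add: step_weight_def norm_minus_commute)
      qed
      also have "\<dots> = V j (?a j N) - V j (?a j 0)"
        by (rule sum_lessThan_telescope)
      also have "\<dots> = V j (t $ j) - V j 0" using N by simp
      finally show "(\<Sum>i\<le>N. norm (?c j i) * w j (?a j i))
          \<le> norm (\<phi> j (t $ j)) * w j (t $ j) + (V j (t $ j) - V j 0)"
        by simp
    qed
    finally show ?thesis .
  qed
  then show "p (lcs_integral sc P (cbox 0 t) (\<lambda>s. sc (\<Prod>j\<in>UNIV. step_fun (\<phi> j) (t $ j) (Suc n) (s $ j)) (f s)))
     \<le> C * (\<Prod>j\<in>UNIV. norm (\<phi> j (t $ j)) * w j (t $ j) + (V j (t $ j) - V j 0))" for n by blast
qed

end

section \<open>Riemann sums\<close>

text \<open>The derivative of \<open>- exp (- c * h)\<close> at \<open>h = 0\<close>, taken along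
  \<open>h = 1 / (n + 1)\<close>. It supplies the limit of the correction factor between Riemann
  sums and step function integrals.\<close>

lemma tendsto_one_minus_exp:
  "(\<lambda>n. (1 - exp (- (c / of_nat (Suc n)))) * of_nat (Suc n)) \<longlonglongrightarrow> (c :: complex)"
proof -
  have "((\<lambda>h. - exp (- (c * h))) has_field_derivative c) (at 0)"
    by (auto intro!: derivative_eq_intros)
  then have "((\<lambda>h. (- exp (- (c * h)) - - exp (- (c * 0))) / (h - 0)) \<longlongrightarrow> c) (at 0)"
    by (simp add: has_field_derivative_iff)
  moreover have "filterlim (\<lambda>n. 1 / of_nat (Suc n) :: complex) (at 0) sequentially"
  proof -
    have "(\<lambda>n. 1 / of_nat (Suc n) :: complex) \<longlonglongrightarrow> 0"
      using LIMSEQ_Suc[OF lim_1_over_n[where 'a = complex]] by simp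
    then show ?thesis by (simp add: filterlim_at del: of_nat_Suc)
  qed
  ultimately have "(\<lambda>n. (- exp (- (c * (1 / of_nat (Suc n)))) - - exp (- (c * 0))) / (1 / of_nat (Suc n) - 0)) \<longlonglongrightarrow> c"
    by (rule filterlim_compose)
  then show ?thesis by (simp del: of_nat_Suc)
qed

lemma AE_hyperplane:
  fixes s :: "real^'n"
  assumes "K \<in> sets lebesgue"
  shows "AE r in lebesgue_on K. \<forall>j. r $ j \<noteq> s $ j"
proof -
  have "AE r in lebesgue. r $ j \<noteq> s $ j" for j
  proof -
    have "negligible {r. r $ j = s $ j}" using negligible_standard_hyperplane[of "axis j (1::real)" "s $ j"] by (simp add: cart_eq_inner_axis)
    then show ?thesis by (auto simp: negligible_iff_null_sets dest: AE_not_in)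
  qed
  then have "AE r in lebesgue. \<forall>j\<in>UNIV. r $ j \<noteq> s $ j"
    by (subst AE_finite_all) auto
  then have "AE r in lebesgue. r \<in> K \<longrightarrow> (\<forall>j. r $ j \<noteq> s $ j)" by eventually_elim simp
  then show ?thesis using assms by (simp add: AE_restrict_space_iff)
qed

text \<open>Cells are half-open, so a point with \<open>s $ j = t $ j\<close> gets index
  \<open>N\<close> in coordinate \<open>j\<close>: besides the \<open>N\<close> genuine cells per
  axis there is a boundary layer, which turns out to be null.\<close>

definition grid_index :: "real^'n \<Rightarrow> nat \<Rightarrow> real^'n \<Rightarrow> 'n \<Rightarrow> nat" where
  "grid_index t N s = (\<lambda>j. nat \<lfloor>s $ j * real N / t $ j\<rfloor>)"

definition grid_point :: "real^'n \<Rightarrow> nat \<Rightarrow> ('n \<Rightarrow> nat) \<Rightarrow> real^'n" where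
  "grid_point t N k = (\<chi> j. t $ j * real (k j) / real N)"

lemma grid_index_eq_iff:
  assumes t: "\<And>j. 0 < t $ j" and N: "0 < N" and s: "s \<in> cbox 0 t"
  shows "grid_index t N s = k \<longleftrightarrow>
    (\<forall>j. t $ j * real (k j) / real N \<le> s $ j \<and> s $ j < t $ j * real (Suc (k j)) / real N)"
proof -
  have "nat \<lfloor>s $ j * real N / t $ j\<rfloor> = k j \<longleftrightarrow>
    t $ j * real (k j) / real N \<le> s $ j \<and> s $ j < t $ j * real (Suc (k j)) / real N" for j
  proof -
    have "0 \<le> s $ j * real N / t $ j" using s t[of j] by (simp add: mem_cbox_zero)
    then have "nat \<lfloor>s $ j * real N / t $ j\<rfloor> = k j \<longleftrightarrow> \<lfloor>s $ j * real N / t $ j\<rfloor> = int (k j)"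
      by (simp add: nat_eq_iff)
    also have "\<dots> \<longleftrightarrow> real (k j) \<le> s $ j * real N / t $ j \<and> s $ j * real N / t $ j < real (Suc (k j))"
      by (simp add: floor_eq_iff add.commute)
    also have "\<dots> \<longleftrightarrow> t $ j * real (k j) / real N \<le> s $ j \<and> s $ j < t $ j * real (Suc (k j)) / real N"
      using t[of j] N by (simp add: divide_simps mult.commute del: of_nat_Suc)
    finally show ?thesis .
  qed
  then show ?thesis by (simp add: grid_index_def fun_eq_iff)
qed

lemma grid_index_le:
  assumes t: "\<And>j. 0 < t $ j" and N: "0 < N" and s: "s \<in> cbox 0 t"
  shows "grid_index t N s j \<le> N"
proof -
  have "t $ j * real (grid_index t N s j) / real N \<le> s $ j"
    using grid_index_eq_iff[OF t N s, of "grid_index t N s"] by blast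
  also have "\<dots> \<le> t $ j" using s by (simp add: mem_cbox_zero)
  finally show ?thesis using t[of j] N by (simp add: divide_le_eq)
qed

lemma grid_point_in_cbox:
  assumes t: "\<And>j. 0 < t $ j" and N: "0 < N" and k: "\<And>j. k j \<le> N"
  shows "grid_point t N k \<in> cbox 0 t"
  using grid_bounds[OF less_imp_le[OF t] k N] by (simp add: mem_cbox_zero grid_point_def)

lemma grid_point_tendsto:
  assumes t: "\<And>j. 0 < t $ j" and s: "s \<in> cbox 0 t"
  shows "(\<lambda>n. grid_point t (Suc n) (grid_index t (Suc n) s)) \<longlonglongrightarrow> s"
proof (rule vec_tendstoI)
  fix j
  let ?g = "\<lambda>n. grid_point t (Suc n) (grid_index t (Suc n) s) $ j"
  have b: "?g n \<le> s $ j" "s $ j - t $ j * inverse (Suc n) \<le> ?g n" for n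
  proof -
    have *: "t $ j * real (grid_index t (Suc n) s j) / real (Suc n) \<le> s $ j"
       "s $ j < t $ j * real (Suc (grid_index t (Suc n) s j)) / real (Suc n)"
      using grid_index_eq_iff[OF t _ s, of "Suc n" "grid_index t (Suc n) s"] by blast+
    show "?g n \<le> s $ j" using *(1) by (simp add: grid_point_def)
    have "t $ j * real (Suc (grid_index t (Suc n) s j)) / real (Suc n) = ?g n + t $ j * inverse (Suc n)"
      by (simp add: grid_point_def distrib_left add_divide_distrib divide_inverse del: of_nat_Suc)
         (simp add: algebra_simps)
    then show "s $ j - t $ j * inverse (Suc n) \<le> ?g n" using *(2) by simp
  qed
  have "(\<lambda>n. s $ j - t $ j * inverse (Suc n)) \<longlonglongrightarrow> s $ j - t $ j * 0"
    by (intro tendsto_intros LIMSEQ_inverse_real_of_nat)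
  then have "(\<lambda>n. s $ j - t $ j * inverse (Suc n)) \<longlonglongrightarrow> s $ j" by simp
  then show "?g \<longlonglongrightarrow> s $ j"
    by (rule tendsto_sandwich[OF _ _ _ tendsto_const, rotated 2]) (use b in auto)
qed

lemma grid_index_simple:
  assumes t: "\<And>j. 0 < (t :: real^'n) $ j" and N: "0 < N"
  shows "simple_function (lebesgue_on (cbox 0 t)) (grid_index t N)"
  unfolding simple_function_def
proof (intro conjI ballI)
  have "grid_index t N ` cbox 0 t \<subseteq> PiE UNIV (\<lambda>_. {..N})"
    using grid_index_le[OF t N] by auto
  then show "finite (grid_index t N ` space (lebesgue_on (cbox 0 t)))"
    by (simp add: space_restrict_space finite_PiE finite_subset)
  fix k
  have "grid_index t N -` {k} \<inter> space (lebesgue_on (cbox 0 t)) =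
     {s \<in> space (lebesgue_on (cbox 0 t)). \<forall>j\<in>UNIV. nat \<lfloor>s $ j * real N / t $ j\<rfloor> = k j}"
    by (auto simp: grid_index_def fun_eq_iff)
  also have "\<dots> \<in> sets (lebesgue_on (cbox 0 t))"
  proof (rule sets.sets_Collect_finite_All')
    fix j
    have "(\<lambda>s. real (nat \<lfloor>s $ j * real N / t $ j\<rfloor>)) \<in> borel_measurable (lebesgue_on (cbox 0 t))"
      by (rule borel_imp_lebesgue_on) measurable
    then have "{s \<in> space (lebesgue_on (cbox 0 t)). real (nat \<lfloor>s $ j * real N / t $ j\<rfloor>) = real (k j)} \<in> sets (lebesgue_on (cbox 0 t))"
      by measurable
    then show "{s \<in> space (lebesgue_on (cbox 0 t)). nat \<lfloor>s $ j * real N / t $ j\<rfloor> = k j} \<in> sets (lebesgue_on (cbox 0 t))"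
      by simp
  qed auto
  finally show "grid_index t N -` {k} \<inter> space (lebesgue_on (cbox 0 t)) \<in> sets (lebesgue_on (cbox 0 t))" .
qed

text \<open>The half-open cell lies between an open and a closed box with the same corners, and
  these have equal measure.\<close>

lemma measure_grid_cell:
  assumes t: "\<And>j. 0 < (t :: real^'n) $ j" and N: "0 < N" and k: "\<And>j. k j < N"
  shows "measure lebesgue {s \<in> cbox 0 t. grid_index t N s = k} = (\<Prod>j\<in>UNIV. t $ j / real N)"
proof -
  define C where "C = {s \<in> cbox 0 t. grid_index t N s = k}"
  let ?a = "grid_point t N k" and ?b = "grid_point t N (\<lambda>j. Suc (k j))"
  have ab: "?a $ j \<le> ?b $ j" "?b $ j - ?a $ j = t $ j / real N" for j
    using t[of j] N by (simp_all add: grid_point_def divide_right_mono mult_left_mono field_simps)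
  have C: "C \<in> lmeasurable"
    unfolding C_def by (rule simple_function_level_lmeasurable[OF _ grid_index_simple[OF t N]]) simp
  have inc: "?a \<in> cbox 0 t" "?b \<in> cbox 0 t"
    using k by (auto intro!: grid_point_in_cbox t N intro: less_imp_le simp: Suc_le_eq)
  have "C \<subseteq> cbox ?a ?b"
  proof
    fix s assume "s \<in> C"
    then have "s \<in> cbox 0 t" "grid_index t N s = k" by (auto simp: C_def)
    then have "?a $ j \<le> s $ j \<and> s $ j < ?b $ j" for j
      using grid_index_eq_iff[OF t N, of s k] by (simp add: grid_point_def del: of_nat_Suc)
    then show "s \<in> cbox ?a ?b" by (simp add: mem_box_cart(2) less_imp_le)
  qed
  then have "measure lebesgue C \<le> measure lebesgue (cbox ?a ?b)"
    using C by (intro measure_mono_fmeasurable) auto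
  moreover have "box ?a ?b \<subseteq> C"
  proof
    fix s assume s: "s \<in> box ?a ?b"
    then have "s \<in> cbox 0 t"
      using inc unfolding mem_cbox_zero mem_box_cart(1) by (meson less_imp_le order_trans)
    then show "s \<in> C"
      using s grid_index_eq_iff[OF t N, of s k] by (auto simp: C_def mem_box_cart(1) grid_point_def intro: less_imp_le)
  qed
  then have "measure lebesgue (box ?a ?b) \<le> measure lebesgue C"
    using C by (intro measure_mono_fmeasurable) auto
  moreover have "measure lebesgue (box ?a ?b) = measure lebesgue (cbox ?a ?b)"
    using ab by (simp add: measure_lborel_box_eq measure_lborel_cbox_eq)
  moreover have "measure lebesgue (cbox ?a ?b) = (\<Prod>j\<in>UNIV. t $ j / real N)"
  proof -
    have "cbox ?a ?b \<noteq> {}" using ab(1) by (simp add: interval_ne_empty_cart)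
    then show ?thesis using content_cbox_cart[of ?a ?b] ab by simp
  qed
  ultimately show ?thesis by (simp add: C_def)
qed

lemma measure_grid_cell_boundary:
  assumes t: "\<And>j. 0 < (t :: real^'n) $ j" and N: "0 < N" and k: "k j = N"
  shows "measure lebesgue {s \<in> cbox 0 t. grid_index t N s = k} = 0"
proof (rule negligible_imp_measure0, rule negligible_subset)
  show "negligible {s :: real^'n. s $ j = t $ j}" using negligible_standard_hyperplane[of "axis j (1::real)" "t $ j"] by (simp add: cart_eq_inner_axis)
  show "{s \<in> cbox 0 t. grid_index t N s = k} \<subseteq> {s. s $ j = t $ j}"
  proof clarify
    fix s assume s: "s \<in> cbox 0 t" and "k = grid_index t N s"
    then have "t $ j * real (k j) / real N \<le> s $ j"
      using grid_index_eq_iff[OF t N s, of k] by blast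
    then show "s $ j = t $ j" using s k N by (auto simp: mem_cbox_zero intro: antisym)
  qed
qed

context sclcs
begin

text \<open>Continuity is taken along sequences because dominated convergence delivers it in that
  form and sampling along grid points uses nothing more.\<close>

definition seq_continuous_on :: "(real^'n) set \<Rightarrow> (real^'n \<Rightarrow> 'x) \<Rightarrow> bool" where
  "seq_continuous_on K F \<longleftrightarrow> (\<forall>s\<in>K. \<forall>x. (\<forall>n. x n \<in> K) \<longrightarrow> x \<longlonglongrightarrow> s \<longrightarrow>
     limitin (seminorm_topology P) (\<lambda>n. F (x n)) (F s) sequentially)"

text \<open>Sampling at the lower corner of the cell of \<open>s\<close> gives simple functions
  converging pointwise. The simple integrals of this sequence are Riemann sums.\<close>

lemma approximating_seq_grid:
  assumes t: "\<And>j. 0 < t $ j" and F: "seq_continuous_on (cbox 0 t) F"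
    and B: "\<And>p s. p \<in> P \<Longrightarrow> s \<in> cbox 0 t \<Longrightarrow> p (F s) \<le> B p"
  shows "approximating_seq P (cbox 0 t) F (\<lambda>n s. F (grid_point t (Suc n) (grid_index t (Suc n) s)))"
proof (rule approximating_seq_bounded)
  show "simple_function (lebesgue_on (cbox 0 t)) (\<lambda>s. F (grid_point t (Suc n) (grid_index t (Suc n) s)))" for n
    by (rule simple_function_compose1[OF grid_index_simple[OF t]]) simp
  have g: "grid_point t (Suc n) (grid_index t (Suc n) s) \<in> cbox 0 t" if "s \<in> cbox 0 t" for n s
    by (intro grid_point_in_cbox t grid_index_le that) auto
  show "limitin (seminorm_topology P) (\<lambda>n. F (grid_point t (Suc n) (grid_index t (Suc n) s))) (F s) sequentially"
    if s: "s \<in> cbox 0 t" for s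
    by (rule F[unfolded seq_continuous_on_def, rule_format, OF s]) (rule g[OF s], rule grid_point_tendsto[OF t s])
  show "p (F (grid_point t (Suc n) (grid_index t (Suc n) s)) - F s) \<le> 2 * B p"
    if "p \<in> P" "s \<in> cbox 0 t" for p n s
    using seminorm_diff_le[OF that(1), of "F (grid_point t (Suc n) (grid_index t (Suc n) s))" "F s"]
      B[OF that] B[OF that(1) g[OF that(2), of n]] by linarith
qed simp

lemma limitin_Riemann_sum:
  assumes t: "\<And>j. 0 < (t :: real^'n) $ j" and F: "seq_continuous_on (cbox 0 t) F"
    and B: "\<And>p s. p \<in> P \<Longrightarrow> s \<in> cbox 0 t \<Longrightarrow> p (F s) \<le> B p"
  shows "limitin (seminorm_topology P)
    (\<lambda>n. \<Sum>k\<in>PiE UNIV (\<lambda>_. {..<Suc n}). sc (of_real (\<Prod>j\<in>UNIV. t $ j / real (Suc n))) (F (grid_point t (Suc n) k)))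
    (lcs_integral sc P (cbox 0 t) F) sequentially"
proof -
  have "simple_integral sc (cbox 0 t) (\<lambda>s. F (grid_point t N (grid_index t N s))) =
    (\<Sum>k\<in>PiE UNIV (\<lambda>_. {..<N}). sc (of_real (\<Prod>j\<in>UNIV. t $ j / real N)) (F (grid_point t N k)))"
    if N: "0 < N" for N
  proof -
    have "simple_integral sc (cbox 0 t) (\<lambda>s. F (grid_point t N (grid_index t N s))) =
      (\<Sum>k\<in>PiE UNIV (\<lambda>_. {..N}). sc (of_real (measure lebesgue {s \<in> cbox 0 t. grid_index t N s = k})) (F (grid_point t N k)))"
      by (rule simple_integral_compose[OF _ grid_index_simple[OF t N]])
        (use grid_index_le[OF t N] in \<open>auto simp: finite_PiE\<close>)
    \<comment> \<open>Index functions taking the value \<open>N\<close> somewhere describe the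
      boundary layer and have measure zero; the remaining cells all have the same measure.\<close>
    also have "\<dots> = (\<Sum>k\<in>PiE UNIV (\<lambda>_. {..<N}). sc (of_real (\<Prod>j\<in>UNIV. t $ j / real N)) (F (grid_point t N k)))"
    proof (rule sum.mono_neutral_cong_right)
      show "\<forall>k\<in>PiE UNIV (\<lambda>_. {..N}) - PiE UNIV (\<lambda>_. {..<N}).
         sc (of_real (measure lebesgue {s \<in> cbox 0 t. grid_index t N s = k})) (F (grid_point t N k)) = 0"
      proof
        fix k :: "'n \<Rightarrow> nat" assume "k \<in> PiE UNIV (\<lambda>_. {..N}) - PiE UNIV (\<lambda>_. {..<N})"
        then obtain j where "k j = N" by (force simp: PiE_iff le_less)
        from measure_grid_cell_boundary[of t N k, OF t N this]
        show "sc (of_real (measure lebesgue {s \<in> cbox 0 t. grid_index t N s = k})) (F (grid_point t N k)) = 0"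
          by simp
      qed
      show "sc (of_real (measure lebesgue {s \<in> cbox 0 t. grid_index t N s = k})) (F (grid_point t N k)) =
         sc (of_real (\<Prod>j\<in>UNIV. t $ j / real N)) (F (grid_point t N k))" if "k \<in> PiE UNIV (\<lambda>_. {..<N})" for k
        using measure_grid_cell[of t N k, OF t N] that by (auto simp: PiE_iff)
    qed (auto simp: finite_PiE PiE_iff intro: less_imp_le)
    finally show ?thesis .
  qed
  from this[OF zero_less_Suc] limitin_lcs_integral[OF _ approximating_seq_grid[OF t F B]]
  show ?thesis by simp
qed

text \<open>Off the null hyperplanes \<open>r $ j = s $ j\<close> every point is strictly inside or
  strictly outside the limit box, so the indicators of the approaching boxes are eventually constant
  there, and dominated convergence applies.\<close>

lemma seq_continuous_on_box_integral:
  assumes f: "lcs_integrable P (cbox 0 (t :: real^'n)) f"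
  shows "seq_continuous_on (cbox 0 t) (box_integral sc P f)"
  unfolding seq_continuous_on_def
proof (intro ballI allI impI)
  fix s :: "real^'n" and x assume s: "s \<in> cbox 0 t" and x: "\<forall>n. x n \<in> cbox 0 t" and lim: "x \<longlonglongrightarrow> s"
  have limj: "(\<lambda>n. x n $ j) \<longlonglongrightarrow> s $ j" for j using lim by (rule tendsto_vec_nth)
  have "limitin (seminorm_topology P)
     (\<lambda>n. lcs_integral sc P (cbox 0 t) (\<lambda>r. sc (indicator (cbox 0 (x n)) r) (f r)))
     (lcs_integral sc P (cbox 0 t) (\<lambda>r. sc (indicator (cbox 0 s) r) (f r))) sequentially"
  proof (rule limitin_lcs_integral_dominated[OF _ f, where B = 1])
    show "indicator (cbox 0 (x n)) \<in> borel_measurable (lebesgue_on (cbox 0 t))"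
      "indicator (cbox 0 s) \<in> borel_measurable (lebesgue_on (cbox 0 t))" for n
      by (rule borel_imp_lebesgue_on, simp)+
    show "AE r in lebesgue_on (cbox 0 t). (\<lambda>n. indicator (cbox 0 (x n)) r) \<longlonglongrightarrow> (indicator (cbox 0 s) r :: complex)"
      using AE_hyperplane[of "cbox 0 t" s, simplified] AE_space
    proof eventually_elim
      fix r assume r: "\<forall>j. r $ j \<noteq> s $ j" and "r \<in> space (lebesgue_on (cbox 0 t))"
      then have r0: "0 \<le> r $ j" for j by (simp add: space_restrict_space mem_cbox_zero)
      have "\<forall>\<^sub>F n in sequentially. indicator (cbox 0 (x n)) r = (indicator (cbox 0 s) r :: complex)"
      proof (cases "r \<in> cbox 0 s")
        case True
        then have "r $ j < s $ j" for j using r by (simp add: mem_cbox_zero less_le)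
        then have "\<forall>\<^sub>F n in sequentially. r $ j < x n $ j" for j
          using limj order_tendstoD(1) by blast
        then have "\<forall>\<^sub>F n in sequentially. \<forall>j. r $ j < x n $ j" by (rule eventually_all_finite)
        then show ?thesis by eventually_elim (use True r0 in \<open>simp add: mem_cbox_zero indicator_def less_imp_le\<close>)
      next
        case False
        then obtain j where "s $ j < r $ j" using r0 by (auto simp: mem_cbox_zero not_le)
        then have "\<forall>\<^sub>F n in sequentially. x n $ j < r $ j"
          using limj order_tendstoD(2) by blast
        then show ?thesis
        proof eventually_elim
          fix n assume "x n $ j < r $ j"
          then have "r \<notin> cbox 0 (x n)" by (auto simp: mem_cbox_zero not_le)
          with False show "indicator (cbox 0 (x n)) r = (indicator (cbox 0 s) r :: complex)" by simp
        qed
      qed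
      then show "(\<lambda>n. indicator (cbox 0 (x n)) r) \<longlonglongrightarrow> (indicator (cbox 0 s) r :: complex)"
        by (rule tendsto_eventually)
    qed
  qed (auto split: split_indicator)
  then show "limitin (seminorm_topology P) (\<lambda>n. box_integral sc P f (x n)) (box_integral sc P f s) sequentially"
    using x s by (simp add: box_integral_indicator[OF f])
qed

lemma box_integral_bounded:
  assumes f: "lcs_integrable P (cbox 0 t) f" and p: "p \<in> P" and s: "s \<in> cbox 0 t"
  shows "p (box_integral sc P f s) \<le> (LINT r|lebesgue_on (cbox 0 t). p (f r))"
proof -
  have K: "cbox 0 t \<in> lmeasurable" by simp
  have i: "lcs_integrable P (cbox 0 t) (\<lambda>r. sc (indicator (cbox 0 s) r) (f r))"
    by (rule lcs_integrable_bounded_mult[OF K f, of _ 1])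
      (auto intro: borel_imp_lebesgue_on split: split_indicator)
  have "p (box_integral sc P f s) \<le> (LINT r|lebesgue_on (cbox 0 t). p (sc (indicator (cbox 0 s) r) (f r)))"
    unfolding box_integral_indicator[OF f s] by (rule lcs_integral_norm_bound[OF K i p])
  also have "\<dots> \<le> (LINT r|lebesgue_on (cbox 0 t). p (f r))"
    using lcs_integrable_seminorm[OF K i p] lcs_integrable_seminorm[OF K f p] seminorm_nonneg[OF p]
    by (intro integral_mono) (auto simp: seminorm_scale[OF p] split: split_indicator)
  finally show ?thesis .
qed

lemma seq_continuous_on_scale:
  assumes F: "seq_continuous_on K F" and c: "continuous_on K c"
  shows "seq_continuous_on K (\<lambda>s. sc (c s) (F s))"
  unfolding seq_continuous_on_def
proof (intro ballI allI impI)
  fix s x assume "s \<in> K" "\<forall>n. x n \<in> K" "x \<longlonglongrightarrow> s"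
  then show "limitin (seminorm_topology P) (\<lambda>n. sc (c (x n)) (F (x n))) (sc (c s) (F s)) sequentially"
    using F unfolding seq_continuous_on_def
    by (intro limitin_scale continuous_on_tendsto_compose[OF c]) (auto intro: always_eventually)
qed

lemma locally_integrable_box_integral:
  fixes f :: "real^'n \<Rightarrow> 'x"
  assumes f: "locally_integrable P f"
  shows "locally_integrable P (box_integral sc P f)"
  unfolding locally_integrable_def
proof (intro allI impI)
  fix K :: "(real^'n) set" assume K: "compact K \<and> K \<subseteq> orthant"
  then obtain R where R: "\<And>s. s \<in> K \<Longrightarrow> norm s \<le> R" by (meson bounded_iff compact_imp_bounded)
  \<comment> \<open>The maximum with \<open>1\<close> gives the enclosing cube positive sides, as
    the grid construction requires.\<close>
  define t :: "real^'n" where "t = (\<chi> j. max R 1)"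
  have t: "0 < t $ j" for j by (simp add: t_def)
  have sub: "K \<subseteq> cbox 0 t"
  proof
    fix s assume s: "s \<in> K"
    have "s $ j \<le> max R 1" for j
      using component_le_norm_cart[of s j] R[OF s] by linarith
    then show "s \<in> cbox 0 t" using s K by (auto simp: mem_cbox_zero t_def orthant_def)
  qed
  note ft = locally_integrable_cbox[OF f, of t]
  have "lcs_integrable P (cbox 0 t) (box_integral sc P f)"
    unfolding lcs_integrable_def
    using approximating_seq_grid[OF t seq_continuous_on_box_integral[OF ft] box_integral_bounded[OF ft]] by blast
  then show "lcs_integrable P K (box_integral sc P f)"
    using K by (intro lcs_integral_subset(1)[OF _ _ sub]) (auto dest: lmeasurable_compact)
qed

end

section \<open>Exponential weights and the Laplace transform\<close>

text \<open>The integral of \<open>exp (a * s)\<close> over \<open>[0,x]\<close> for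
  \<open>x \<ge> 0\<close>, hence the second alternative for \<open>a_j\<close> in (P);
  \<open>a = 0\<close> is the removable singularity of the quotient.\<close>

definition exp_primitive :: "real \<Rightarrow> real \<Rightarrow> real" where
  "exp_primitive a x = (if a = 0 then x else (exp (a * x) - 1) / a)"

lemma exp_primitive_zero [simp]: "exp_primitive a 0 = 0"
  by (simp add: exp_primitive_def)

lemma exp_primitive_DERIV: "(exp_primitive a has_real_derivative exp (a * x)) (at x within S)"
proof (cases "a = 0")
  case True
  then have "exp_primitive a = (\<lambda>x. x)" by (auto simp: exp_primitive_def)
  with True show ?thesis by (auto intro!: derivative_eq_intros)
next
  case False
  then have "exp_primitive a = (\<lambda>x. (exp (a * x) - 1) / a)" by (auto simp: exp_primitive_def)
  with False show ?thesis by (auto intro!: derivative_eq_intros)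
qed

lemma integrable_exp_lebesgue_on: "integrable (lebesgue_on {0..x}) (\<lambda>s. exp (a * s :: real))"
  by (intro continuous_imp_integrable_real continuous_intros)

lemma integral_exp_eq_primitive:
  assumes "0 \<le> x"
  shows "(LINT s|lebesgue_on {0..x}. exp (a * s)) = exp_primitive a x"
proof -
  have "((\<lambda>s. exp (a * s)) has_integral (exp_primitive a x - exp_primitive a 0)) {0..x}"
    using assms by (intro fundamental_theorem_of_calculus)
      (auto simp: has_real_derivative_iff_has_vector_derivative[symmetric] exp_primitive_DERIV)
  then show ?thesis
    using lebesgue_integral_eq_integral[OF integrable_exp_lebesgue_on[of x a]]
    by (simp add: integral_unique)
qed

lemma exp_primitive_mono:
  assumes "0 \<le> x" "a \<le> b"
  shows "exp_primitive a x \<le> exp_primitive b x"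
  unfolding integral_exp_eq_primitive[OF assms(1), symmetric]
  using assms by (intro integral_mono integrable_exp_lebesgue_on) (auto intro: mult_right_mono)

lemma exp_primitive_nonneg: "0 \<le> x \<Longrightarrow> 0 \<le> exp_primitive a x"
  by (subst integral_exp_eq_primitive[symmetric]) (auto intro: integral_nonneg_AE)

lemma exp_primitive_le_pos: "0 < a \<Longrightarrow> exp_primitive a x \<le> exp (a * x) / a"
  by (simp add: exp_primitive_def divide_right_mono)

lemma exp_primitive_le_neg: "a < 0 \<Longrightarrow> exp_primitive a x \<le> 1 / - a"
  by (simp add: exp_primitive_def divide_simps)

text \<open>Supplies the function \<open>V\<close> of the product bound for an exponential
  \<open>\<phi>\<close>. The left side is the increment of a curve whose speed at \<open>s\<close>
  is at most \<open>norm z * exp ((Re z + \<mu>) * s)\<close>, since \<open>\<mu> \<ge> 0\<close>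
  allows the weight at \<open>x\<close> to be replaced by the one at \<open>s\<close>; the mean
  value inequality integrates this.\<close>

lemma exp_increment_le:
  fixes z :: complex
  assumes "0 \<le> x" "x \<le> y" "0 \<le> \<mu>"
  shows "norm (exp (z * of_real y) - exp (z * of_real x)) * exp (\<mu> * x)
    \<le> norm z * exp_primitive (Re z + \<mu>) y - norm z * exp_primitive (Re z + \<mu>) x"
proof (cases "x = y")
  case False
  have "norm (exp (z * of_real y) * of_real (exp (\<mu> * x)) - exp (z * of_real x) * of_real (exp (\<mu> * x)))
    \<le> norm z * exp_primitive (Re z + \<mu>) y - norm z * exp_primitive (Re z + \<mu>) x"
  proof (rule differentiable_bound_general)
    show "x < y" using assms False by simp
    show "continuous_on {x..y} (\<lambda>s. exp (z * of_real s) * of_real (exp (\<mu> * x)))"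
      by (intro continuous_intros)
    show "((\<lambda>s. exp (z * of_real s) * of_real (exp (\<mu> * x))) has_vector_derivative
        z * exp (z * of_real s) * of_real (exp (\<mu> * x))) (at s)" for s
      by (rule has_vector_derivative_real_field) (auto intro!: derivative_eq_intros)
    have d: "((\<lambda>s. norm z * exp_primitive (Re z + \<mu>) s) has_real_derivative norm z * exp ((Re z + \<mu>) * s)) (at s)" for s
      by (intro DERIV_cmult exp_primitive_DERIV)
    then show "((\<lambda>s. norm z * exp_primitive (Re z + \<mu>) s) has_vector_derivative
        norm z * exp ((Re z + \<mu>) * s)) (at s)" for s
      by (simp add: has_real_derivative_iff_has_vector_derivative)
    show "continuous_on {x..y} (\<lambda>s. norm z * exp_primitive (Re z + \<mu>) s)"
      by (intro continuous_at_imp_continuous_on ballI DERIV_isCont[OF d])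
    fix s assume "x < s"
    then have "\<mu> * x \<le> \<mu> * s" using assms by (simp add: mult_left_mono)
    then show "norm (z * exp (z * of_real s) * of_real (exp (\<mu> * x))) \<le> norm z * exp ((Re z + \<mu>) * s)"
      by (simp add: norm_mult mult.assoc exp_add[symmetric] distrib_right mult_left_mono)
  qed
  then show ?thesis by (simp add: norm_mult left_diff_distrib[symmetric])
qed simp

text \<open>The \<open>2^n\<close> choices in (P) are the expansion of a product of binomials. In
  factored form (P) has the shape that the product bound consumes and produces.\<close>

lemma sum_Pow_exp_eq_prod:
  assumes "t \<in> orthant"
  shows "(\<Sum>S\<in>Pow UNIV. \<Prod>j\<in>UNIV. if j \<in> S then exp (a j * t $ j)
      else (LINT s|lebesgue_on {0..t $ j}. exp (a j * s)))
    = (\<Prod>j\<in>UNIV. exp (a j * t $ j) + exp_primitive (a j) (t $ j))"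
proof -
  have "0 \<le> t $ j" for j using assms by (simp add: orthant_def)
  then show ?thesis
    by (simp add: prod_add prod.If_cases Compl_eq_Diff_UNIV integral_exp_eq_primitive)
qed

lemma orthant_measurable [simp]: "(orthant :: (real^'n) set) \<in> sets lebesgue"
proof -
  have "closed (orthant :: (real^'n) set)"
    unfolding orthant_def by (intro closed_Collect_all closed_Collect_le continuous_intros)
  then show ?thesis by simp
qed

text \<open>Written as a product over \<open>Basis\<close> of one-variable functions supported on
  \<open>{0..}\<close>, the integral factors by Tonelli's theorem, and each factor equals
  \<open>1 / \<delta> j\<close>.\<close>

lemma integrable_exp_orthant:
  fixes \<delta> :: "'n::finite \<Rightarrow> real"
  assumes \<delta>: "\<And>j. 0 < \<delta> j"
  shows "integrable (lebesgue_on orthant) (\<lambda>t :: real^'n. \<Prod>j\<in>UNIV. exp (- \<delta> j * t $ j))"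
proof (rule integrableI_nonneg)
  let ?e = "\<lambda>j r. ennreal (exp (- \<delta> j * r)) * indicator {0..} r"
  show "(\<lambda>t :: real^'n. \<Prod>j\<in>UNIV. exp (- \<delta> j * t $ j)) \<in> borel_measurable (lebesgue_on orthant)"
    by (rule borel_imp_lebesgue_on) measurable
  show "AE t in lebesgue_on orthant. 0 \<le> (\<Prod>j\<in>UNIV. exp (- \<delta> j * t $ j))"
    by (simp add: prod_nonneg)
  have "(\<integral>\<^sup>+(t :: real^'n). ennreal (\<Prod>j\<in>UNIV. exp (- \<delta> j * t $ j)) \<partial>lebesgue_on orthant)
     = (\<integral>\<^sup>+(t :: real^'n). ennreal (\<Prod>j\<in>UNIV. exp (- \<delta> j * t $ j)) * indicator orthant t \<partial>lborel)"
    by (simp add: nn_integral_restrict_space nn_integral_completion)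
  also have "\<dots> = (\<integral>\<^sup>+(t :: real^'n). (\<Prod>b\<in>Basis. ?e (axis_index b) (t \<bullet> b)) \<partial>lborel)"
  proof (rule nn_integral_cong)
    fix t :: "real^'n"
    have B: "(Basis :: (real^'n) set) = range (\<lambda>i. axis i 1)" by (auto simp: Basis_vec_def)
    have "(\<Prod>b\<in>Basis. ?e (axis_index b) (t \<bullet> b)) = (\<Prod>j\<in>UNIV. ?e j (t $ j))"
      unfolding B by (subst prod.reindex) (auto simp: inj_on_def axis_eq_axis axis_index_axis cart_eq_inner_axis)
    also have "\<dots> = (\<Prod>j\<in>UNIV. ennreal (exp (- \<delta> j * t $ j))) * (\<Prod>j\<in>UNIV. indicator {0..} (t $ j))"
      by (rule prod.distrib)
    also have "(\<Prod>j\<in>UNIV. indicator {0..} (t $ j) :: ennreal) = indicator orthant t"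
    proof (cases "t \<in> orthant")
      case False
      then obtain j where "\<not> 0 \<le> t $ j" by (auto simp: orthant_def)
      then have "(\<Prod>j\<in>UNIV. indicator {0..} (t $ j)) = (0 :: ennreal)"
        by (intro prod_zero) (auto intro!: exI[of _ j])
      with False show ?thesis by simp
    qed (simp add: orthant_def)
    finally show "ennreal (\<Prod>j\<in>UNIV. exp (- \<delta> j * t $ j)) * indicator orthant t
       = (\<Prod>b\<in>Basis. ?e (axis_index b) (t \<bullet> b))"
      by (simp add: prod_ennreal)
  qed
  also have "\<dots> = (\<Prod>b\<in>(Basis :: (real^'n) set). \<integral>\<^sup>+r. ?e (axis_index b) r \<partial>lborel)"
    by (rule nn_integral_lborel_prod) auto
  also have "\<dots> < \<infinity>"
  proof -
    have "(\<integral>\<^sup>+r. ?e j r \<partial>lborel) = ennreal (0 - (- 1 / \<delta> j * exp (- \<delta> j * 0)))" for j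
    proof (rule nn_integral_FTC_atLeast)
      show "((\<lambda>r. - 1 / \<delta> j * exp (- \<delta> j * r)) has_real_derivative exp (- \<delta> j * r)) (at r)" for r
        using \<delta>[of j] by (auto intro!: derivative_eq_intros)
      have "((\<lambda>r. exp (- (\<delta> j * r))) \<longlongrightarrow> 0) at_top"
        by (rule filterlim_compose[OF exp_at_bot])
          (auto simp: filterlim_uminus_at_bot intro!: filterlim_tendsto_pos_mult_at_top[OF tendsto_const \<delta>] filterlim_ident)
      then show "((\<lambda>r. - 1 / \<delta> j * exp (- \<delta> j * r)) \<longlongrightarrow> 0) at_top"
        using tendsto_mult_right_zero[of "\<lambda>r. exp (- (\<delta> j * r))" at_top "- 1 / \<delta> j"] by simp
    qed auto
    then show ?thesis by (simp add: ennreal_prod_eq_top less_top[symmetric])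
  qed
  finally show "(\<integral>\<^sup>+(t :: real^'n). ennreal (\<Prod>j\<in>UNIV. exp (- \<delta> j * t $ j)) \<partial>lebesgue_on orthant) < \<infinity>" .
qed

context sclcs
begin

lemma exp_weighted_prod:
  "exp_weighted sc lam f s = sc (\<Prod>j\<in>UNIV. exp (- (lam $ j) * of_real (s $ j))) (f s)"
  by (simp add: exp_weighted_def sum_negf[symmetric] exp_sum)

lemma seminorm_exp_weighted:
  "p \<in> P \<Longrightarrow> p (exp_weighted sc lam f s) = (\<Prod>j\<in>UNIV. exp (- Re (lam $ j) * s $ j)) * p (f s)"
  by (simp add: exp_weighted_prod seminorm_scale prod_norm[symmetric])

lemma lcs_integrable_exp_weighted:
  assumes f: "lcs_integrable P (cbox 0 (t :: real^'n)) f"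
  shows "lcs_integrable P (cbox 0 t) (exp_weighted sc lam f)"
  unfolding exp_weighted_prod[abs_def]
  by (intro lcs_integrable_continuous_mult f continuous_intros) simp

text \<open>The constants \<open>c j\<close> are there for the expansion used in part (iii): with
  \<open>z j = 0\<close> the factor does not depend on \<open>s $ j\<close> and can carry a value
  frozen at \<open>t $ j\<close>. Weights with \<open>\<mu> = 0\<close> give part (ii).\<close>

lemma lcs_integral_exp_bound:
  fixes c z :: "'n::finite \<Rightarrow> complex" and \<mu> :: "'n \<Rightarrow> real"
  assumes t: "t \<in> orthant" and f: "lcs_integrable P (cbox 0 t) f" and p: "p \<in> P" and C: "0 \<le> C"
    and \<mu>: "\<And>j. 0 \<le> \<mu> j"
    and G: "\<And>u. u \<in> orthant \<Longrightarrow> p (box_integral sc P f u) \<le> C * (\<Prod>j\<in>UNIV. exp (\<mu> j * u $ j))"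
  shows "p (lcs_integral sc P (cbox 0 t) (\<lambda>s. sc (\<Prod>j\<in>UNIV. c j * exp (z j * of_real (s $ j))) (f s)))
    \<le> C * (\<Prod>j\<in>UNIV. norm (c j) * (exp ((Re (z j) + \<mu> j) * t $ j)
         + norm (z j) * exp_primitive (Re (z j) + \<mu> j) (t $ j)))"
proof -
  have "p (lcs_integral sc P (cbox 0 t) (\<lambda>s. sc (\<Prod>j\<in>UNIV. c j * exp (z j * of_real (s $ j))) (f s)))
    \<le> C * (\<Prod>j\<in>UNIV. norm (c j * exp (z j * of_real (t $ j))) * exp (\<mu> j * t $ j)
        + (norm (c j) * (norm (z j) * exp_primitive (Re (z j) + \<mu> j) (t $ j))
           - norm (c j) * (norm (z j) * exp_primitive (Re (z j) + \<mu> j) 0)))"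
  proof (rule lcs_integral_prod_bound[OF t f p, where w = "\<lambda>j x. exp (\<mu> j * x)"
        and V = "\<lambda>j x. norm (c j) * (norm (z j) * exp_primitive (Re (z j) + \<mu> j) x)"])
    show "continuous_on {0..t $ j} (\<lambda>x. c j * exp (z j * complex_of_real x))" for j
      by (intro continuous_intros)
    show "p (box_integral sc P f u) \<le> C * (\<Prod>j\<in>UNIV. exp (\<mu> j * u $ j))" if "u \<in> cbox 0 t" for u
      using G that cbox_zero_subset_orthant by blast
    show "norm (c j * exp (z j * complex_of_real y) - c j * exp (z j * complex_of_real x)) * exp (\<mu> j * x)
        \<le> norm (c j) * (norm (z j) * exp_primitive (Re (z j) + \<mu> j) y)
          - norm (c j) * (norm (z j) * exp_primitive (Re (z j) + \<mu> j) x)"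
      if "0 \<le> x" "x \<le> y" for j x y
      using mult_left_mono[OF exp_increment_le[OF that \<mu>, of "z j" j], of "norm (c j)"]
      by (simp add: right_diff_distrib[symmetric] norm_mult mult.assoc)
  qed (use C in auto)
  also have "\<dots> = C * (\<Prod>j\<in>UNIV. norm (c j) * (exp ((Re (z j) + \<mu> j) * t $ j)
         + norm (z j) * exp_primitive (Re (z j) + \<mu> j) (t $ j)))"
    by (simp add: norm_mult distrib_left distrib_right exp_add mult.assoc)
  finally show ?thesis .
qed

section \<open>Growth of primitives: parts (i) and (ii)\<close>

lemma nn_integral_seminorm_le_exp:
  fixes f :: "real^'n \<Rightarrow> 'x"
  assumes lam0: "lam0 \<in> Omega_abs sc P f" and p: "p \<in> P"
  shows "\<exists>M>0. \<forall>t\<in>orthant. (\<integral>\<^sup>+ s. ennreal (p (f s)) \<partial>lebesgue_on (cbox 0 t))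
    \<le> ennreal (M * exp (\<Sum>j\<in>UNIV. max 0 (Re (lam0 $ j)) * t $ j))"
proof -
  define c where "c = (\<integral>\<^sup>+ s. ennreal (p (exp_weighted sc lam0 f s)) \<partial>lebesgue_on orthant)"
  have f: "locally_integrable P f" and c: "c < \<infinity>"
    using lam0 p by (auto simp: Omega_abs_def c_def)
  \<comment> \<open>Undoing the weight costs \<open>exp (Re (lam0 $ j) * s $ j)\<close> in each
    coordinate, which on the box is at most \<open>exp (max 0 (Re (lam0 $ j)) * t $ j)\<close>. The
    \<open>1\<close> added to \<open>c\<close> keeps the constant positive when the weighted
    integral vanishes.\<close>
  have "(\<integral>\<^sup>+ s. ennreal (p (f s)) \<partial>lebesgue_on (cbox 0 t))
    \<le> ennreal ((enn2real c + 1) * exp (\<Sum>j\<in>UNIV. max 0 (Re (lam0 $ j)) * t $ j))" if t: "t \<in> orthant" for t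
  proof -
    let ?e = "exp (\<Sum>j\<in>UNIV. max 0 (Re (lam0 $ j)) * t $ j)"
    have "(\<integral>\<^sup>+ s. ennreal (p (f s)) \<partial>lebesgue_on (cbox 0 t))
      \<le> (\<integral>\<^sup>+ s. ennreal ?e * ennreal (p (exp_weighted sc lam0 f s)) \<partial>lebesgue_on (cbox 0 t))"
    proof (rule nn_integral_mono)
      fix s assume "s \<in> space (lebesgue_on (cbox 0 t))"
      then have s: "0 \<le> s $ j" "s $ j \<le> t $ j" for j by (simp_all add: space_restrict_space mem_cbox_zero)
      have "p (f s) = exp (\<Sum>j\<in>UNIV. Re (lam0 $ j) * s $ j) * p (exp_weighted sc lam0 f s)"
        by (simp add: seminorm_exp_weighted[OF p] exp_sum prod.distrib[symmetric] mult.assoc[symmetric] exp_add[symmetric])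
      also have "\<dots> \<le> ?e * p (exp_weighted sc lam0 f s)"
        using s by (intro mult_right_mono seminorm_nonneg[OF p]) (auto intro!: sum_mono mult_mono)
      finally show "ennreal (p (f s)) \<le> ennreal ?e * ennreal (p (exp_weighted sc lam0 f s))"
        by (simp add: ennreal_mult[symmetric] seminorm_nonneg[OF p] ennreal_leI)
    qed
    also have "\<dots> = ennreal ?e * (\<integral>\<^sup>+ s. ennreal (p (exp_weighted sc lam0 f s)) \<partial>lebesgue_on (cbox 0 t))"
      using lcs_integrable_seminorm[OF _ lcs_integrable_exp_weighted[OF locally_integrable_cbox[OF f]] p]
      by (intro nn_integral_cmult) (auto intro: borel_measurable_integrable)
    also have "\<dots> \<le> ennreal ?e * c"
      unfolding c_def using cbox_zero_subset_orthant[of t]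
      by (intro mult_left_mono) (auto simp: nn_integral_restrict_space intro!: nn_integral_mono split: split_indicator)
    also have "\<dots> = ennreal ?e * ennreal (enn2real c)"
      using c by (simp add: less_top)
    also have "\<dots> \<le> ennreal ((enn2real c + 1) * ?e)"
      by (simp add: ennreal_mult[symmetric] ennreal_leI mult.commute)
    finally show ?thesis .
  qed
  moreover have "0 < enn2real c + 1" by (simp add: add_nonneg_pos)
  ultimately show ?thesis by blast
qed

lemma Omega_b_imp_property_P:
  assumes lam0: "lam0 \<in> Omega_b sc P f"
  shows "property_P sc P f lam0"
  unfolding property_P_def
proof
  fix p assume p: "p \<in> P"
  have f: "locally_integrable P f" using lam0 by (simp add: Omega_b_def)
  obtain B where B: "\<And>t. t \<in> orthant \<Longrightarrow> p (I_lap sc P f lam0 t) \<le> B"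
    using lam0 p unfolding Omega_b_def by blast
  have z: "0 \<in> orthant" by (simp add: orthant_def)
  have B0: "0 \<le> B" using order_trans[OF seminorm_nonneg[OF p] B[OF z]] .
  \<comment> \<open>The product bound yields factors with coefficient \<open>1\<close> on the
    exponential and \<open>norm (lam0 $ j)\<close> on its primitive; the larger of the two is pulled
    out to match (P). The later \<open>+ 1\<close> makes the constant strictly positive.\<close>
  let ?L = "\<Prod>j\<in>UNIV. max 1 (norm (lam0 $ j))"
  have L: "0 \<le> ?L" by (intro prod_nonneg) auto
  let ?a = "\<lambda>t j. exp (Re (lam0 $ j) * t $ j)" and ?b = "\<lambda>t j. exp_primitive (Re (lam0 $ j)) (t $ j)"
  have "p (box_integral sc P f t) \<le> (B * ?L + 1) * (\<Prod>j\<in>UNIV. ?a t j + ?b t j)"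
    if t: "t \<in> orthant" for t
  proof -
    have t0: "0 \<le> t $ j" for j using t by (simp add: orthant_def)
    have "p (box_integral sc P f t) = p (lcs_integral sc P (cbox 0 t)
       (\<lambda>s. sc (\<Prod>j\<in>UNIV. 1 * exp (lam0 $ j * of_real (s $ j))) (exp_weighted sc lam0 f s)))"
      unfolding box_integral_def
      by (simp add: exp_weighted_prod prod.distrib[symmetric] exp_add[symmetric])
    also have "\<dots> \<le> B * (\<Prod>j\<in>UNIV. norm (1 :: complex) * (exp ((Re (lam0 $ j) + 0) * t $ j)
         + norm (lam0 $ j) * exp_primitive (Re (lam0 $ j) + 0) (t $ j)))"
      using B B0 by (intro lcs_integral_exp_bound[OF t lcs_integrable_exp_weighted[OF locally_integrable_cbox[OF f]] p])
        (auto simp: I_lap_def)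
    also have "\<dots> \<le> B * (\<Prod>j\<in>UNIV. max 1 (norm (lam0 $ j)) * (?a t j + ?b t j))"
    proof (intro mult_left_mono[OF _ B0] prod_mono conjI)
      fix j
      show "norm (1 :: complex) * (exp ((Re (lam0 $ j) + 0) * t $ j)
         + norm (lam0 $ j) * exp_primitive (Re (lam0 $ j) + 0) (t $ j)) \<le> max 1 (norm (lam0 $ j)) * (?a t j + ?b t j)"
        using exp_primitive_nonneg[OF t0[of j], of "Re (lam0 $ j)"]
        by (simp add: distrib_left add_mono mult_right_mono)
    qed (use exp_primitive_nonneg[OF t0] in auto)
    also have "\<dots> = B * ?L * (\<Prod>j\<in>UNIV. ?a t j + ?b t j)"
      by (simp add: prod.distrib)
    also have "\<dots> \<le> (B * ?L + 1) * (\<Prod>j\<in>UNIV. ?a t j + ?b t j)"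
      using exp_primitive_nonneg[OF t0] by (intro mult_right_mono prod_nonneg) auto
    finally show ?thesis .
  qed
  moreover have "0 < B * ?L + 1" using B0 L by (simp add: add_nonneg_pos)
  ultimately show "\<exists>M>0. \<forall>t\<in>orthant. p (box_integral sc P f t) \<le> M *
      (\<Sum>S\<in>Pow UNIV. \<Prod>j\<in>UNIV. if j \<in> S then exp (Re (lam0 $ j) * t $ j)
         else (LINT s|lebesgue_on {0..t $ j}. exp (Re (lam0 $ j) * s)))"
    by (intro exI[of _ "B * ?L + 1"] conjI ballI) (simp_all only: sum_Pow_exp_eq_prod)
qed

section \<open>From (P) to the transforms: part (iii)\<close>

lemma property_P_exp_bound:
  assumes P: "property_P sc P f lam0" and p: "p \<in> P"
    and \<mu>: "\<And>j. 0 < \<mu> j" "\<And>j. Re (lam0 $ j) \<le> \<mu> j"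
  shows "\<exists>C\<ge>0. \<forall>t\<in>orthant. p (box_integral sc P f t) \<le> C * (\<Prod>j\<in>UNIV. exp (\<mu> j * t $ j))"
proof -
  obtain M where M: "0 < M" "\<And>t. t \<in> orthant \<Longrightarrow> p (box_integral sc P f t) \<le> M *
      (\<Sum>S\<in>Pow UNIV. \<Prod>j\<in>UNIV. if j \<in> S then exp (Re (lam0 $ j) * t $ j)
         else (LINT s|lebesgue_on {0..t $ j}. exp (Re (lam0 $ j) * s)))"
    using P p unfolding property_P_def by blast
  \<comment> \<open>The \<open>1\<close> pays for the exponential alternative. The
    \<open>1 / \<mu> j\<close> pays for its primitive, which is monotone in the exponent and
    therefore comparable with the primitive for \<open>\<mu> j\<close>.\<close>
  let ?A = "\<lambda>j. 1 + 1 / \<mu> j"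
  have "p (box_integral sc P f t) \<le> M * (\<Prod>j\<in>UNIV. ?A j) * (\<Prod>j\<in>UNIV. exp (\<mu> j * t $ j))"
    if t: "t \<in> orthant" for t
  proof -
    have t0: "0 \<le> t $ j" for j using t by (simp add: orthant_def)
    have "(\<Sum>S\<in>Pow UNIV. \<Prod>j\<in>UNIV. if j \<in> S then exp (Re (lam0 $ j) * t $ j)
         else (LINT s|lebesgue_on {0..t $ j}. exp (Re (lam0 $ j) * s)))
      = (\<Prod>j\<in>UNIV. exp (Re (lam0 $ j) * t $ j) + exp_primitive (Re (lam0 $ j)) (t $ j))"
      by (rule sum_Pow_exp_eq_prod[OF t])
    also have "\<dots> \<le> (\<Prod>j\<in>UNIV. ?A j * exp (\<mu> j * t $ j))"
    proof (intro prod_mono conjI)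
      fix j
      have "exp_primitive (Re (lam0 $ j)) (t $ j) \<le> exp (\<mu> j * t $ j) / \<mu> j"
        using exp_primitive_mono[OF t0 \<mu>(2)] exp_primitive_le_pos[OF \<mu>(1)] by (rule order_trans)
      moreover have "exp (Re (lam0 $ j) * t $ j) \<le> exp (\<mu> j * t $ j)"
        using \<mu>(2) t0 by (simp add: mult_right_mono)
      ultimately have "exp (Re (lam0 $ j) * t $ j) + exp_primitive (Re (lam0 $ j)) (t $ j)
        \<le> exp (\<mu> j * t $ j) + exp (\<mu> j * t $ j) / \<mu> j" by linarith
      then show "exp (Re (lam0 $ j) * t $ j) + exp_primitive (Re (lam0 $ j)) (t $ j) \<le> ?A j * exp (\<mu> j * t $ j)"
        by (simp add: distrib_right)
    qed (use exp_primitive_nonneg[OF t0] in auto)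
    finally show ?thesis
      using order_trans[OF M(2)[OF t] mult_left_mono[OF _ less_imp_le[OF M(1)]]]
      by (simp add: prod.distrib mult.assoc)
  qed
  moreover have "0 \<le> M * (\<Prod>j\<in>UNIV. ?A j)"
    using M(1) \<mu>(1) by (intro mult_nonneg_nonneg prod_nonneg) (simp_all add: less_imp_le)
  ultimately show ?thesis by blast
qed

lemma has_laplace_unique:
  assumes L: "has_laplace sc P f lam L" "has_laplace sc P f lam L'"
  shows "L = L'"
proof (rule eq_if_p_diff_zero)
  fix p assume p: "p \<in> P"
  have "p (L - L') \<le> 2 * e" if e: "0 < e" for e
  proof -
    obtain M M' where M: "\<And>t. (\<forall>j. M < t $ j) \<Longrightarrow> p (I_lap sc P f lam t - L) < e"
       "\<And>t. (\<forall>j. M' < t $ j) \<Longrightarrow> p (I_lap sc P f lam t - L') < e"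
      using L e p unfolding has_laplace_def by meson
    let ?t = "\<chi> j. max M M' + 1"
    have "p (I_lap sc P f lam ?t - L) < e" "p (I_lap sc P f lam ?t - L') < e"
      by (rule M; simp)+
    then show ?thesis
      using seminorm_triangle_diff[OF p, of L L' "I_lap sc P f lam ?t"] seminorm_diff_commute[OF p, of L] by simp
  qed
  \<comment> \<open>If \<open>p (L - L')\<close> were positive, this choice would bound it by two
    thirds of itself.\<close>
  from this[of "p (L - L') / 3"] show "p (L - L') = 0" using seminorm_nonneg[OF p, of "L - L'"] by force
qed

lemma laplace_eqI: "has_laplace sc P f lam L \<Longrightarrow> laplace sc P f lam = L"
  unfolding laplace_def using has_laplace_unique by blast


text \<open>
  Since \<open>exp (- \<lambda> u) - exp (- \<lambda> (u + h)) = (1 - exp (- \<lambda> h)) * exp (- \<lambda> u)\<close>, the Riemann sums of the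
  left-hand side on a grid of mesh \<open>h\<close> are, up to a factor tending to \<open>1\<close>, integrals of \<open>f\<close> against
  step functions.  This replaces Fubini's theorem for vector-valued functions.
\<close>

lemma I_lap_box_integral:
  fixes t :: "real^'n"
  assumes t: "\<And>j. 0 < t $ j" and f: "lcs_integrable P (cbox 0 t) f"
  shows "sc (\<Prod>j\<in>UNIV. lam $ j) (I_lap sc P (box_integral sc P f) lam t) =
    lcs_integral sc P (cbox 0 t)
      (\<lambda>s. sc (\<Prod>j\<in>UNIV. exp (- (lam $ j) * of_real (s $ j)) - exp (- (lam $ j) * of_real (t $ j))) (f s))"
proof -
  let ?\<phi> = "\<lambda>j x. exp (- (lam $ j) * complex_of_real x)"
  let ?G = "box_integral sc P f"
  have to: "t \<in> orthant" using t by (simp add: orthant_def less_imp_le)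
  define F where "F = exp_weighted sc lam ?G"
  have "seq_continuous_on (cbox 0 t) (\<lambda>s. sc (\<Prod>j\<in>UNIV. ?\<phi> j (s $ j)) (?G s))"
    by (intro seq_continuous_on_scale seq_continuous_on_box_integral f continuous_intros)
  then have F: "seq_continuous_on (cbox 0 t) F"
    by (simp add: F_def exp_weighted_prod[abs_def])
  \<comment> \<open>A crude bound for the exponential weight on the box, enough for the boundedness
    that convergence of Riemann sums asks for.\<close>
  define b where "b = (\<Prod>j\<in>UNIV. exp (\<bar>Re (lam $ j)\<bar> * t $ j))"
  have B: "p (F s) \<le> b * (LINT r|lebesgue_on (cbox 0 t). p (f r))" if p: "p \<in> P" and s: "s \<in> cbox 0 t" for p s
  proof -
    have "- Re (lam $ j) * s $ j \<le> \<bar>Re (lam $ j)\<bar> * t $ j" for j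
      using s by (intro mult_mono) (auto simp: mem_cbox_zero)
    then have "(\<Prod>j\<in>UNIV. exp (- Re (lam $ j) * s $ j)) \<le> b"
      unfolding b_def by (intro prod_mono) simp
    then show ?thesis
      unfolding F_def seminorm_exp_weighted[OF p]
      by (intro mult_mono box_integral_bounded[OF f p s]) (auto simp: b_def seminorm_nonneg[OF p] intro: prod_nonneg)
  qed
  define R where "R N = (\<Sum>k\<in>PiE UNIV (\<lambda>_. {..<N}). sc (of_real (\<Prod>j\<in>UNIV. t $ j / real N)) (F (grid_point t N k)))" for N
  \<comment> \<open>Each factor is \<open>(1 - exp (- \<lambda> * h)) / h\<close> for the mesh
    \<open>h = t $ j / N\<close>: the exact ratio between a step weight and the Riemann weight of
    the same cell. Its limit is \<open>lam $ j\<close>, which is where the product in front of the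
    transform comes from.\<close>
  define q where "q N = (\<Prod>j\<in>UNIV. (1 - exp (- (lam $ j * of_real (t $ j) / of_nat N))) * of_nat N / of_real (t $ j))" for N
  have Riem: "limitin (seminorm_topology P) (\<lambda>n. R (Suc n)) (lcs_integral sc P (cbox 0 t) F) sequentially"
    unfolding R_def by (rule limitin_Riemann_sum[OF t F B])
  have "(\<lambda>n. q (Suc n)) \<longlonglongrightarrow> (\<Prod>j\<in>UNIV. lam $ j * of_real (t $ j) / of_real (t $ j))"
    unfolding q_def using t by (intro tendsto_prod tendsto_divide tendsto_const tendsto_one_minus_exp) (auto simp: less_le)
  also have "(\<Prod>j\<in>UNIV. lam $ j * of_real (t $ j) / of_real (t $ j)) = (\<Prod>j\<in>UNIV. lam $ j)"
    using t by (intro prod.cong) (auto simp: less_le)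
  finally have lim1: "limitin (seminorm_topology P) (\<lambda>n. sc (q (Suc n)) (R (Suc n)))
      (sc (\<Prod>j\<in>UNIV. lam $ j) (lcs_integral sc P (cbox 0 t) F)) sequentially"
    using Riem by (rule limitin_scale)
  have step: "sc (q N) (R N) = lcs_integral sc P (cbox 0 t)
      (\<lambda>s. sc (\<Prod>j\<in>UNIV. step_fun (?\<phi> j) (t $ j) N (s $ j) - ?\<phi> j (t $ j)) (f s))" if N: "0 < N" for N
  proof -
    let ?w = "\<lambda>j. step_weight (?\<phi> j) (t $ j) N"
    have "lcs_integral sc P (cbox 0 t) (\<lambda>s. sc (\<Prod>j\<in>UNIV. step_fun (?\<phi> j) (t $ j) N (s $ j) - ?\<phi> j (t $ j)) (f s))
      = lcs_integral sc P (cbox 0 t)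
         (\<lambda>s. sc (\<Prod>j\<in>UNIV. \<Sum>i\<in>{..<N}. ?w j i * indicator {..t $ j * real i / real N} (s $ j)) (f s))"
    proof (rule lcs_integral_cong)
      fix s assume s: "s \<in> cbox 0 t"
      \<comment> \<open>On the box the top indicator is constantly \<open>1\<close> with weight
        \<open>?\<phi> j (t $ j)\<close>, so subtracting this value removes index \<open>N\<close>.
        What is left runs over the same cells as the Riemann sum.\<close>
      have "step_fun (?\<phi> j) (t $ j) N (s $ j) - ?\<phi> j (t $ j)
         = (\<Sum>i\<in>{..<N}. ?w j i * indicator {..t $ j * real i / real N} (s $ j))" for j
        using s N by (simp add: step_fun_def lessThan_Suc_atMost[symmetric] step_weight_def mem_cbox_zero)
      then show "sc (\<Prod>j\<in>UNIV. step_fun (?\<phi> j) (t $ j) N (s $ j) - ?\<phi> j (t $ j)) (f s)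
        = sc (\<Prod>j\<in>UNIV. \<Sum>i\<in>{..<N}. ?w j i * indicator {..t $ j * real i / real N} (s $ j)) (f s)" by simp
    qed simp
    also have "\<dots> = (\<Sum>k\<in>PiE UNIV (\<lambda>_. {..<N}). sc (\<Prod>j\<in>UNIV. ?w j (k j)) (?G (grid_point t N k)))"
      unfolding grid_point_def
      by (rule lcs_integral_prod_indicators[OF f]) (use grid_bounds[OF less_imp_le[OF t]] N in auto)
    also have "\<dots> = (\<Sum>k\<in>PiE UNIV (\<lambda>_. {..<N}). sc (q N) (sc (of_real (\<Prod>j\<in>UNIV. t $ j / real N)) (F (grid_point t N k))))"
    proof (rule sum.cong)
      fix k :: "'n \<Rightarrow> nat" assume "k \<in> PiE UNIV (\<lambda>_. {..<N})"
      then have k: "k j < N" for j by (auto simp: PiE_iff)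
      have wj: "?w j (k j) = ((1 - exp (- (lam $ j * of_real (t $ j) / of_nat N))) * of_nat N / of_real (t $ j))
          * of_real (t $ j / real N) * ?\<phi> j (grid_point t N k $ j)" for j
      proof -
        have "?w j (k j) = ?\<phi> j (t $ j * real (k j) / real N) - ?\<phi> j (t $ j * real (Suc (k j)) / real N)"
          using k[of j] by (simp only: step_weight_def if_True)
        also have "?\<phi> j (t $ j * real (Suc (k j)) / real N)
            = ?\<phi> j (t $ j * real (k j) / real N) * exp (- (lam $ j * of_real (t $ j) / of_nat N))"
          by (simp add: exp_add[symmetric] distrib_left add_divide_distrib minus_diff_commute)
        finally have w: "?w j (k j) = (1 - exp (- (lam $ j * of_real (t $ j) / of_nat N))) * ?\<phi> j (grid_point t N k $ j)"
          by (simp only: grid_point_def vec_lambda_beta left_diff_distrib mult_1_left mult.commute[of "exp (- (lam $ j * of_real (t $ j) / of_nat N))"])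
        have cancel: "x * of_nat N / of_real (t $ j) * of_real (t $ j / real N) = x" for x :: complex
        proof -
          have "t $ j \<noteq> 0" using t[of j] by simp
          then show ?thesis using N by simp
        qed
        show ?thesis unfolding cancel by (rule w)
      qed
      have "(\<Prod>j\<in>UNIV. ?w j (k j)) = q N * of_real (\<Prod>j\<in>UNIV. t $ j / real N) * (\<Prod>j\<in>UNIV. ?\<phi> j (grid_point t N k $ j))"
        unfolding q_def of_real_prod prod.distrib[symmetric] by (rule prod.cong[OF refl wj])
      then show "sc (\<Prod>j\<in>UNIV. ?w j (k j)) (?G (grid_point t N k))
         = sc (q N) (sc (of_real (\<Prod>j\<in>UNIV. t $ j / real N)) (F (grid_point t N k)))"
        by (simp only: F_def exp_weighted_prod scale_scale mult.assoc)
    qed simp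
    also have "\<dots> = sc (q N) (R N)" by (simp add: R_def scale_sum_right)
    finally show ?thesis by simp
  qed
  have lim2: "limitin (seminorm_topology P)
     (\<lambda>n. lcs_integral sc P (cbox 0 t) (\<lambda>s. sc (\<Prod>j\<in>UNIV. step_fun (?\<phi> j) (t $ j) (Suc n) (s $ j) - ?\<phi> j (t $ j)) (f s)))
     (lcs_integral sc P (cbox 0 t) (\<lambda>s. sc (\<Prod>j\<in>UNIV. ?\<phi> j (s $ j) - ?\<phi> j (t $ j)) (f s))) sequentially"
    by (rule limitin_step_fun[OF to f]) (intro continuous_intros)
  have "sc (\<Prod>j\<in>UNIV. lam $ j) (lcs_integral sc P (cbox 0 t) F) =
     lcs_integral sc P (cbox 0 t) (\<lambda>s. sc (\<Prod>j\<in>UNIV. ?\<phi> j (s $ j) - ?\<phi> j (t $ j)) (f s))"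
    by (rule limitin_Hausdorff_unique[OF lim1[unfolded step[OF zero_less_Suc]] lim2 _ Hausdorff]) simp
  then show ?thesis by (simp add: I_lap_def box_integral_def[of _ _ "exp_weighted _ _ _"] F_def)
qed

text \<open>Every term of the expansion other than the full transform has some coordinate
  \<open>i\<close> frozen at \<open>t $ i\<close>. That factor is
  \<open>exp ((\<mu> i - Re (lam $ i)) * t $ i)\<close> after weighting and decays, while all other
  factors stay bounded uniformly in \<open>t\<close>.\<close>

lemma I_lap_diff_bound:
  fixes t :: "real^'n" and lam :: "complex^'n"
  assumes f: "locally_integrable P f" and p: "p \<in> P" and C: "0 \<le> C"
    and \<mu>: "\<And>j. 0 \<le> \<mu> j" "\<And>j. \<mu> j < Re (lam $ j)"
    and G: "\<And>u. u \<in> orthant \<Longrightarrow> p (box_integral sc P f u) \<le> C * (\<Prod>j\<in>UNIV. exp (\<mu> j * u $ j))"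
    and d: "0 < d" "\<And>j. d \<le> Re (lam $ j) - \<mu> j" and T: "0 < T" "\<And>j. T \<le> t $ j"
  shows "p (I_lap sc P f lam t - sc (\<Prod>j\<in>UNIV. lam $ j) (I_lap sc P (box_integral sc P f) lam t))
    \<le> real (card (Pow (UNIV :: 'n set))) * (C * (\<Prod>j\<in>UNIV. 1 + norm (lam $ j) / (Re (lam $ j) - \<mu> j))) * exp (- d * T)"
proof -
  \<comment> \<open>Endpoint value at most \<open>1\<close>, plus the weighted variation of
    \<open>exp (- \<lambda> * s)\<close> over the whole half-line.\<close>
  let ?D = "\<lambda>j. 1 + norm (lam $ j) / (Re (lam $ j) - \<mu> j)"
  have t: "0 < t $ j" for j using T less_le_trans by blast
  have to: "t \<in> orthant" using t by (simp add: orthant_def less_imp_le)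
  note ft = locally_integrable_cbox[OF f, of t]
  have K: "cbox 0 t \<in> lmeasurable" by simp
  define c where "c X j = (if j \<in> X then 1 else - exp (- (lam $ j) * of_real (t $ j)))" for X j
  define z where "z X j = (if j \<in> X then - (lam $ j) else 0)" for X j
  define \<psi> where "\<psi> X s = (\<Prod>j\<in>UNIV. c X j * exp (z X j * of_real (s $ j)))" for X and s :: "real^'n"
  have expand: "(\<Prod>j\<in>UNIV. exp (- (lam $ j) * of_real (s $ j)) - exp (- (lam $ j) * of_real (t $ j))) = (\<Sum>X\<in>Pow UNIV. \<psi> X s)" for s
  proof -
    have "(\<Prod>j\<in>UNIV. exp (- (lam $ j) * of_real (s $ j)) + (- exp (- (lam $ j) * of_real (t $ j))))
      = (\<Sum>X\<in>Pow UNIV. \<Prod>j\<in>UNIV. if j \<in> X then exp (- (lam $ j) * of_real (s $ j)) else - exp (- (lam $ j) * of_real (t $ j)))"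
      by (subst prod_add) (simp_all add: prod.If_cases Compl_eq_Diff_UNIV)
    also have "\<dots> = (\<Sum>X\<in>Pow UNIV. \<psi> X s)"
      unfolding \<psi>_def by (intro sum.cong prod.cong) (auto simp: c_def z_def)
    finally show ?thesis by simp
  qed
  have int: "lcs_integrable P (cbox 0 t) (\<lambda>s. sc (\<psi> X s) (f s))" for X
    unfolding \<psi>_def by (intro lcs_integrable_continuous_mult ft continuous_intros) simp
  let ?J = "\<lambda>X. lcs_integral sc P (cbox 0 t) (\<lambda>s. sc (\<psi> X s) (f s))"
  have "sc (\<Prod>j\<in>UNIV. lam $ j) (I_lap sc P (box_integral sc P f) lam t)
     = lcs_integral sc P (cbox 0 t) (\<lambda>s. \<Sum>X\<in>Pow UNIV. sc (\<psi> X s) (f s))"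
    unfolding I_lap_box_integral[OF t ft] expand scale_sum_left ..
  also have "\<dots> = (\<Sum>X\<in>Pow UNIV. ?J X)"
    by (rule lcs_integral_sum[OF K int, THEN conjunct2])
  also have "\<dots> = ?J UNIV + (\<Sum>X\<in>Pow UNIV - {UNIV}. ?J X)"
    by (rule sum.remove) auto
  also have "?J UNIV = I_lap sc P f lam t"
    unfolding I_lap_def box_integral_def exp_weighted_prod[abs_def] by (simp add: \<psi>_def c_def z_def)
  finally have "p (I_lap sc P f lam t - sc (\<Prod>j\<in>UNIV. lam $ j) (I_lap sc P (box_integral sc P f) lam t))
     = p (\<Sum>X\<in>Pow UNIV - {UNIV}. ?J X)"
    using seminorm_minus[OF p, of "\<Sum>X\<in>Pow UNIV - {UNIV}. ?J X"] by simp
  also have "\<dots> \<le> (\<Sum>X\<in>Pow UNIV - {UNIV}. p (?J X))" by (rule seminorm_sum[OF p])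
  also have "\<dots> \<le> (\<Sum>X\<in>Pow (UNIV :: 'n set) - {UNIV}. C * (\<Prod>j\<in>UNIV. ?D j) * exp (- d * T))"
  proof (rule sum_mono)
    fix X :: "'n set" assume "X \<in> Pow UNIV - {UNIV}"
    then obtain i where i: "i \<notin> X" by auto
    let ?b = "\<lambda>j. norm (c X j) * (exp ((Re (z X j) + \<mu> j) * t $ j) + norm (z X j) * exp_primitive (Re (z X j) + \<mu> j) (t $ j))"
    have D1: "1 \<le> ?D j" for j using \<mu>(2)[of j] by simp
    have e1: "exp ((\<mu> j - Re (lam $ j)) * t $ j) \<le> 1" for j
      using \<mu>(2)[of j] t[of j] by (simp add: mult_nonpos_nonneg less_imp_le)
    have b0: "0 \<le> ?b j" for j
      using exp_primitive_nonneg[OF less_imp_le[OF t]] by (intro mult_nonneg_nonneg add_nonneg_nonneg) auto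
    have bX: "?b j = exp ((\<mu> j - Re (lam $ j)) * t $ j)" if "j \<notin> X" for j
      using that by (simp add: c_def z_def exp_add[symmetric] algebra_simps)
    have bD: "?b j \<le> ?D j" for j
    proof (cases "j \<in> X")
      case True
      have "exp_primitive (\<mu> j - Re (lam $ j)) (t $ j) \<le> 1 / (Re (lam $ j) - \<mu> j)"
        using exp_primitive_le_neg[of "\<mu> j - Re (lam $ j)" "t $ j"] \<mu>(2)[of j] by simp
      then have "norm (lam $ j) * exp_primitive (\<mu> j - Re (lam $ j)) (t $ j) \<le> norm (lam $ j) * (1 / (Re (lam $ j) - \<mu> j))"
        by (rule mult_left_mono) simp
      from add_mono[OF e1[of j] this] True show ?thesis by (simp add: c_def z_def)
    next
      case False
      show ?thesis using bX[OF False] e1[of j] D1[of j] by linarith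
    qed
    have bi: "?b i \<le> exp (- d * T) * ?D i"
    proof -
      have "d * T \<le> (Re (lam $ i) - \<mu> i) * t $ i"
        using d T \<mu>(2)[of i] by (intro mult_mono) auto
      then have "?b i \<le> exp (- d * T)" unfolding bX[OF i] by (simp add: left_diff_distrib)
      also have "\<dots> \<le> exp (- d * T) * ?D i" using D1[of i] by (simp add: mult_le_cancel_left1)
      finally show ?thesis .
    qed
    have "p (?J X) \<le> C * (\<Prod>j\<in>UNIV. ?b j)"
      unfolding \<psi>_def by (rule lcs_integral_exp_bound[OF to ft p C \<mu>(1) G])
    also have "\<dots> \<le> C * ((\<Prod>j\<in>UNIV. ?D j) * exp (- d * T))"
    proof (rule mult_left_mono[OF _ C])
      have "(\<Prod>j\<in>UNIV. ?b j) = ?b i * (\<Prod>j\<in>UNIV - {i}. ?b j)" by (rule prod.remove) auto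
      also have "\<dots> \<le> (exp (- d * T) * ?D i) * (\<Prod>j\<in>UNIV - {i}. ?D j)"
        using D1 by (intro mult_mono bi prod_mono conjI b0 bD prod_nonneg mult_nonneg_nonneg)
          (auto intro: order_trans[OF zero_le_one])
      also have "\<dots> = exp (- d * T) * (\<Prod>j\<in>UNIV. ?D j)"
        by (subst prod.remove[of UNIV i]) auto
      finally show "(\<Prod>j\<in>UNIV. ?b j) \<le> (\<Prod>j\<in>UNIV. ?D j) * exp (- d * T)" by (simp add: mult.commute)
    qed
    finally show "p (?J X) \<le> C * (\<Prod>j\<in>UNIV. ?D j) * exp (- d * T)" by (simp add: mult.assoc)
  qed
  also have "\<dots> = real (card (Pow (UNIV :: 'n set) - {UNIV})) * (C * (\<Prod>j\<in>UNIV. ?D j) * exp (- d * T))"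
    by simp
  also have "\<dots> \<le> real (card (Pow (UNIV :: 'n set))) * (C * (\<Prod>j\<in>UNIV. ?D j) * exp (- d * T))"
    using C \<mu>(2) by (intro mult_right_mono mult_nonneg_nonneg prod_nonneg) (auto intro!: card_mono simp: less_imp_le)
  finally show ?thesis by (simp add: mult.assoc)
qed

text \<open>Boxes with unequal sides are compared with the cube of side \<open>N\<close> inside
  them. The error is at most the integral of \<open>h\<close> outside that cube, whatever the box.
  Hence the values on cubes form a Cauchy sequence, so sequential completeness suffices, and the
  same tail bound upgrades their limit to the joint limit.\<close>

lemma has_laplace_dominated:
  fixes g :: "real^'n \<Rightarrow> 'x"
  assumes g: "locally_integrable P g"
    and dom: "\<And>p. p \<in> P \<Longrightarrow> \<exists>h. integrable (lebesgue_on orthant) h \<and>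
      (\<forall>s\<in>orthant. p (exp_weighted sc lam g s) \<le> h s)"
  shows "\<exists>L. has_laplace sc P g lam L"
proof -
  define Q where "Q N = cbox 0 (\<chi> j. real N :: real^'n)" for N
  let ?I = "I_lap sc P g lam"
  have tail: "\<exists>T. T \<longlonglongrightarrow> 0 \<and> (\<forall>N t. (\<forall>j. real N \<le> t $ j) \<longrightarrow> p (?I t - ?I (\<chi> j. real N)) \<le> T N)"
    if p: "p \<in> P" for p
  proof -
    obtain h where h: "integrable (lebesgue_on orthant) h" "\<And>s. s \<in> orthant \<Longrightarrow> p (exp_weighted sc lam g s) \<le> h s"
      using dom[OF p] by blast
    have h0: "0 \<le> h s" if "s \<in> orthant" for s using order_trans[OF seminorm_nonneg[OF p] h(2)[OF that]] .
    define T where "T N = (LINT s|lebesgue_on orthant. indicator (- Q N) s * h s)" for N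
    have Tint: "integrable (lebesgue_on orthant) (\<lambda>s. indicator (- Q N) s * h s)" for N
    proof (rule Bochner_Integration.integrable_bound[OF h(1)])
      have "(indicator (- Q N) :: real^'n \<Rightarrow> real) \<in> borel_measurable (lebesgue_on orthant)"
        by (rule borel_imp_lebesgue_on) (simp add: Q_def)
      then show "(\<lambda>s. indicator (- Q N) s * h s) \<in> borel_measurable (lebesgue_on orthant)"
        using h(1) by simp
    qed (auto split: split_indicator)
    have "T \<longlonglongrightarrow> (LINT s|lebesgue_on (orthant :: (real^'n) set). 0)"
      unfolding T_def
    proof (rule integral_dominated_convergence[where w = h])
      show "AE s in lebesgue_on orthant. norm (indicator (- Q N) s * h s) \<le> h s" for N
        using h0 by (intro AE_I2) (auto simp: space_restrict_space split: split_indicator)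
      show "AE s in lebesgue_on orthant. (\<lambda>N. indicator (- Q N) s * h s) \<longlonglongrightarrow> 0"
      proof (rule AE_I2)
        fix s :: "real^'n" assume "s \<in> space (lebesgue_on orthant)"
        then have s: "0 \<le> s $ j" for j by (simp add: space_restrict_space orthant_def)
        obtain M :: nat where M: "norm s \<le> real M" using real_arch_simple by blast
        have "\<forall>\<^sub>F N in sequentially. indicator (- Q N) s * h s = 0"
          using eventually_ge_at_top[of M]
        proof eventually_elim
          fix N assume "M \<le> N"
          then have "s $ j \<le> real N" for j
            using component_le_norm_cart[of s j] M by linarith
          then show "indicator (- Q N) s * h s = 0" using s by (simp add: Q_def mem_cbox_zero)
        qed
        then show "(\<lambda>N. indicator (- Q N) s * h s) \<longlonglongrightarrow> 0" by (rule tendsto_eventually)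
      qed
    qed (use Tint h(1) in auto)
    then have "T \<longlonglongrightarrow> 0" by simp
    moreover have "p (?I t - ?I (\<chi> j. real N)) \<le> T N" if t: "\<forall>j. real N \<le> t $ j" for N t
    proof -
      let ?F = "exp_weighted sc lam g"
      have K: "cbox 0 t \<in> lmeasurable" by simp
      note F = lcs_integrable_exp_weighted[OF locally_integrable_cbox[OF g, of t], of lam]
      have u: "(\<chi> j. real N) \<in> cbox 0 t" using t by (simp add: mem_cbox_zero)
      have i: "lcs_integrable P (cbox 0 t) (\<lambda>s. sc (indicator (Q N) s) (?F s))"
        by (rule lcs_integrable_bounded_mult[OF K F, of _ 1])
          (auto intro: borel_imp_lebesgue_on simp: Q_def split: split_indicator)
      \<comment> \<open>Both values are expressed over the larger box, so that the difference is one
        integral supported off the cube.\<close>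
      have "?I t - ?I (\<chi> j. real N) = lcs_integral sc P (cbox 0 t) (\<lambda>s. ?F s - sc (indicator (Q N) s) (?F s))"
        using lcs_integral_diff[OF K F i] box_integral_indicator[OF F u]
        by (simp add: I_lap_def box_integral_def Q_def)
      also have "p \<dots> \<le> (LINT s|lebesgue_on (cbox 0 t). p (?F s - sc (indicator (Q N) s) (?F s)))"
        by (rule lcs_integral_norm_bound[OF K lcs_integrable_diff[OF K F i] p])
      also have "\<dots> \<le> T N"
        using lcs_integrable_seminorm[OF K lcs_integrable_diff[OF K F i] p] Tint[of N] cbox_zero_subset_orthant[of t]
        unfolding T_def
        by (simp add: integral_restrict_space integrable_restrict_space)
          (rule integral_mono, auto simp: seminorm_zero[OF p] h0 h(2) subset_eq split: split_indicator)
      finally show ?thesis .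
    qed
    ultimately show ?thesis by blast
  qed
  have "\<exists>L. limitin (seminorm_topology P) (\<lambda>N. ?I (\<chi> j. real N)) L sequentially"
  proof (rule sequentially_complete, intro ballI allI impI)
    fix p and e :: real assume p: "p \<in> P" and e: "0 < e"
    obtain T where T: "T \<longlonglongrightarrow> 0" "\<And>N t. (\<forall>j. real N \<le> t $ j) \<Longrightarrow> p (?I t - ?I (\<chi> j. real N)) \<le> T N"
      using tail[OF p] by blast
    obtain N where N: "T N < e / 2"
      using order_tendstoD(2)[OF T(1), of "e / 2"] e by (auto simp: eventually_sequentially)
    have "p (?I (\<chi> j. real k) - ?I (\<chi> j. real m)) < e" if "N \<le> k" "N \<le> m" for k m
    proof -
      have "p (?I (\<chi> j. real k) - ?I (\<chi> j. real N)) \<le> T N" "p (?I (\<chi> j. real m) - ?I (\<chi> j. real N)) \<le> T N"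
        using that by (auto intro!: T(2))
      then show ?thesis
        using N seminorm_triangle_diff[OF p, of "?I (\<chi> j. real k)" "?I (\<chi> j. real m)" "?I (\<chi> j. real N)"]
          seminorm_diff_commute[OF p, of "?I (\<chi> j. real N)" "?I (\<chi> j. real m)"] by linarith
    qed
    then show "\<exists>N. \<forall>k\<ge>N. \<forall>m\<ge>N. p (?I (\<chi> j. real k) - ?I (\<chi> j. real m)) < e" by blast
  qed
  then obtain L where L: "limitin (seminorm_topology P) (\<lambda>N. ?I (\<chi> j. real N)) L sequentially" by blast
  have "has_laplace sc P g lam L"
    unfolding has_laplace_def
  proof (intro allI impI ballI)
    fix e :: real and p assume e: "0 < e" and p: "p \<in> P"
    obtain T where T: "T \<longlonglongrightarrow> 0" "\<And>N t. (\<forall>j. real N \<le> t $ j) \<Longrightarrow> p (?I t - ?I (\<chi> j. real N)) \<le> T N"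
      using tail[OF p] by blast
    have "\<forall>\<^sub>F N in sequentially. T N < e / 2 \<and> p (?I (\<chi> j. real N) - L) < e / 2 \<and> 1 \<le> N"
      using order_tendstoD(2)[OF T(1), of "e / 2"] order_tendstoD(2)[of _ 0 _ "e / 2"] L e p
      unfolding limitin_iff by (intro eventually_conj eventually_ge_at_top) auto
    then obtain N where N: "T N < e / 2" "p (?I (\<chi> j. real N) - L) < e / 2" "1 \<le> N"
      by (auto simp: eventually_sequentially)
    have "p (?I t - L) < e" if "\<forall>j. real N < t $ j" for t
      using T(2)[of N t] N(1,2) that seminorm_triangle_diff[OF p, of "?I t" L "?I (\<chi> j. real N)"] by (simp add: less_imp_le)
    then show "\<exists>M>0. \<forall>t. (\<forall>j. M < t $ j) \<longrightarrow> p (?I t - L) < e"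
      using N(3) by (intro exI[of _ "real N"]) auto
  qed
  then show ?thesis by blast
qed


text \<open>The theorem prescribes \<open>G\<close> only on \<open>orthant\<close>; this lets
  \<open>box_integral sc P f\<close> stand in for it.\<close>

lemma orthant_cong:
  fixes g h :: "real^'n \<Rightarrow> 'x"
  assumes eq: "\<And>t. t \<in> orthant \<Longrightarrow> g t = h t"
  shows "Omega_abs sc P g = Omega_abs sc P h" and "laplace sc P g = laplace sc P h"
proof -
  have w: "exp_weighted sc lam g s = exp_weighted sc lam h s" if "s \<in> orthant" for lam s
    using eq[OF that] by (simp add: exp_weighted_def)
  have "lcs_integrable P K g = lcs_integrable P K h" if "compact K" "K \<subseteq> orthant" for K
    using that eq by (intro lcs_integrable_cong lmeasurable_compact) auto
  then have "locally_integrable P g = locally_integrable P h"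
    by (auto simp: locally_integrable_def)
  moreover have "(\<integral>\<^sup>+ t. ennreal (p (exp_weighted sc lam g t)) \<partial>lebesgue_on orthant)
      = (\<integral>\<^sup>+ t. ennreal (p (exp_weighted sc lam h t)) \<partial>lebesgue_on orthant)" for p lam
    by (rule nn_integral_cong) (simp add: space_restrict_space w)
  ultimately show "Omega_abs sc P g = Omega_abs sc P h" by (simp add: Omega_abs_def)
  have "I_lap sc P g lam t = I_lap sc P h lam t" for lam t
    unfolding I_lap_def box_integral_def
    using cbox_zero_subset_orthant[of t] by (intro lcs_integral_cong w) auto
  then show "laplace sc P g = laplace sc P h"
    by (simp add: laplace_def has_laplace_def fun_eq_iff)
qed

lemma property_P_imp_laplace:
  fixes f :: "real^'n \<Rightarrow> 'x"
  assumes f: "locally_integrable P f" and P: "property_P sc P f lam0"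
    and lam: "\<And>j. max (Re (lam0 $ j)) 0 < Re (lam $ j)"
  shows "lam \<in> Omega_abs sc P (box_integral sc P f)" and "lam \<in> Omega sc P f" and "lam \<in> Omega_b sc P f"
    and "laplace sc P f lam = sc (\<Prod>j\<in>UNIV. lam $ j) (laplace sc P (box_integral sc P f) lam)"
proof -
  let ?G = "box_integral sc P f" and ?\<Lambda> = "\<Prod>j\<in>UNIV. lam $ j"
  \<comment> \<open>The midpoint leaves room on both sides: \<open>\<mu> j\<close> is positive and
    at least \<open>Re (lam0 $ j)\<close>, as needed to bound the primitive, and the gap
    \<open>\<delta> j\<close> to \<open>Re (lam $ j)\<close> gives exponential decay.\<close>
  define \<mu> where "\<mu> j = (max (Re (lam0 $ j)) 0 + Re (lam $ j)) / 2" for j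
  have \<mu>: "0 < \<mu> j" "Re (lam0 $ j) \<le> \<mu> j" "\<mu> j < Re (lam $ j)" for j
    using lam[of j] by (auto simp: \<mu>_def)
  define \<delta> where "\<delta> j = Re (lam $ j) - \<mu> j" for j
  have \<delta>: "0 < \<delta> j" for j using \<mu>(3)[of j] by (simp add: \<delta>_def)
  have bound: "\<exists>C\<ge>0. \<forall>t\<in>orthant. p (?G t) \<le> C * (\<Prod>j\<in>UNIV. exp (\<mu> j * t $ j))" if "p \<in> P" for p
    by (rule property_P_exp_bound[OF P that \<mu>(1,2)])
  have G: "locally_integrable P ?G" by (rule locally_integrable_box_integral[OF f])
  have dom: "\<exists>h. integrable (lebesgue_on orthant) h \<and> (\<forall>s\<in>orthant. p (exp_weighted sc lam ?G s) \<le> h s)"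
    if p: "p \<in> P" for p
  proof -
    obtain C where C: "\<And>t. t \<in> orthant \<Longrightarrow> p (?G t) \<le> C * (\<Prod>j\<in>UNIV. exp (\<mu> j * t $ j))"
      using bound[OF p] by blast
    have "p (exp_weighted sc lam ?G s) \<le> C * (\<Prod>j\<in>UNIV. exp (- \<delta> j * s $ j))" if s: "s \<in> orthant" for s
    proof -
      have "p (exp_weighted sc lam ?G s) \<le> (\<Prod>j\<in>UNIV. exp (- Re (lam $ j) * s $ j)) * (C * (\<Prod>j\<in>UNIV. exp (\<mu> j * s $ j)))"
        unfolding seminorm_exp_weighted[OF p] using C[OF s] by (intro mult_left_mono) (auto intro: prod_nonneg)
      also have "\<dots> = C * ((\<Prod>j\<in>UNIV. exp (- Re (lam $ j) * s $ j)) * (\<Prod>j\<in>UNIV. exp (\<mu> j * s $ j)))"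
        by simp
      also have "(\<Prod>j\<in>UNIV. exp (- Re (lam $ j) * s $ j)) * (\<Prod>j\<in>UNIV. exp (\<mu> j * s $ j))
          = (\<Prod>j\<in>UNIV. exp (- \<delta> j * s $ j))"
        by (simp add: prod.distrib[symmetric] exp_add[symmetric] \<delta>_def algebra_simps)
      finally show ?thesis .
    qed
    moreover have "integrable (lebesgue_on orthant) (\<lambda>s :: real^'n. C * (\<Prod>j\<in>UNIV. exp (- \<delta> j * s $ j)))"
      by (intro integrable_mult_right integrable_exp_orthant \<delta>)
    ultimately show ?thesis by (intro exI conjI ballI)
  qed
  show "lam \<in> Omega_abs sc P ?G"
    unfolding Omega_abs_def
  proof (intro CollectI conjI G ballI)
    fix p assume "p \<in> P"
    then obtain h where h: "integrable (lebesgue_on orthant) h"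
        "\<And>s. s \<in> orthant \<Longrightarrow> p (exp_weighted sc lam ?G s) \<le> h s"
      using dom by blast
    have "(\<integral>\<^sup>+ t. ennreal (p (exp_weighted sc lam ?G t)) \<partial>lebesgue_on orthant)
        \<le> (\<integral>\<^sup>+ t. ennreal (norm (h t)) \<partial>lebesgue_on orthant)"
      using h(2) by (intro nn_integral_mono ennreal_leI) (force simp: space_restrict_space)
    also have "\<dots> < \<infinity>" using h(1) by (simp add: integrable_iff_bounded)
    finally show "(\<integral>\<^sup>+ t. ennreal (p (exp_weighted sc lam ?G t)) \<partial>lebesgue_on orthant) < \<infinity>" .
  qed
  obtain L where L: "has_laplace sc P ?G lam L"
    using has_laplace_dominated[OF G dom] by blast
  \<comment> \<open>The least gap over the finitely many coordinates, a common decay rate whichever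
    coordinate happens to be frozen.\<close>
  define d where "d = Min (range \<delta>)"
  have d: "0 < d" "d \<le> \<delta> j" for j using \<delta> by (auto simp: d_def)
  have fL: "has_laplace sc P f lam (sc ?\<Lambda> L)"
    unfolding has_laplace_def
  proof (intro allI impI ballI)
    fix e :: real and p assume e: "0 < e" and p: "p \<in> P"
    obtain C where C: "0 \<le> C" "\<And>t. t \<in> orthant \<Longrightarrow> p (?G t) \<le> C * (\<Prod>j\<in>UNIV. exp (\<mu> j * t $ j))"
      using bound[OF p] by blast
    let ?B = "real (card (Pow (UNIV :: 'n set))) * (C * (\<Prod>j\<in>UNIV. 1 + norm (lam $ j) / (Re (lam $ j) - \<mu> j)))"
    have "filterlim (\<lambda>T. - d * T) at_bot at_top"
      using d(1) by (auto simp: filterlim_uminus_at_bot intro!: filterlim_tendsto_pos_mult_at_top[OF tendsto_const] filterlim_ident)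
    then have "((\<lambda>T. ?B * exp (- d * T)) \<longlongrightarrow> ?B * 0) at_top"
      by (intro tendsto_mult tendsto_const filterlim_compose[OF exp_at_bot])
    then have "\<forall>\<^sub>F T in at_top. ?B * exp (- d * T) < e / 2"
      using e by (intro order_tendstoD(2)) auto
    then have "\<forall>\<^sub>F T in at_top. ?B * exp (- d * T) < e / 2 \<and> 0 < T"
      using eventually_gt_at_top[of 0] by (rule eventually_conj)
    then obtain T where T: "?B * exp (- d * T) < e / 2" "0 < T"
      using eventually_happens'[OF trivial_limit_at_top_linorder] by blast
    \<comment> \<open>Adding \<open>1\<close> to the norm keeps the denominator positive without
      examining the product.\<close>
    have "0 < e / (2 * (norm ?\<Lambda> + 1))" using e by (simp add: add_nonneg_pos)
    then obtain M where M: "0 < M" "\<And>t. (\<forall>j. M < t $ j) \<Longrightarrow> p (I_lap sc P ?G lam t - L) < e / (2 * (norm ?\<Lambda> + 1))"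
      using L p unfolding has_laplace_def by blast
    have "p (I_lap sc P f lam t - sc ?\<Lambda> L) < e" if t: "\<forall>j. max T M < t $ j" for t
    proof -
      have "p (I_lap sc P f lam t - sc ?\<Lambda> (I_lap sc P ?G lam t)) \<le> ?B * exp (- d * T)"
        using t d(2) \<mu> T(2)
        by (intro I_lap_diff_bound[OF f p C(1) _ _ C(2) d(1)]) (auto simp: \<delta>_def less_imp_le)
      moreover have "p (sc ?\<Lambda> (I_lap sc P ?G lam t) - sc ?\<Lambda> L) \<le> e / 2"
      proof -
        have "p (sc ?\<Lambda> (I_lap sc P ?G lam t) - sc ?\<Lambda> L) = norm ?\<Lambda> * p (I_lap sc P ?G lam t - L)"
          by (simp add: scale_right_diff_distrib[symmetric] seminorm_scale[OF p])
        also have "\<dots> \<le> (norm ?\<Lambda> + 1) * (e / (2 * (norm ?\<Lambda> + 1)))"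
          using M(2)[of t] t by (intro mult_mono) (auto simp: seminorm_nonneg[OF p] less_imp_le)
        also have "\<dots> = e / 2"
        proof -
          have "0 < norm ?\<Lambda> + 1" by (simp add: add_nonneg_pos)
          then show ?thesis by (simp add: field_simps)
        qed
        finally show ?thesis .
      qed
      ultimately show ?thesis
        using T(1) seminorm_triangle_diff[OF p, of "I_lap sc P f lam t" "sc ?\<Lambda> L" "sc ?\<Lambda> (I_lap sc P ?G lam t)"] by linarith
    qed
    then show "\<exists>M>0. \<forall>t. (\<forall>j. M < t $ j) \<longrightarrow> p (I_lap sc P f lam t - sc ?\<Lambda> L) < e"
      using T(2) M(1) by (intro exI[of _ "max T M"]) auto
  qed
  then show "lam \<in> Omega sc P f" using f by (auto simp: Omega_def)
  show "laplace sc P f lam = sc ?\<Lambda> (laplace sc P ?G lam)"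
    using laplace_eqI[OF fL] laplace_eqI[OF L] by simp
  show "lam \<in> Omega_b sc P f"
    unfolding Omega_b_def
  proof (intro CollectI conjI f ballI)
    fix p assume p: "p \<in> P"
    obtain C where C: "0 \<le> C" "\<And>t. t \<in> orthant \<Longrightarrow> p (?G t) \<le> C * (\<Prod>j\<in>UNIV. exp (\<mu> j * t $ j))"
      using bound[OF p] by blast
    \<comment> \<open>The product bound applied directly with exponents \<open>- (lam $ j)\<close>:
      after weighting they have real part \<open>- \<delta> j\<close>, so the exponentials are at
      most \<open>1\<close> and the primitives at most \<open>1 / \<delta> j\<close>, independently
      of \<open>t\<close>.\<close>
    have "p (I_lap sc P f lam t) \<le> C * (\<Prod>j\<in>UNIV. 1 + norm (lam $ j) * (1 / \<delta> j))" if t: "t \<in> orthant" for t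
    proof -
      have t0: "0 \<le> t $ j" for j using t by (simp add: orthant_def)
      have "p (I_lap sc P f lam t) = p (lcs_integral sc P (cbox 0 t)
          (\<lambda>s. sc (\<Prod>j\<in>UNIV. 1 * exp (- (lam $ j) * of_real (s $ j))) (f s)))"
        by (simp add: I_lap_def box_integral_def exp_weighted_prod[abs_def])
      also have "\<dots> \<le> C * (\<Prod>j\<in>UNIV. norm (1 :: complex) * (exp ((Re (- (lam $ j)) + \<mu> j) * t $ j)
          + norm (- (lam $ j)) * exp_primitive (Re (- (lam $ j)) + \<mu> j) (t $ j)))"
        by (rule lcs_integral_exp_bound[OF t locally_integrable_cbox[OF f] p C(1) less_imp_le[OF \<mu>(1)] C(2)])
      also have "\<dots> \<le> C * (\<Prod>j\<in>UNIV. 1 + norm (lam $ j) * (1 / \<delta> j))"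
      proof (intro mult_left_mono[OF _ C(1)] prod_mono conjI)
        fix j
        have "exp (- \<delta> j * t $ j) \<le> 1" using \<delta>[of j] t0[of j] by simp
        moreover have "norm (lam $ j) * exp_primitive (- \<delta> j) (t $ j) \<le> norm (lam $ j) * (1 / \<delta> j)"
          using exp_primitive_le_neg[of "- \<delta> j" "t $ j"] \<delta>[of j] by (intro mult_left_mono) auto
        moreover have "Re (- (lam $ j)) + \<mu> j = - \<delta> j" by (simp add: \<delta>_def)
        ultimately show "norm (1 :: complex) * (exp ((Re (- (lam $ j)) + \<mu> j) * t $ j)
          + norm (- (lam $ j)) * exp_primitive (Re (- (lam $ j)) + \<mu> j) (t $ j)) \<le> 1 + norm (lam $ j) * (1 / \<delta> j)"
          by (simp only: norm_one mult_1_left norm_minus_cancel add_mono)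
      qed (use exp_primitive_nonneg[OF t0] in auto)
      finally show ?thesis .
    qed
    then show "\<exists>B. \<forall>t\<in>orthant. p (I_lap sc P f lam t) \<le> B" by blast
  qed
qed

end

theorem theorem2p10:
  fixes sc :: "complex \<Rightarrow> 'x::ab_group_add \<Rightarrow> 'x"
    and P :: "('x \<Rightarrow> real) set"
    and f G :: "real^'n \<Rightarrow> 'x"
  assumes "sclcs sc P"
    and "CARD('n) \<ge> 2"
    and "locally_integrable P f"
    and "\<forall>t\<in>orthant. G t = box_integral sc P f t"
  shows
    "(\<forall>lam0. lam0 \<in> Omega_abs sc P f \<longrightarrow>
        (\<forall>p\<in>P. \<exists>M::real. M > 0 \<and> (\<forall>t\<in>orthant.
           (\<integral>\<^sup>+ s. ennreal (p (f s)) \<partial>lebesgue_on (cbox 0 t))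
             \<le> ennreal (M * exp (\<Sum>j\<in>UNIV. max 0 (Re (lam0 $ j)) * t $ j)))))
     \<and> (\<forall>lam0. lam0 \<in> Omega_b sc P f \<longrightarrow> property_P sc P f lam0)
     \<and> (\<forall>lam0 lam. property_P sc P f lam0 \<and> (\<forall>j. Re (lam $ j) > max (Re (lam0 $ j)) 0) \<longrightarrow>
          lam \<in> Omega_abs sc P G
          \<and> lam \<in> Omega sc P f \<inter> Omega_b sc P f
          \<and> laplace sc P f lam = sc (\<Prod>j\<in>UNIV. lam $ j) (laplace sc P G lam))"
proof -
  interpret sclcs sc P by fact
  have f: "locally_integrable P f" by fact
  have G: "\<And>t. t \<in> orthant \<Longrightarrow> G t = box_integral sc P f t" using assms(4) by blast
  have cong: "Omega_abs sc P G = Omega_abs sc P (box_integral sc P f)"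
    "laplace sc P G = laplace sc P (box_integral sc P f)"
    by (rule orthant_cong, erule G)+
  show ?thesis
    unfolding cong
  proof (intro conjI)
    show "\<forall>lam0. lam0 \<in> Omega_abs sc P f \<longrightarrow> (\<forall>p\<in>P. \<exists>M>0. \<forall>t\<in>orthant.
        (\<integral>\<^sup>+ s. ennreal (p (f s)) \<partial>lebesgue_on (cbox 0 t))
          \<le> ennreal (M * exp (\<Sum>j\<in>UNIV. max 0 (Re (lam0 $ j)) * t $ j)))"
      by (intro allI impI ballI nn_integral_seminorm_le_exp)
    show "\<forall>lam0. lam0 \<in> Omega_b sc P f \<longrightarrow> property_P sc P f lam0"
      by (intro allI impI Omega_b_imp_property_P)
  next
    show "\<forall>lam0 lam. property_P sc P f lam0 \<and> (\<forall>j. max (Re (lam0 $ j)) 0 < Re (lam $ j)) \<longrightarrow>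
        lam \<in> Omega_abs sc P (box_integral sc P f) \<and> lam \<in> Omega sc P f \<inter> Omega_b sc P f
        \<and> laplace sc P f lam = sc (\<Prod>j\<in>UNIV. lam $ j) (laplace sc P (box_integral sc P f) lam)"
    proof (intro allI impI)
      fix lam0 lam
      assume "property_P sc P f lam0 \<and> (\<forall>j. max (Re (lam0 $ j)) 0 < Re (lam $ j))"
      then have P: "property_P sc P f lam0" and lam: "\<And>j. max (Re (lam0 $ j)) 0 < Re (lam $ j)"
        by blast+
      show "lam \<in> Omega_abs sc P (box_integral sc P f) \<and> lam \<in> Omega sc P f \<inter> Omega_b sc P f
          \<and> laplace sc P f lam = sc (\<Prod>j\<in>UNIV. lam $ j) (laplace sc P (box_integral sc P f) lam)"
        by (intro conjI IntI property_P_imp_laplace[OF f P lam])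
    qed
  qed
qed

end
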